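(* Let $0<\beta<1$ and suppose that all eigenvalues of the operator $T_\beta$ are simple. Let $u_0\in L^2(0,1)$, and let $u$ be the solution of the problem $$u_t+u_{xxx}=0\quad (x\in(0,1),\ t>0),$$ $$u(0,t)=u(1,t)=0,\quad u_x(1,t)=\beta u_x(0,t)\quad (t>0),\qquad u(\cdot,0)=u_0 .$$ Then, for all $t>0$, $u(\cdot,t)\in C^\infty[0,1]$.
   Context: The operator $T_\beta=(-i\partial_x)^3$ acts on $L^2(0,1)$ with domain $\mathcal D_\beta=\{v\in H^3(0,1): v(0)=v(1)=0,\ v_x(1)=\beta v_x(0)\}$, so that formally $-u_{xxx}=iT_\beta u$. The problem is well-posed in $L^2(0,1)$, and its solution is $u(\cdot,t)=S(t)u_0$, where $S(t)$ is the $C_0$-semigroup on $L^2(0,1)$ generated by $iT_\beta$ with domain $\mathcal D_\beta$. Simple eigenvalue means of algebraic multiplicity one. $u(\cdot,t)\in C^\infty[0,1]$ means that the $L^2(0,1)$ class $u(\cdot,t)$ has a representative that is infinitely differentiable on the closed interval $[0,1]$. *)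

theory Defs
  imports "HOL-Analysis.Analysis"
begin

abbreviation unit_measure :: "real measure"
  where "unit_measure \<equiv> lebesgue_on {0<..<1}"

definition square_integrable :: "(real \<Rightarrow> complex) \<Rightarrow> bool"
  where "square_integrable f \<longleftrightarrow>
    f \<in> borel_measurable unit_measure \<and> integrable unit_measure (\<lambda>x. (cmod (f x))\<^sup>2)"

lemma square_integrableD:
  "square_integrable f \<Longrightarrow> f \<in> borel_measurable unit_measure"
  by (simp add: square_integrable_def)

lemma square_integrable_0: "square_integrable (\<lambda>_. 0)"
  by (simp add: square_integrable_def)

lemma square_integrable_add:
  assumes f: "square_integrable f" and g: "square_integrable g"
  shows "square_integrable (\<lambda>x. f x + g x)"
proof -
  note [measurable] = square_integrableD[OF f] square_integrableD[OF g]
  have i: "integrable unit_measure (\<lambda>x. 2 * (cmod (f x))\<^sup>2 + 2 * (cmod (g x))\<^sup>2)"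
    using f g by (auto simp: square_integrable_def)
  have b: "(cmod (f x + g x))\<^sup>2 \<le> 2 * (cmod (f x))\<^sup>2 + 2 * (cmod (g x))\<^sup>2" for x
  proof -
    have "(cmod (f x + g x))\<^sup>2 \<le> (cmod (f x) + cmod (g x))\<^sup>2"
      by (intro power_mono norm_triangle_ineq) auto
    also have "\<dots> \<le> 2 * (cmod (f x))\<^sup>2 + 2 * (cmod (g x))\<^sup>2"
      using sum_squares_bound[of "cmod (f x)" "cmod (g x)"] by (simp add: power2_sum)
    finally show ?thesis .
  qed
  have "integrable unit_measure (\<lambda>x. (cmod (f x + g x))\<^sup>2)"
    by (rule Bochner_Integration.integrable_bound[OF i]) (use b in \<open>auto intro!: AE_I2 order_trans[OF b]\<close>)
  then show ?thesis
    by (simp add: square_integrable_def)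
qed

lemma square_integrable_scale:
  "square_integrable f \<Longrightarrow> square_integrable (\<lambda>x. c * f x)"
  by (auto simp: square_integrable_def norm_mult power_mult_distrib)

lemma integrable_inner_square:
  assumes f: "square_integrable f" and g: "square_integrable g"
  shows "integrable unit_measure (\<lambda>x. f x \<bullet> g x)"
proof -
  note [measurable] = square_integrableD[OF f] square_integrableD[OF g]
  have i: "integrable unit_measure (\<lambda>x. (cmod (f x))\<^sup>2 + (cmod (g x))\<^sup>2)"
    using f g by (auto simp: square_integrable_def)
  have b: "norm (f x \<bullet> g x) \<le> (cmod (f x))\<^sup>2 + (cmod (g x))\<^sup>2" for x
  proof -
    have "norm (f x \<bullet> g x) \<le> cmod (f x) * cmod (g x)"
      by (simp add: Cauchy_Schwarz_ineq2)
    moreover have "0 \<le> cmod (f x) * cmod (g x)" by simp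
    ultimately show ?thesis
      using sum_squares_bound[of "cmod (f x)" "cmod (g x)"] by linarith
  qed
  show ?thesis
    by (rule Bochner_Integration.integrable_bound[OF i]) (use b in \<open>auto intro!: AE_I2\<close>)
qed

definition L2_eq :: "(real \<Rightarrow> complex) \<Rightarrow> (real \<Rightarrow> complex) \<Rightarrow> bool"
  where "L2_eq f g \<longleftrightarrow>
    square_integrable f \<and> square_integrable g \<and> (AE x in unit_measure. f x = g x)"

lemma L2_eqI:
  assumes "square_integrable f" "square_integrable g" "\<And>x. f x = g x"
  shows "L2_eq f g"
  using assms by (simp add: L2_eq_def)

quotient_type L2 = "real \<Rightarrow> complex" / partial: L2_eq
  morphisms rep_L2 abs_L2
proof (rule part_equivpI)
  show "\<exists>f. L2_eq f f"
    using square_integrable_0 by (auto simp: L2_eq_def)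
  show "symp L2_eq"
  proof (rule sympI)
    fix f g assume "L2_eq f g"
    moreover from this have "AE x in unit_measure. g x = f x"
      unfolding L2_eq_def by (elim conjE eventually_mono) (rule sym)
    ultimately show "L2_eq g f"
      by (simp add: L2_eq_def)
  qed
  show "transp L2_eq"
  proof (rule transpI)
    fix f g h assume *: "L2_eq f g" "L2_eq g h"
    then have "AE x in unit_measure. f x = g x" "AE x in unit_measure. g x = h x"
      by (simp_all add: L2_eq_def)
    then have "AE x in unit_measure. f x = h x"
      by eventually_elim simp
    with * show "L2_eq f h"
      by (simp add: L2_eq_def)
  qed
qed

lemma square_integrable_minus: "square_integrable f \<Longrightarrow> square_integrable (\<lambda>x. - f x)"
  using square_integrable_scale[of f "-1"] by simp

lemma square_integrable_scaleR: "square_integrable f \<Longrightarrow> square_integrable (\<lambda>x. r *\<^sub>R f x)"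
  using square_integrable_scale[of f "complex_of_real r"] by (simp add: scaleR_conv_of_real)

instantiation L2 :: real_vector
begin

lift_definition zero_L2 :: L2 is "\<lambda>_. 0"
  by (simp add: L2_eq_def square_integrable_0)

lift_definition plus_L2 :: "L2 \<Rightarrow> L2 \<Rightarrow> L2" is "\<lambda>f g x. f x + g x"
proof -
  fix f f' g g' assume *: "L2_eq f f'" "L2_eq g g'"
  then have "AE x in unit_measure. f x = f' x" "AE x in unit_measure. g x = g' x"
    by (simp_all add: L2_eq_def)
  then have "AE x in unit_measure. f x + g x = f' x + g' x"
    by eventually_elim simp
  with * show "L2_eq (\<lambda>x. f x + g x) (\<lambda>x. f' x + g' x)"
    by (simp add: L2_eq_def square_integrable_add)
qed

lift_definition uminus_L2 :: "L2 \<Rightarrow> L2" is "\<lambda>f x. - f x"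
  by (simp add: L2_eq_def square_integrable_minus)

definition minus_L2 :: "L2 \<Rightarrow> L2 \<Rightarrow> L2"
  where "minus_L2 u v = u + - v"

lift_definition scaleR_L2 :: "real \<Rightarrow> L2 \<Rightarrow> L2" is "\<lambda>r f x. r *\<^sub>R f x"
proof -
  fix r :: real and f g assume *: "L2_eq f g"
  then have "AE x in unit_measure. f x = g x"
    by (simp add: L2_eq_def)
  then have "AE x in unit_measure. r *\<^sub>R f x = r *\<^sub>R g x"
    by eventually_elim simp
  with * show "L2_eq (\<lambda>x. r *\<^sub>R f x) (\<lambda>x. r *\<^sub>R g x)"
    unfolding L2_eq_def using square_integrable_scaleR by blast
qed

instance
proof
  fix u v w :: L2 and a b :: real
  note [simp] = square_integrable_0 square_integrable_add square_integrable_minus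
    square_integrable_scaleR
  show "u + v + w = u + (v + w)"
    by transfer (rule L2_eqI; simp add: L2_eq_def)
  show "u + v = v + u"
    by transfer (rule L2_eqI; simp add: L2_eq_def)
  show "0 + u = u"
    by transfer (rule L2_eqI; simp add: L2_eq_def)
  show "- u + u = 0"
    by transfer (rule L2_eqI; simp add: L2_eq_def)
  show "u - v = u + - v"
    by (rule minus_L2_def)
  show "a *\<^sub>R (u + v) = a *\<^sub>R u + a *\<^sub>R v"
    by transfer (rule L2_eqI; simp add: L2_eq_def algebra_simps)
  show "(a + b) *\<^sub>R u = a *\<^sub>R u + b *\<^sub>R u"
    by transfer (rule L2_eqI; simp add: L2_eq_def algebra_simps)
  show "a *\<^sub>R b *\<^sub>R u = (a * b) *\<^sub>R u"
    by transfer (rule L2_eqI; simp add: L2_eq_def)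
  show "1 *\<^sub>R u = u"
    by transfer (rule L2_eqI; simp add: L2_eq_def)
qed

end

lift_definition scaleC :: "complex \<Rightarrow> L2 \<Rightarrow> L2" (infixr "*\<^sub>C" 75) is "\<lambda>c f x. c * f x"
proof -
  fix c :: complex and f g assume *: "L2_eq f g"
  then have "AE x in unit_measure. f x = g x"
    by (simp add: L2_eq_def)
  then have "AE x in unit_measure. c * f x = c * g x"
    by eventually_elim simp
  with * show "L2_eq (\<lambda>x. c * f x) (\<lambda>x. c * g x)"
    unfolding L2_eq_def using square_integrable_scale by blast
qed

global_interpretation complex_L2: vector_space scaleC
  defines complex_dim = complex_L2.dim
proof
  fix u v :: L2 and a b :: complex
  note [simp] = square_integrable_0 square_integrable_add square_integrable_scale
  show "a *\<^sub>C (u + v) = a *\<^sub>C u + a *\<^sub>C v"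
    by transfer (rule L2_eqI; simp add: L2_eq_def algebra_simps)
  show "(a + b) *\<^sub>C u = a *\<^sub>C u + b *\<^sub>C u"
    by transfer (rule L2_eqI; simp add: L2_eq_def algebra_simps)
  show "a *\<^sub>C b *\<^sub>C u = (a * b) *\<^sub>C u"
    by transfer (rule L2_eqI; simp add: L2_eq_def)
  show "1 *\<^sub>C u = u"
    by transfer (rule L2_eqI; simp add: L2_eq_def)
qed

text \<open>
  As on \<^typ>\<open>complex\<close> itself, the class \<^class>\<open>real_inner\<close> takes the real part
  \<open>Re (\<integral> f * cnj g)\<close> of the Hermitian inner product; it induces the usual norm.
\<close>

instantiation L2 :: real_inner
begin

lift_definition inner_L2 :: "L2 \<Rightarrow> L2 \<Rightarrow> real"
  is "\<lambda>f g. \<integral>x. f x \<bullet> g x \<partial>unit_measure"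
proof -
  fix f f' g g' assume *: "L2_eq f f'" "L2_eq g g'"
  then have "AE x in unit_measure. f x = f' x" "AE x in unit_measure. g x = g' x"
    by (simp_all add: L2_eq_def)
  then have ae: "AE x in unit_measure. f x \<bullet> g x = f' x \<bullet> g' x"
    by eventually_elim simp
  from * have sq: "square_integrable f" "square_integrable g"
      "square_integrable f'" "square_integrable g'"
    by (simp_all add: L2_eq_def)
  show "(\<integral>x. f x \<bullet> g x \<partial>unit_measure) = (\<integral>x. f' x \<bullet> g' x \<partial>unit_measure)"
    by (rule integral_cong_AE[OF borel_measurable_integrable borel_measurable_integrable ae])
      (rule integrable_inner_square; fact sq)+
qed

definition norm_L2 :: "L2 \<Rightarrow> real"
  where "norm_L2 u = sqrt (u \<bullet> u)"

definition dist_L2 :: "L2 \<Rightarrow> L2 \<Rightarrow> real"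
  where "dist_L2 u v = norm (u - v)"

definition sgn_L2 :: "L2 \<Rightarrow> L2"
  where "sgn_L2 u = inverse (norm u) *\<^sub>R u"

definition uniformity_L2 :: "(L2 \<times> L2) filter"
  where "uniformity_L2 = (INF e\<in>{0<..}. principal {(u, v). dist u v < e})"

definition open_L2 :: "L2 set \<Rightarrow> bool"
  where "open_L2 U \<longleftrightarrow> (\<forall>u\<in>U. \<forall>\<^sub>F (u', v) in uniformity. u' = u \<longrightarrow> v \<in> U)"

instance
proof
  fix u v w :: L2 and r :: real and U :: "L2 set"
  show "u \<bullet> v = v \<bullet> u"
    by transfer (simp add: inner_commute)
  show "(u + v) \<bullet> w = u \<bullet> w + v \<bullet> w"
    by transfer (simp add: L2_eq_def inner_add_left integrable_inner_square)
  show "(r *\<^sub>R u) \<bullet> v = r * (u \<bullet> v)"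
    by transfer simp
  show "0 \<le> u \<bullet> u"
    by transfer simp
  show "u \<bullet> u = 0 \<longleftrightarrow> u = 0"
  proof transfer
    fix f assume "L2_eq f f"
    then have f: "square_integrable f"
      by (simp add: L2_eq_def)
    have "(\<integral>x. f x \<bullet> f x \<partial>unit_measure) = 0 \<longleftrightarrow> (AE x in unit_measure. f x \<bullet> f x = 0)"
      by (rule integral_nonneg_eq_0_iff_AE) (simp_all add: integrable_inner_square f)
    also have "\<dots> \<longleftrightarrow> L2_eq f (\<lambda>_. 0)"
      using f square_integrable_0 by (simp add: L2_eq_def)
    finally show "(\<integral>x. f x \<bullet> f x \<partial>unit_measure) = 0 \<longleftrightarrow> L2_eq f (\<lambda>_. 0)" .
  qed
qed (rule norm_L2_def dist_L2_def sgn_L2_def uniformity_L2_def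
    open_L2_def[unfolded split_def] | simp add: open_L2_def)+

end

text \<open>
  Derivatives are taken within \<open>A\<close>, so they are one-sided at the end points of a closed
  interval. Off \<open>A\<close> the values of \<open>nderiv A k f\<close> are meaningless and never used.
\<close>

definition nderiv ::
    "real set \<Rightarrow> nat \<Rightarrow> (real \<Rightarrow> 'a::real_normed_vector) \<Rightarrow> real \<Rightarrow> 'a"
  where "nderiv A k f = ((\<lambda>g x. vector_derivative g (at x within A)) ^^ k) f"

definition smooth_on :: "real set \<Rightarrow> (real \<Rightarrow> 'a::real_normed_vector) \<Rightarrow> bool"
  where "smooth_on A f \<longleftrightarrow> (\<forall>k. \<forall>x\<in>A. nderiv A k f differentiable (at x within A))"

definition test_function :: "(real \<Rightarrow> complex) \<Rightarrow> bool"
  where "test_function \<phi> \<longleftrightarrow> smooth_on UNIV \<phi> \<and>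
    compact (closure {x. \<phi> x \<noteq> 0}) \<and> closure {x. \<phi> x \<noteq> 0} \<subseteq> {0<..<1}"

text \<open>
  The integrals do not depend on the chosen representatives, and a weak derivative is unique
  in \<open>L\<^sup>2(0,1)\<close> if it exists; \<open>weak_deriv k v\<close> is meaningful only in that case.
\<close>

definition has_weak_deriv :: "nat \<Rightarrow> L2 \<Rightarrow> L2 \<Rightarrow> bool"
  where "has_weak_deriv k v w \<longleftrightarrow> (\<forall>\<phi>. test_function \<phi> \<longrightarrow>
    (\<integral>x. rep_L2 v x * nderiv UNIV k \<phi> x \<partial>unit_measure) =
      (-1) ^ k * (\<integral>x. rep_L2 w x * \<phi> x \<partial>unit_measure))"

definition weak_deriv :: "nat \<Rightarrow> L2 \<Rightarrow> L2"
  where "weak_deriv k v = (THE w. has_weak_deriv k v w)"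

definition Sobolev :: "nat \<Rightarrow> L2 set"
  where "Sobolev m = {v. \<forall>k\<le>m. \<exists>w. has_weak_deriv k v w}"

definition representative :: "L2 \<Rightarrow> (real \<Rightarrow> complex) \<Rightarrow> bool"
  where "representative v f \<longleftrightarrow> (AE x in unit_measure. rep_L2 v x = f x)"

text \<open>
  An unbounded operator is given by its domain \<open>D\<close> and a total function \<open>A\<close> whose values
  off \<open>D\<close> are irrelevant.
\<close>

definition eigenvalue :: "L2 set \<Rightarrow> (L2 \<Rightarrow> L2) \<Rightarrow> complex \<Rightarrow> bool"
  where "eigenvalue D A \<mu> \<longleftrightarrow> (\<exists>v\<in>D. v \<noteq> 0 \<and> A v = \<mu> *\<^sub>C v)"

definition generalized_eigenspace :: "L2 set \<Rightarrow> (L2 \<Rightarrow> L2) \<Rightarrow> complex \<Rightarrow> L2 set"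
  where "generalized_eigenspace D A \<mu> =
    {v. \<exists>n. (\<forall>j<n. ((\<lambda>w. A w - \<mu> *\<^sub>C w) ^^ j) v \<in> D) \<and>
            ((\<lambda>w. A w - \<mu> *\<^sub>C w) ^^ n) v = 0}"

text \<open>
  Infinite-dimensional spaces have dimension \<open>0\<close> in the library, so multiplicity \<open>1\<close>
  means exactly that the generalized eigenspace is a complex line.
\<close>

definition algebraic_multiplicity :: "L2 set \<Rightarrow> (L2 \<Rightarrow> L2) \<Rightarrow> complex \<Rightarrow> nat"
  where "algebraic_multiplicity D A \<mu> = complex_dim (generalized_eigenspace D A \<mu>)"

definition simple_eigenvalue :: "L2 set \<Rightarrow> (L2 \<Rightarrow> L2) \<Rightarrow> complex \<Rightarrow> bool"
  where "simple_eigenvalue D A \<mu> \<longleftrightarrow>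
    eigenvalue D A \<mu> \<and> algebraic_multiplicity D A \<mu> = 1"

definition C0_semigroup :: "(real \<Rightarrow> L2 \<Rightarrow> L2) \<Rightarrow> bool"
  where "C0_semigroup S \<longleftrightarrow>
    (\<forall>t\<ge>0. bounded_linear (S t) \<and> (\<forall>c v. S t (c *\<^sub>C v) = c *\<^sub>C S t v)) \<and>
    (\<forall>v. S 0 v = v) \<and>
    (\<forall>s\<ge>0. \<forall>t\<ge>0. \<forall>v. S (s + t) v = S s (S t v)) \<and>
    (\<forall>v. ((\<lambda>t. S t v) \<longlongrightarrow> v) (at_right 0))"

text \<open>
  The graph of the generator equals the graph of \<open>A\<close> on \<open>D\<close>; in particular the domain of
  the generator is exactly \<open>D\<close>.
\<close>

definition generated_by :: "(real \<Rightarrow> L2 \<Rightarrow> L2) \<Rightarrow> L2 set \<Rightarrow> (L2 \<Rightarrow> L2) \<Rightarrow> bool"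
  where "generated_by S D A \<longleftrightarrow> (\<forall>v w.
    ((\<lambda>h. inverse h *\<^sub>R (S h v - v)) \<longlongrightarrow> w) (at_right 0) \<longleftrightarrow> v \<in> D \<and> w = A v)"

text \<open>
  Boundary values of \<open>v \<in> H\<^sup>3(0,1)\<close> are those of its unique representative in \<open>C\<^sup>1[0,1]\<close>.
\<close>

definition T_dom :: "real \<Rightarrow> L2 set"
  where "T_dom \<beta> = {v \<in> Sobolev 3. \<exists>f f'. representative v f \<and>
    (\<forall>x\<in>{0..1}. (f has_vector_derivative f' x) (at x within {0..1})) \<and>
    continuous_on {0..1} f' \<and>
    f 0 = 0 \<and> f 1 = 0 \<and> f' 1 = complex_of_real \<beta> * f' 0}"

definition T_op :: "L2 \<Rightarrow> L2"
  where "T_op v = (- \<i>) ^ 3 *\<^sub>C weak_deriv 3 v"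

end

theory Submission
  imports Defs
begin

text \<open>
  Write \<open>A\<close> for \<open>\<i> T\<^sub>\<beta>\<close>, that is \<open>A v = - v'''\<close> on the domain. The equation smooths because it is
  dispersive with a boundary condition that loses energy. Pairing \<open>A u\<close> with \<open>u\<close> leaves only the
  boundary term \<open>- (1 - \<beta>\<^sup>2) |u'(0)|\<^sup>2 / 2\<close>; pairing it with \<open>x u\<close> gives Kato's term
  \<open>- 3/2 \<integral>|u'|\<^sup>2\<close> plus \<open>\<beta>\<^sup>2 |u'(0)|\<^sup>2 / 2\<close>. For the weight \<open>c + x\<close> with
  \<open>c (1 - \<beta>\<^sup>2) = 3 + \<beta>\<^sup>2\<close> the sum is exactly \<open>- 3/2 (\<integral>|u'|\<^sup>2 + |u'(0)|\<^sup>2)\<close> (\<open>energy_identity\<close>). So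
  the energy \<open>E(u) = \<integral> (c + x) |u|\<^sup>2\<close>, which is comparable with the squared \<open>L\<^sup>2\<close> norm, controls one
  derivative of \<open>u\<close> through its rate of decay, and the same holds for \<open>E(A u)\<close>.

  One derivative is a third of the way to \<open>A u\<close>. The missing two thirds come from interpolating
  \<open>A u\<close> between \<open>u'\<close> and \<open>(A u)'\<close> (\<open>interpolation\<close>), with exactly the boundary terms that the
  dissipation controls. Choosing the interpolation parameter proportional to \<open>t\<close> makes
  \<open>E(u) + \<delta> t\<^sup>3 E(A u)\<close> nonincreasing for \<open>t \<le> 1\<close>, whence \<open>\<parallel>A S(t) v\<parallel> \<le> K t\<^sup>-\<^sup>3\<^sup>/\<^sup>2 \<parallel>v\<parallel>\<close>
  (\<open>smoothing_estimate\<close>). This is proved for \<open>v\<close> in the domain of \<open>A\<^sup>2\<close>, where everything can be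
  differentiated in time. That domain is dense (\<open>dense_domain_square\<close>) and \<open>A\<close> is closed
  (\<open>generates_closed\<close>), so \<open>S(t)\<close> maps all of \<open>L\<^sup>2\<close> into the domain. Splitting \<open>S(t)\<close> into factors
  and commuting \<open>A\<close> with them, the image lies in the domain of every power of \<open>A\<close>. Each power
  supplies three more continuous derivatives up to the boundary (\<open>smooth_if_domain_powers\<close>).

  Two preparations make this rigorous. On the analytic side, \<open>L\<^sup>2(0,1)\<close> is complete, and elements of
  the domain, defined by weak derivatives, are \<open>C\<^sup>2\<close> functions with absolutely continuous second
  derivative (\<open>T_dom_classical\<close>), for which integration by parts is available. On the abstract side,
  a strongly continuous semigroup on a Banach space is locally bounded, its orbits starting in the
  domain of the generator are differentiable, and its generator is closed and has a densely defined
  square.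
\<close>

section \<open>The Hilbert space \<open>L\<^sup>2(0,1)\<close>\<close>

interpretation unit: finite_measure unit_measure
  by (rule finite_measure_lebesgue_on) simp

interpretation unit_pair: pair_sigma_finite unit_measure unit_measure ..

lemma measure_unit: "measure unit_measure {0<..<1} = 1"
  by (subst measure_restrict_space) auto

lemma AE_unit_cong: "(\<And>x. 0 < x \<Longrightarrow> x < 1 \<Longrightarrow> P x) \<Longrightarrow> AE x in unit_measure. P x"
  by (rule AE_I2) simp

lemma square_integrable_integrable: "square_integrable f \<Longrightarrow> integrable unit_measure f"
proof -
  assume f: "square_integrable f"
  then have [measurable]: "f \<in> borel_measurable unit_measure"
    by (rule square_integrableD)
  have "integrable unit_measure (\<lambda>x. cmod (f x))"
    by (rule unit.square_integrable_imp_integrable) (use f in \<open>auto simp: square_integrable_def\<close>)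
  then show ?thesis
    by (subst (asm) integrable_norm_iff) auto
qed

lemma square_integrable_rep: "square_integrable (rep_L2 v)"
  using Quotient_rep_reflp[OF Quotient_L2, of v] by (simp add: L2_eq_def)

lemma rep_L2_measurable [measurable]: "rep_L2 v \<in> borel_measurable unit_measure"
  by (rule square_integrableD[OF square_integrable_rep])

lemma integrable_rep: "integrable unit_measure (rep_L2 v)"
  by (rule square_integrable_integrable[OF square_integrable_rep])

lemma abs_rep_L2: "abs_L2 (rep_L2 v) = v"
  by (rule Quotient_abs_rep[OF Quotient_L2])

lemma abs_L2_eqI:
  "square_integrable f \<Longrightarrow> square_integrable g \<Longrightarrow> AE x in unit_measure. f x = g x \<Longrightarrow>
    abs_L2 f = abs_L2 g"
  by (rule Quotient_rel_abs[OF Quotient_L2]) (simp add: L2_eq_def)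

lemma rep_abs_L2: "square_integrable f \<Longrightarrow> AE x in unit_measure. rep_L2 (abs_L2 f) x = f x"
  using Quotient_rep_abs[OF Quotient_L2, of f] by (simp add: L2_eq_def)

lemma representative_abs: "square_integrable f \<Longrightarrow> representative (abs_L2 f) f"
  unfolding representative_def by (rule rep_abs_L2)

lemma representative_rep: "representative v (rep_L2 v)"
  by (simp add: representative_def)

lemma representative_unique:
  assumes "representative v f" "representative w f" shows "v = w"
proof -
  have "AE x in unit_measure. rep_L2 v x = rep_L2 w x"
    using assms unfolding representative_def by eventually_elim simp
  then have "abs_L2 (rep_L2 v) = abs_L2 (rep_L2 w)"
    by (intro abs_L2_eqI square_integrable_rep)
  then show ?thesis by (simp add: abs_rep_L2)
qed

lemma representative_add:
  assumes "representative v f" "representative w g"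
  shows "representative (v + w) (\<lambda>x. f x + g x)"
proof -
  have "v + w = abs_L2 (\<lambda>x. rep_L2 v x + rep_L2 w x)"
    using plus_L2.abs_eq[of "rep_L2 v" "rep_L2 w"] by (simp add: L2_eq_def square_integrable_rep abs_rep_L2)
  then have "AE x in unit_measure. rep_L2 (v + w) x = rep_L2 v x + rep_L2 w x"
    by (simp add: rep_abs_L2 square_integrable_add square_integrable_rep)
  then show ?thesis
    using assms unfolding representative_def by eventually_elim simp
qed

lemma representative_scaleC:
  assumes "representative v f" shows "representative (c *\<^sub>C v) (\<lambda>x. c * f x)"
proof -
  have "c *\<^sub>C v = abs_L2 (\<lambda>x. c * rep_L2 v x)"
    using scaleC.abs_eq[of "rep_L2 v"] by (simp add: L2_eq_def square_integrable_rep abs_rep_L2)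
  then have "AE x in unit_measure. rep_L2 (c *\<^sub>C v) x = c * rep_L2 v x"
    by (simp add: rep_abs_L2 square_integrable_scale square_integrable_rep)
  then show ?thesis
    using assms unfolding representative_def by eventually_elim simp
qed

lemma representative_minus:
  assumes "representative v f" shows "representative (- v) (\<lambda>x. - f x)"
  using representative_scaleC[OF assms, of "-1"] by simp

lemma representative_diff:
  assumes "representative v f" "representative w g"
  shows "representative (v - w) (\<lambda>x. f x - g x)"
  using representative_add[OF assms(1) representative_minus[OF assms(2)]] by simp

lemma inner_abs_L2:
  assumes "square_integrable f" "square_integrable g"
  shows "abs_L2 f \<bullet> abs_L2 g = (\<integral>x. f x \<bullet> g x \<partial>unit_measure)"
  by (rule inner_L2.abs_eq) (use assms in \<open>auto simp: L2_eq_def\<close>)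

lemma inner_L2_rep: "v \<bullet> w = (\<integral>x. rep_L2 v x \<bullet> rep_L2 w x \<partial>unit_measure)"
  using inner_abs_L2[OF square_integrable_rep square_integrable_rep, of v w] by (simp add: abs_rep_L2)

lemma norm_L2_sq: "(norm v)\<^sup>2 = (\<integral>x. (cmod (rep_L2 v x))\<^sup>2 \<partial>unit_measure)"
  by (simp add: power2_norm_eq_inner inner_L2_rep)

text \<open>
  Cauchy--Schwarz against the constant \<open>1\<close>, whose norm is \<open>1\<close> on a probability space.
\<close>

lemma integral_cmod_le_norm:
  assumes "square_integrable f"
  shows "(\<integral>x. cmod (f x) \<partial>unit_measure) \<le> norm (abs_L2 f)"
proof -
  note [measurable] = square_integrableD[OF assms]
  let ?g = "\<lambda>x. complex_of_real (cmod (f x))"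
  have g: "square_integrable ?g"
    using assms by (auto simp: square_integrable_def)
  have one: "square_integrable (\<lambda>_. 1)"
    by (auto simp: square_integrable_def)
  have "(\<integral>x. cmod (f x) \<partial>unit_measure) = abs_L2 ?g \<bullet> abs_L2 (\<lambda>_. 1)"
    by (subst inner_abs_L2[OF g one]) (simp add: inner_complex_def)
  also have "\<dots> \<le> norm (abs_L2 ?g) * norm (abs_L2 (\<lambda>_. 1))"
    by (rule norm_cauchy_schwarz)
  also have "norm (abs_L2 (\<lambda>_. 1)) = 1"
    unfolding norm_L2_def inner_abs_L2[OF one one] by (simp add: measure_unit)
  also have "norm (abs_L2 ?g) = norm (abs_L2 f)"
    unfolding norm_L2_def inner_abs_L2[OF g g] inner_abs_L2[OF assms assms]
    by (simp add: dot_square_norm)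
  finally show ?thesis by simp
qed

text \<open>
  Completeness (Riesz--Fischer): a Cauchy sequence in \<open>L\<^sup>2\<close> is Cauchy in \<open>L\<^sup>1\<close>, hence has a
  subsequence converging almost everywhere, and by Fatou's lemma the pointwise limit is also the
  limit in \<open>L\<^sup>2\<close>.
\<close>

instance L2 :: banach
proof
  fix X :: "nat \<Rightarrow> L2"
  assume X: "Cauchy X"
  define s where "s n = rep_L2 (X n)" for n
  have [measurable]: "s n \<in> borel_measurable unit_measure" for n
    by (simp add: s_def)
  have rep_diff: "AE x in unit_measure. rep_L2 (X i - X j) x = s i x - s j x" for i j
    using representative_diff[OF representative_rep representative_rep, of "X i" "X j"]
    by (simp add: representative_def s_def)
  have L1: "(\<integral>x. norm (s i x - s j x) \<partial>unit_measure) \<le> norm (X i - X j)" for i j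
  proof -
    have "(\<integral>x. norm (s i x - s j x) \<partial>unit_measure) = (\<integral>x. cmod (rep_L2 (X i - X j) x) \<partial>unit_measure)"
      by (rule integral_cong_AE) (measurable, use rep_diff[of i j] in \<open>eventually_elim, simp\<close>)
    also have "\<dots> \<le> norm (X i - X j)"
      using integral_cmod_le_norm[OF square_integrable_rep, of "X i - X j"] by (simp add: abs_rep_L2)
    finally show ?thesis .
  qed
  obtain r where r: "strict_mono r" and ae: "AE x in unit_measure. Cauchy (\<lambda>i. s (r i) x)"
  proof (rule cauchy_L1_AE_cauchy_subseq[of unit_measure s])
    show "integrable unit_measure (s n)" for n
      by (simp add: s_def integrable_rep)
    show "\<exists>N. \<forall>i\<ge>N. \<forall>j\<ge>N. (\<integral>x. norm (s i x - s j x) \<partial>unit_measure) < e" if "e > 0" for e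
      using CauchyD[OF X that] L1 by (meson le_less_trans)
  qed
  define f where "f x = lim (\<lambda>i. s (r i) x)" for x
  have [measurable]: "f \<in> borel_measurable unit_measure"
    unfolding f_def by measurable
  have conv: "AE x in unit_measure. (\<lambda>i. s (r i) x) \<longlonglongrightarrow> f x"
    using ae by eventually_elim (simp add: f_def Cauchy_convergent_iff convergent_LIMSEQ_iff)
  have fatou: "(\<integral>\<^sup>+x. ennreal ((cmod (s n x - f x))\<^sup>2) \<partial>unit_measure) \<le> ennreal (e\<^sup>2)"
    if e: "e > 0" and N: "\<And>i j. i \<ge> N \<Longrightarrow> j \<ge> N \<Longrightarrow> norm (X i - X j) < e" and n: "n \<ge> N" for e N n
  proof -
    have "(\<integral>\<^sup>+x. ennreal ((cmod (s n x - f x))\<^sup>2) \<partial>unit_measure)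
        = (\<integral>\<^sup>+x. liminf (\<lambda>i. ennreal ((cmod (s n x - s (r i) x))\<^sup>2)) \<partial>unit_measure)"
    proof (rule nn_integral_cong_AE, use conv in eventually_elim)
      fix x assume "(\<lambda>i. s (r i) x) \<longlonglongrightarrow> f x"
      then have "(\<lambda>i. ennreal ((cmod (s n x - s (r i) x))\<^sup>2)) \<longlonglongrightarrow> ennreal ((cmod (s n x - f x))\<^sup>2)"
        by (intro tendsto_intros)
      then show "ennreal ((cmod (s n x - f x))\<^sup>2) = liminf (\<lambda>i. ennreal ((cmod (s n x - s (r i) x))\<^sup>2))"
        by (intro lim_imp_Liminf[symmetric]) auto
    qed
    also have "\<dots> \<le> liminf (\<lambda>i. \<integral>\<^sup>+x. ennreal ((cmod (s n x - s (r i) x))\<^sup>2) \<partial>unit_measure)"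
      by (rule nn_integral_liminf) measurable
    also have "\<dots> \<le> ennreal (e\<^sup>2)"
    proof (rule Liminf_le)
      show "eventually (\<lambda>i. (\<integral>\<^sup>+x. ennreal ((cmod (s n x - s (r i) x))\<^sup>2) \<partial>unit_measure) \<le> ennreal (e\<^sup>2)) sequentially"
        using eventually_ge_at_top[of N]
      proof eventually_elim
        fix i assume "i \<ge> N"
        then have "r i \<ge> N" using seq_suble[OF r, of i] by linarith
        have "(\<integral>\<^sup>+x. ennreal ((cmod (s n x - s (r i) x))\<^sup>2) \<partial>unit_measure)
            = (\<integral>\<^sup>+x. ennreal ((cmod (rep_L2 (X n - X (r i)) x))\<^sup>2) \<partial>unit_measure)"
          by (rule nn_integral_cong_AE) (use rep_diff[of n "r i"] in \<open>eventually_elim, simp\<close>)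
        also have "\<dots> = ennreal ((norm (X n - X (r i)))\<^sup>2)"
          unfolding norm_L2_sq
          by (rule nn_integral_eq_integral)
             (use square_integrable_rep[of "X n - X (r i)"] in \<open>auto simp: square_integrable_def\<close>)
        also have "\<dots> \<le> ennreal (e\<^sup>2)"
          using N[OF n \<open>r i \<ge> N\<close>] by (intro ennreal_leI power_mono) auto
        finally show "(\<integral>\<^sup>+x. ennreal ((cmod (s n x - s (r i) x))\<^sup>2) \<partial>unit_measure) \<le> ennreal (e\<^sup>2)" .
      qed
    qed simp
    finally show ?thesis .
  qed
  have sq_diff: "square_integrable (\<lambda>x. s n x - f x)"
    if e: "e > 0" and N: "\<And>i j. i \<ge> N \<Longrightarrow> j \<ge> N \<Longrightarrow> norm (X i - X j) < e" and n: "n \<ge> N" for e N n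
    unfolding square_integrable_def integrable_iff_bounded
    using le_less_trans[OF fatou[OF that]] by simp
  have f: "square_integrable f"
  proof -
    obtain N where N: "\<And>i j. i \<ge> N \<Longrightarrow> j \<ge> N \<Longrightarrow> norm (X i - X j) < 1"
      using CauchyD[OF X zero_less_one] by blast
    have "square_integrable (\<lambda>x. s N x + - (s N x - f x))"
      by (intro square_integrable_add square_integrable_minus sq_diff[of 1 N N])
         (use N in \<open>auto simp: s_def square_integrable_rep\<close>)
    then show ?thesis by simp
  qed
  have "X \<longlonglongrightarrow> abs_L2 f"
  proof (rule LIMSEQ_I)
    fix e :: real assume "e > 0"
    then have e2: "e / 2 > 0" by simp
    obtain N where N: "\<And>i j. i \<ge> N \<Longrightarrow> j \<ge> N \<Longrightarrow> norm (X i - X j) < e / 2"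
      using CauchyD[OF X e2] by blast
    have "norm (X n - abs_L2 f) < e" if n: "n \<ge> N" for n
    proof -
      have ae: "AE x in unit_measure. rep_L2 (X n - abs_L2 f) x = s n x - f x"
        using representative_diff[OF representative_rep representative_abs[OF f], of "X n"]
        by (simp add: representative_def s_def)
      have "ennreal ((norm (X n - abs_L2 f))\<^sup>2)
          = (\<integral>\<^sup>+x. ennreal ((cmod (rep_L2 (X n - abs_L2 f) x))\<^sup>2) \<partial>unit_measure)"
        unfolding norm_L2_sq
        by (rule nn_integral_eq_integral[symmetric])
           (use square_integrable_rep[of "X n - abs_L2 f"] in \<open>auto simp: square_integrable_def\<close>)
      also have "\<dots> = (\<integral>\<^sup>+x. ennreal ((cmod (s n x - f x))\<^sup>2) \<partial>unit_measure)"
        by (rule nn_integral_cong_AE) (use ae in \<open>eventually_elim, simp\<close>)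
      also have "\<dots> \<le> ennreal ((e / 2)\<^sup>2)"
        by (rule fatou[OF e2 N n])
      finally have "norm (X n - abs_L2 f) \<le> e / 2"
        using e2 by (simp add: power2_le_iff_abs_le)
      with \<open>e > 0\<close> show ?thesis by simp
    qed
    then show "\<exists>no. \<forall>n\<ge>no. norm (X n - abs_L2 f) < e" by blast
  qed
  then show "convergent X" by (rule convergentI)
qed

section \<open>Absolutely continuous functions on the unit interval\<close>

definition primitive :: "(real \<Rightarrow> complex) \<Rightarrow> real \<Rightarrow> complex"
  where "primitive w x = (\<integral>y. indicat_real {..x} y *\<^sub>R w y \<partial>unit_measure)"

text \<open>
  Absolute continuity in the form in which it is used: \<open>f\<close> is the primitive of an explicitly
  given integrable \<open>w\<close>, which is its derivative almost everywhere.
\<close>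

definition abs_cont :: "(real \<Rightarrow> complex) \<Rightarrow> (real \<Rightarrow> complex) \<Rightarrow> bool"
  where "abs_cont f w \<longleftrightarrow> integrable unit_measure w \<and> (\<forall>x\<in>{0..1}. f x = f 0 + primitive w x)"

lemma abs_contD: "abs_cont f w \<Longrightarrow> x \<in> {0..1} \<Longrightarrow> f x = f 0 + primitive w x"
  by (simp only: abs_cont_def)

lemma abs_cont_integrable: "abs_cont f w \<Longrightarrow> integrable unit_measure w"
  by (simp only: abs_cont_def)

lemma integrable_borel_indicator:
  assumes A: "A \<in> sets borel" and w: "integrable unit_measure (w :: real \<Rightarrow> complex)"
  shows "integrable unit_measure (\<lambda>y. indicat_real A y *\<^sub>R w y)"
proof -
  have "integrable unit_measure (\<lambda>y. indicat_real (A \<inter> {0<..<1}) y *\<^sub>R w y)"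
    using A by (intro integrable_mult_indicator w) (auto simp: sets_restrict_space)
  then show ?thesis
    by (rule Bochner_Integration.integrable_cong[THEN iffD1, OF refl, rotated]) (auto simp: indicator_def)
qed

lemmas integrable_cut = integrable_borel_indicator[OF atMost_borel]

lemma primitive_le_0: "x \<le> 0 \<Longrightarrow> primitive w x = 0"
  unfolding primitive_def by (subst Bochner_Integration.integral_cong[where g = "\<lambda>_. 0"]) auto

lemma primitive_ge_1: "1 \<le> x \<Longrightarrow> primitive w x = (\<integral>y. w y \<partial>unit_measure)"
  unfolding primitive_def by (intro Bochner_Integration.integral_cong) auto

lemma primitive_cong_AE:
  assumes "integrable unit_measure w" "integrable unit_measure w'" "AE x in unit_measure. w x = w' x"
  shows "primitive w x = primitive w' x"
  unfolding primitive_def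
proof (rule integral_cong_AE)
  show "AE y in unit_measure. indicat_real {..x} y *\<^sub>R w y = indicat_real {..x} y *\<^sub>R w' y"
    using assms(3) by eventually_elim simp
qed (use assms integrable_cut borel_measurable_integrable in blast)+

lemma AE_unit_neq: "AE y in unit_measure. y \<noteq> x"
proof -
  have "AE y in lebesgue. y \<noteq> x"
    by (rule AE_I'[of "{x}"]) auto
  then show ?thesis
    by (subst AE_restrict_space_iff) auto
qed

lemma continuous_primitive:
  assumes w: "integrable unit_measure w"
  shows "continuous_on UNIV (primitive w)"
  unfolding continuous_on_sequentially comp_def
proof (intro ballI allI impI, elim conjE)
  fix X :: "nat \<Rightarrow> real" and a :: real assume X: "X \<longlonglongrightarrow> a"
  show "(\<lambda>n. primitive w (X n)) \<longlonglongrightarrow> primitive w a"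
    unfolding primitive_def
  proof (rule integral_dominated_convergence)
    show "integrable unit_measure (\<lambda>y. norm (w y))" using w by simp
    show "AE y in unit_measure. (\<lambda>n. indicat_real {..X n} y *\<^sub>R w y) \<longlonglongrightarrow> indicat_real {..a} y *\<^sub>R w y"
      using AE_unit_neq[of a]
    proof eventually_elim
      fix y assume "y \<noteq> a"
      then consider "y < a" | "y > a" by linarith
      then have "eventually (\<lambda>n. indicat_real {..X n} y = indicat_real {..a} y) sequentially"
      proof cases
        case 1
        show ?thesis using order_tendstoD(1)[OF X 1] by eventually_elim (use 1 in \<open>auto simp: indicator_def\<close>)
      next
        case 2
        show ?thesis using order_tendstoD(2)[OF X 2] by eventually_elim (use 2 in \<open>auto simp: indicator_def\<close>)
      qed
      then have "(\<lambda>n. indicat_real {..X n} y) \<longlonglongrightarrow> indicat_real {..a} y"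
        by (rule tendsto_eventually)
      then show "(\<lambda>n. indicat_real {..X n} y *\<^sub>R w y) \<longlonglongrightarrow> indicat_real {..a} y *\<^sub>R w y"
        by (intro tendsto_intros)
    qed
    show "AE y in unit_measure. norm (indicat_real {..X n} y *\<^sub>R w y) \<le> norm (w y)" for n
      by (auto simp: indicator_def)
  qed (use integrable_cut[OF w] in \<open>auto intro: borel_measurable_integrable\<close>)
qed

lemma abs_cont_continuous:
  assumes "abs_cont f w" shows "continuous_on {0..1} f"
proof -
  have "continuous_on {0..1} (\<lambda>x. f 0 + primitive w x)"
    by (intro continuous_intros continuous_on_subset[OF continuous_primitive[OF abs_cont_integrable[OF assms]]]) auto
  then show ?thesis
    by (rule continuous_on_eq) (rule abs_contD[OF assms, symmetric])
qed

lemma continuous_measurable_unit: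
  fixes f :: "real \<Rightarrow> 'a::euclidean_space"
  assumes "continuous_on {0..1} f" shows "f \<in> borel_measurable unit_measure"
  by (rule continuous_imp_measurable_on_sets_lebesgue)
     (use assms in \<open>auto intro: continuous_on_subset\<close>)

lemma continuous_bounded_unit:
  fixes f :: "real \<Rightarrow> 'a::euclidean_space"
  assumes "continuous_on {0..1} f" obtains B where "\<And>x. x \<in> {0..1} \<Longrightarrow> norm (f x) \<le> B"
proof -
  have "bounded (f ` {0..1})"
    by (intro compact_imp_bounded compact_continuous_image assms) auto
  then show ?thesis
    using that unfolding bounded_iff by (metis imageI)
qed

lemma continuous_integrable_unit:
  fixes f :: "real \<Rightarrow> 'a::euclidean_space"
  assumes "continuous_on {0..1} f" shows "integrable unit_measure f"
proof -
  obtain B where B: "\<And>x. x \<in> {0..1} \<Longrightarrow> norm (f x) \<le> B"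
    using continuous_bounded_unit[OF assms] by blast
  show ?thesis
    by (rule unit.integrable_const_bound[of _ B])
       (use B continuous_measurable_unit[OF assms] in \<open>auto intro!: AE_I2\<close>)
qed

lemma continuous_square_integrable:
  assumes "continuous_on {0..1} f" shows "square_integrable f"
  unfolding square_integrable_def
  using continuous_measurable_unit[OF assms]
  by (auto intro!: continuous_integrable_unit continuous_intros assms)

lemma primitive_eq_integral:
  assumes w: "continuous_on {0..1} w" and x: "x \<in> {0..1}"
  shows "primitive w x = integral {0..x} w"
proof -
  have "primitive w x = integral {0<..<1} (\<lambda>y. indicat_real {..x} y *\<^sub>R w y)"
    unfolding primitive_def
    by (rule lebesgue_integral_eq_integral) (use integrable_cut[OF continuous_integrable_unit[OF w]] in auto)
  also have "\<dots> = integral {0..1} (\<lambda>y. indicat_real {..x} y *\<^sub>R w y)"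
    using integral_open_interval[of 0 "1::real"] by (simp add: box_real cbox_interval)
  also have "\<dots> = integral {0..1} (\<lambda>y. if y \<in> {..x} then w y else 0)"
    by (rule integral_cong) auto
  also have "\<dots> = integral ({..x} \<inter> {0..1}) w"
    by (rule Henstock_Kurzweil_Integration.integral_restrict_Int)
  also have "{..x} \<inter> {0..1} = {0..x}"
    using x by auto
  finally show ?thesis .
qed

lemma abs_cont_deriv:
  assumes f: "abs_cont f w" and w: "continuous_on {0..1} w" and x: "x \<in> {0..1}"
  shows "(f has_vector_derivative w x) (at x within {0..1})"
proof -
  have "((\<lambda>u. integral {0..u} w) has_vector_derivative w x) (at x within {0..1})"
    by (rule integral_has_vector_derivative[OF w x])
  then have "((\<lambda>u. f 0 + integral {0..u} w) has_vector_derivative w x) (at x within {0..1})"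
    by (auto intro!: derivative_eq_intros)
  then show ?thesis
  proof (rule has_vector_derivative_transform[OF x, rotated])
    fix y :: real assume "y \<in> {0..1}"
    then show "f y = f 0 + integral {0..y} w"
      by (metis abs_contD[OF f] primitive_eq_integral[OF w])
  qed
qed

lemma abs_cont_C1:
  assumes f: "\<And>x. x \<in> {0..1} \<Longrightarrow> (f has_vector_derivative w x) (at x within {0..1})"
    and w: "continuous_on {0..1} w"
  shows "abs_cont f w"
  unfolding abs_cont_def
proof (intro conjI ballI)
  show "integrable unit_measure w"
    by (rule continuous_integrable_unit[OF w])
  fix x :: real assume x: "x \<in> {0..1}"
  have "(w has_integral (f x - f 0)) {0..x}"
    by (rule fundamental_theorem_of_calculus)
       (use x in \<open>auto intro!: has_vector_derivative_within_subset[OF f]\<close>)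
  then show "f x = f 0 + primitive w x"
    by (simp add: primitive_eq_integral[OF w x] integral_unique)
qed

lemma abs_cont_cong_AE:
  assumes "abs_cont f w" "integrable unit_measure w'" "AE x in unit_measure. w x = w' x"
  shows "abs_cont f w'"
  unfolding abs_cont_def
  using assms(2) abs_contD[OF assms(1)] primitive_cong_AE[OF abs_cont_integrable[OF assms(1)] assms(2,3)]
  by metis

lemma abs_cont_cnj:
  assumes "abs_cont f w" shows "abs_cont (\<lambda>x. cnj (f x)) (\<lambda>x. cnj (w x))"
  unfolding abs_cont_def
proof (intro conjI ballI)
  show "integrable unit_measure (\<lambda>x. cnj (w x))"
    using abs_cont_integrable[OF assms] by simp
  fix x :: real assume "x \<in> {0..1}"
  then have "cnj (f x) = cnj (f 0) + cnj (primitive w x)"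
    using abs_contD[OF assms] by (metis complex_cnj_add)
  also have "cnj (primitive w x) = primitive (\<lambda>x. cnj (w x)) x"
    unfolding primitive_def by (subst Bochner_Integration.integral_cnj[symmetric]) (simp add: scaleR_conv_of_real)
  finally show "cnj (f x) = cnj (f 0) + primitive (\<lambda>x. cnj (w x)) x" .
qed

text \<open>
  Integration by parts. For two primitives starting from \<open>0\<close> both integrals are double
  integrals of \<open>w x * z y\<close>, over the triangles \<open>y \<le> x\<close> and \<open>x \<le> y\<close>. The triangles overlap in the
  diagonal only, a null set, so by Fubini the integrals add up to the integral over the square.
\<close>

lemma primitive_by_parts:
  assumes w: "integrable unit_measure w" and z: "integrable unit_measure z"
  shows "(\<integral>x. w x * primitive z x \<partial>unit_measure) + (\<integral>x. primitive w x * z x \<partial>unit_measure)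
    = (\<integral>x. w x \<partial>unit_measure) * (\<integral>x. z x \<partial>unit_measure)"
proof -
  have [measurable]: "w \<in> borel_measurable unit_measure" "z \<in> borel_measurable unit_measure"
    using w z by auto
  have [measurable]: "(\<lambda>x. x) \<in> borel_measurable unit_measure"
    by (auto intro: continuous_measurable_unit)
  let ?M = "unit_measure \<Otimes>\<^sub>M unit_measure"
  define h where "h p = w (fst p) * z (snd p)" for p
  have h: "integrable ?M h"
  proof (rule unit_pair.Fubini_integrable)
    show "h \<in> borel_measurable ?M"
      unfolding h_def by measurable
    show "integrable unit_measure (\<lambda>x. \<integral>y. norm (h (x, y)) \<partial>unit_measure)"
      using w z by (simp add: h_def norm_mult)
    show "AE x in unit_measure. integrable unit_measure (\<lambda>y. h (x, y))"
      using z by (simp add: h_def)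
  qed
  define T1 where "T1 = {p \<in> space ?M. snd p \<le> fst p}"
  define T2 where "T2 = {p \<in> space ?M. fst p \<le> snd p}"
  have T1: "T1 \<in> sets ?M" and T2: "T2 \<in> sets ?M"
    unfolding T1_def T2_def by measurable
  have h1: "integrable ?M (\<lambda>p. indicat_real T1 p *\<^sub>R h p)" and h2: "integrable ?M (\<lambda>p. indicat_real T2 p *\<^sub>R h p)"
    by (intro integrable_mult_indicator h T1 T2)+
  have "(\<integral>x. w x * primitive z x \<partial>unit_measure)
      = (\<integral>x. (\<integral>y. indicat_real T1 (x, y) *\<^sub>R h (x, y) \<partial>unit_measure) \<partial>unit_measure)"
  proof (rule Bochner_Integration.integral_cong[OF refl])
    fix x :: real assume x: "x \<in> space unit_measure"
    have "(\<integral>y. indicat_real T1 (x, y) *\<^sub>R h (x, y) \<partial>unit_measure)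
        = w x * (\<integral>y. indicat_real {..x} y *\<^sub>R z y \<partial>unit_measure)"
      by (subst Bochner_Integration.integral_mult_right[OF integrable_cut[OF z], symmetric], rule Bochner_Integration.integral_cong[OF refl])
         (use x in \<open>auto simp: T1_def h_def space_pair_measure indicator_def\<close>)
    then show "w x * primitive z x = (\<integral>y. indicat_real T1 (x, y) *\<^sub>R h (x, y) \<partial>unit_measure)"
      by (simp add: primitive_def)
  qed
  also have "\<dots> = integral\<^sup>L ?M (\<lambda>p. indicat_real T1 p *\<^sub>R h p)"
    by (rule unit_pair.integral_fst'[OF h1])
  finally have 1: "(\<integral>x. w x * primitive z x \<partial>unit_measure) = integral\<^sup>L ?M (\<lambda>p. indicat_real T1 p *\<^sub>R h p)" .
  have h2': "integrable ?M (\<lambda>(x, y). indicat_real T2 (x, y) *\<^sub>R h (x, y))"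
    using h2 by (simp add: case_prod_unfold)
  have "(\<integral>y. primitive w y * z y \<partial>unit_measure)
      = (\<integral>y. (\<integral>x. indicat_real T2 (x, y) *\<^sub>R h (x, y) \<partial>unit_measure) \<partial>unit_measure)"
  proof (rule Bochner_Integration.integral_cong[OF refl])
    fix y :: real assume y: "y \<in> space unit_measure"
    have "(\<integral>x. indicat_real T2 (x, y) *\<^sub>R h (x, y) \<partial>unit_measure)
        = (\<integral>x. indicat_real {..y} x *\<^sub>R w x \<partial>unit_measure) * z y"
      by (subst Bochner_Integration.integral_mult_left[OF integrable_cut[OF w], symmetric], rule Bochner_Integration.integral_cong[OF refl])
         (use y in \<open>auto simp: T2_def h_def space_pair_measure indicator_def\<close>)
    then show "primitive w y * z y = (\<integral>x. indicat_real T2 (x, y) *\<^sub>R h (x, y) \<partial>unit_measure)"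
      by (simp add: primitive_def)
  qed
  also have "\<dots> = integral\<^sup>L ?M (\<lambda>(x, y). indicat_real T2 (x, y) *\<^sub>R h (x, y))"
    by (rule unit_pair.integral_snd[OF h2'])
  finally have 2: "(\<integral>y. primitive w y * z y \<partial>unit_measure) = integral\<^sup>L ?M (\<lambda>p. indicat_real T2 p *\<^sub>R h p)"
    by (simp add: case_prod_unfold)
  have diag: "AE p in ?M. fst p \<noteq> snd p"
  proof (rule unit_pair.AE_pair_measure)
    show "{p \<in> space ?M. fst p \<noteq> snd p} \<in> sets ?M"
      by measurable
    show "AE x in unit_measure. AE y in unit_measure. fst (x, y) \<noteq> snd (x, y)"
      using AE_unit_neq by (auto simp: eq_commute)
  qed
  have "integral\<^sup>L ?M (\<lambda>p. indicat_real T1 p *\<^sub>R h p) + integral\<^sup>L ?M (\<lambda>p. indicat_real T2 p *\<^sub>R h p)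
      = integral\<^sup>L ?M (\<lambda>p. indicat_real T1 p *\<^sub>R h p + indicat_real T2 p *\<^sub>R h p)"
    by (rule Bochner_Integration.integral_add[OF h1 h2, symmetric])
  also have "\<dots> = integral\<^sup>L ?M h"
  proof (rule integral_cong_AE)
    show "AE p in ?M. indicat_real T1 p *\<^sub>R h p + indicat_real T2 p *\<^sub>R h p = h p"
      using diag AE_space
      by eventually_elim (auto simp: T1_def T2_def indicator_def)
  qed (use h h1 h2 in auto)
  also have "\<dots> = (\<integral>x. (\<integral>y. h (x, y) \<partial>unit_measure) \<partial>unit_measure)"
    by (rule unit_pair.integral_fst'[OF h, symmetric])
  also have "\<dots> = (\<integral>x. w x \<partial>unit_measure) * (\<integral>x. z x \<partial>unit_measure)"
    by (simp add: h_def)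
  finally show ?thesis
    by (simp add: 1 2)
qed

lemma integrable_mult_continuous:
  fixes w f :: "real \<Rightarrow> complex"
  assumes w: "integrable unit_measure w" and f: "continuous_on {0..1} f"
  shows "integrable unit_measure (\<lambda>x. w x * f x)"
proof -
  obtain B where B: "\<And>x. x \<in> {0..1} \<Longrightarrow> norm (f x) \<le> B"
    using continuous_bounded_unit[OF f] by blast
  have [measurable]: "w \<in> borel_measurable unit_measure" "f \<in> borel_measurable unit_measure"
    using w continuous_measurable_unit[OF f] by auto
  show ?thesis
  proof (rule Bochner_Integration.integrable_bound)
    show "integrable unit_measure (\<lambda>x. w x * of_real B)"
      using w by simp
    show "AE x in unit_measure. norm (w x * f x) \<le> norm (w x * of_real B)"
      by (rule AE_unit_cong) (use B in \<open>auto simp: norm_mult intro!: mult_left_mono order_trans[OF B]\<close>)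
  qed measurable
qed

lemma integration_by_parts_mult:
  assumes f: "abs_cont f w" and g: "abs_cont g z"
  shows "(\<integral>x. w x * g x \<partial>unit_measure) + (\<integral>x. f x * z x \<partial>unit_measure) = f 1 * g 1 - f 0 * g 0"
proof -
  have w: "integrable unit_measure w" and z: "integrable unit_measure z"
    using f g by (auto simp: abs_cont_def)
  have [simp]: "integrable unit_measure (\<lambda>x. w x * primitive z x)"
      "integrable unit_measure (\<lambda>x. primitive w x * z x)"
    using integrable_mult_continuous[OF w continuous_on_subset[OF continuous_primitive[OF z]]]
      integrable_mult_continuous[OF z continuous_on_subset[OF continuous_primitive[OF w]]]
    by (auto simp: mult.commute)
  have f': "f x = f 0 + primitive w x" and g': "g x = g 0 + primitive z x" if "x \<in> {0..1}" for x
    using abs_contD[OF f that] abs_contD[OF g that] .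
  have 1: "(\<integral>x. w x * g x \<partial>unit_measure) = (\<integral>x. w x * g 0 + w x * primitive z x \<partial>unit_measure)"
    by (rule Bochner_Integration.integral_cong[OF refl], subst g') (auto simp: distrib_left)
  have 2: "(\<integral>x. f x * z x \<partial>unit_measure) = (\<integral>x. f 0 * z x + primitive w x * z x \<partial>unit_measure)"
    by (rule Bochner_Integration.integral_cong[OF refl], subst f') (auto simp: distrib_right)
  have "(\<integral>x. w x * g x \<partial>unit_measure) + (\<integral>x. f x * z x \<partial>unit_measure)
      = (\<integral>x. w x \<partial>unit_measure) * g 0 + f 0 * (\<integral>x. z x \<partial>unit_measure)
        + ((\<integral>x. w x * primitive z x \<partial>unit_measure) + (\<integral>x. primitive w x * z x \<partial>unit_measure))"
    unfolding 1 2 using w z by simp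
  also have "\<dots> = f 1 * g 1 - f 0 * g 0"
    unfolding primitive_by_parts[OF w z] using f'[of 1] g'[of 1]
    by (simp add: primitive_ge_1 algebra_simps)
  finally show ?thesis .
qed

lemma integration_by_parts_inner:
  assumes f: "abs_cont f w" and g: "abs_cont g z"
  shows "(\<integral>x. w x \<bullet> g x \<partial>unit_measure) + (\<integral>x. f x \<bullet> z x \<partial>unit_measure) = f 1 \<bullet> g 1 - f 0 \<bullet> g 0"
proof -
  have w: "integrable unit_measure w" and z: "integrable unit_measure z"
    using f g by (auto simp: abs_cont_def)
  have inner: "a \<bullet> b = Re (a * cnj b)" for a b :: complex
    by (simp add: inner_complex_def)
  have 1: "integrable unit_measure (\<lambda>x. w x * cnj (g x))"
    by (intro integrable_mult_continuous w continuous_intros abs_cont_continuous[OF g])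
  have 2: "integrable unit_measure (\<lambda>x. f x * cnj (z x))"
    using integrable_mult_continuous[OF integrable_cnj[OF z] abs_cont_continuous[OF f]]
    by (simp add: mult.commute)
  have "(\<integral>x. w x \<bullet> g x \<partial>unit_measure) + (\<integral>x. f x \<bullet> z x \<partial>unit_measure)
      = Re ((\<integral>x. w x * cnj (g x) \<partial>unit_measure) + (\<integral>x. f x * cnj (z x) \<partial>unit_measure))"
    unfolding inner plus_complex.sel integral_Re[OF 1] integral_Re[OF 2] ..
  also have "\<dots> = Re (f 1 * cnj (g 1) - f 0 * cnj (g 0))"
    by (subst integration_by_parts_mult[OF f abs_cont_cnj[OF g]]) simp
  finally show ?thesis
    by (simp add: inner)
qed

section \<open>Test functions and the du Bois-Reymond lemma\<close>

text \<open>
  The class of functions \<open>p(1/x) exp(-1/x)\<close>, extended by \<open>0\<close> to \<open>x \<le> 0\<close>, is closed under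
  differentiation, and with it the building blocks of the bump functions below.
\<close>

definition flat :: "real poly \<Rightarrow> real \<Rightarrow> real"
  where "flat p x = (if x > 0 then poly p (1 / x) * exp (- (1 / x)) else 0)"

lemma poly_exp_tendsto_0: "((\<lambda>y::real. poly p y * exp (- y)) \<longlongrightarrow> 0) at_top"
proof -
  have "((\<lambda>y. \<Sum>i\<le>degree p. coeff p i * (y ^ i / exp y)) \<longlongrightarrow> (\<Sum>i\<le>degree p. coeff p i * 0)) at_top"
    by (intro tendsto_intros tendsto_power_div_exp_0)
  then show ?thesis
    by (simp add: poly_altdef sum_distrib_right exp_minus divide_inverse mult.assoc)
qed

lemma flat_has_derivative:
  "(flat p has_real_derivative flat ([:0, 0, 1:] * (p - pderiv p)) x) (at x)"
proof -
  consider "x < 0" | "x > 0" | "x = 0" by linarith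
  then show ?thesis
  proof cases
    case 1
    have "((\<lambda>_. 0) has_real_derivative 0) (at x)" by simp
    then have "(flat p has_real_derivative 0) (at x)"
      by (rule DERIV_cong_ev[THEN iffD1, rotated -1])
         (use 1 in \<open>auto intro!: eventually_mono[OF order_tendstoD(2)[OF tendsto_ident_at]] simp: flat_def eventually_nhds_conv_at\<close>)
    then show ?thesis using 1 by (simp add: flat_def)
  next
    case 2
    have "((\<lambda>x. poly p (1 / x) * exp (- (1 / x))) has_real_derivative
        flat ([:0, 0, 1:] * (p - pderiv p)) x) (at x)"
      using 2
      by (auto intro!: derivative_eq_intros DERIV_chain2[OF poly_DERIV]
            simp: flat_def field_simps power2_eq_square)
    then show ?thesis
      by (rule DERIV_cong_ev[THEN iffD1, rotated -1])
         (use 2 in \<open>auto intro!: eventually_mono[OF order_tendstoD(1)[OF tendsto_ident_at]] simp: flat_def eventually_nhds_conv_at\<close>)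
  next
    case 3
    \<comment> \<open>With \<open>y = 1/h\<close> the right difference quotient is \<open>y p(y) exp(-y)\<close>, again a polynomial times \<open>exp(-y)\<close>.\<close>
    have "((\<lambda>h. flat p h / h) \<longlongrightarrow> 0) (at_right 0)"
    proof -
      have "((\<lambda>y. poly (p * [:0, 1:]) y * exp (- y)) \<longlongrightarrow> 0) at_top"
        by (rule poly_exp_tendsto_0)
      then have "((\<lambda>h. poly (p * [:0, 1:]) (inverse h) * exp (- inverse h)) \<longlongrightarrow> 0) (at_right 0)"
        by (rule filterlim_compose[OF _ filterlim_inverse_at_top_right])
      then show ?thesis
        by (rule Lim_transform_eventually)
           (auto intro!: eventually_at_right_less[THEN eventually_mono] simp: flat_def field_simps)
    qed
    moreover have "((\<lambda>h. flat p h / h) \<longlongrightarrow> 0) (at_left 0)"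
      by (rule tendsto_eventually)
         (auto simp: eventually_at_filter flat_def)
    ultimately have "((\<lambda>h. flat p h / h) \<longlongrightarrow> 0) (at 0)"
      by (simp add: filterlim_split_at)
    then show ?thesis
      using 3 by (simp add: DERIV_def flat_def)
  qed
qed

text \<open>
  Defining the space of bump functions by its generators turns smoothness into an induction: a
  generator is differentiated by the product rule into two more of them, so the space is closed
  under differentiation. The parameters \<open>a\<close> and \<open>b\<close> bound the supports.
\<close>

inductive_set bumps :: "real \<Rightarrow> real \<Rightarrow> (real \<Rightarrow> complex) set" for a b
  where
    base: "a \<le> a' \<Longrightarrow> b' \<le> b \<Longrightarrow> n > 0 \<Longrightarrow>
      (\<lambda>x. complex_of_real (flat p (n * (x - a')) * flat q (n * (b' - x)))) \<in> bumps a b"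
  | add: "f \<in> bumps a b \<Longrightarrow> g \<in> bumps a b \<Longrightarrow> (\<lambda>x. f x + g x) \<in> bumps a b"
  | scale: "f \<in> bumps a b \<Longrightarrow> (\<lambda>x. c * f x) \<in> bumps a b"

lemma bumps_deriv:
  "f \<in> bumps a b \<Longrightarrow> \<exists>g\<in>bumps a b. \<forall>x. (f has_vector_derivative g x) (at x)"
proof (induction rule: bumps.induct)
  case (base a' b' n p q)
  let ?d = "\<lambda>p. [:0, 0, 1:] * (p - pderiv p) :: real poly"
  let ?g = "\<lambda>x. of_real n * complex_of_real (flat (?d p) (n * (x - a')) * flat q (n * (b' - x)))
      + of_real (- n) * complex_of_real (flat p (n * (x - a')) * flat (?d q) (n * (b' - x)))"
  have "?g \<in> bumps a b"
    by (intro bumps.intros base)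
  moreover have "((\<lambda>x. complex_of_real (flat p (n * (x - a')) * flat q (n * (b' - x)))) has_vector_derivative ?g x) (at x)" for x
  proof -
    have "((\<lambda>x. flat p (n * (x - a'))) has_real_derivative flat (?d p) (n * (x - a')) * n) (at x)"
      by (rule DERIV_chain2[OF flat_has_derivative]) (auto intro!: derivative_eq_intros)
    moreover have "((\<lambda>x. flat q (n * (b' - x))) has_real_derivative flat (?d q) (n * (b' - x)) * (- n)) (at x)"
      by (rule DERIV_chain2[OF flat_has_derivative]) (auto intro!: derivative_eq_intros)
    ultimately have "((\<lambda>x. flat p (n * (x - a')) * flat q (n * (b' - x))) has_real_derivative
        flat (?d p) (n * (x - a')) * n * flat q (n * (b' - x)) +
        flat (?d q) (n * (b' - x)) * (- n) * flat p (n * (x - a'))) (at x)"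
      by (rule DERIV_mult)
    then have "((\<lambda>x. complex_of_real (flat p (n * (x - a')) * flat q (n * (b' - x)))) has_vector_derivative
        of_real (flat (?d p) (n * (x - a')) * n * flat q (n * (b' - x)) +
        flat (?d q) (n * (b' - x)) * (- n) * flat p (n * (x - a')))) (at x)"
      by (rule has_vector_derivative_of_real)
    then show ?thesis
      by (rule has_vector_derivative_eq_rhs) (simp add: algebra_simps)
  qed
  ultimately show ?case by (intro bexI[of _ ?g] allI)
next
  case (add f g)
  then obtain f' g' where "f' \<in> bumps a b" "g' \<in> bumps a b"
      "\<And>x. (f has_vector_derivative f' x) (at x)" "\<And>x. (g has_vector_derivative g' x) (at x)"
    by blast
  then show ?case
    by (intro bexI[of _ "\<lambda>x. f' x + g' x"]) (auto intro!: has_vector_derivative_add bumps.add)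
next
  case (scale f c)
  then obtain f' where "f' \<in> bumps a b" "\<And>x. (f has_vector_derivative f' x) (at x)"
    by blast
  then show ?case
    by (intro bexI[of _ "\<lambda>x. c * f' x"]) (auto intro!: has_vector_derivative_mult_right bumps.scale)
qed

lemma bumps_support: "f \<in> bumps a b \<Longrightarrow> x \<notin> {a..b} \<Longrightarrow> f x = 0"
proof (induction rule: bumps.induct)
  case (base a' b' n p q)
  then have "x - a' \<le> 0 \<or> b' - x \<le> 0" by auto
  then have "n * (x - a') \<le> 0 \<or> n * (b' - x) \<le> 0"
    using \<open>n > 0\<close> by (auto simp: mult_le_0_iff)
  then show ?case by (auto simp: flat_def)
qed auto

lemma bumps_continuous: "f \<in> bumps a b \<Longrightarrow> continuous_on A f"
  using bumps_deriv[of f a b]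
  by (meson continuous_at_imp_continuous_on has_vector_derivative_continuous)

lemma nderiv_0 [simp]: "nderiv A 0 f = f"
  by (simp add: nderiv_def)

lemma nderiv_Suc: "nderiv A (Suc k) f = (\<lambda>x. vector_derivative (nderiv A k f) (at x within A))"
  by (simp add: nderiv_def)

lemma nderiv_nderiv: "nderiv A j (nderiv A k f) = nderiv A (j + k) f"
  by (simp add: nderiv_def funpow_add)

text \<open>
  Smoothness without formulas for the higher derivatives: they all stay in \<open>S\<close>.
\<close>

lemma smooth_on_UNIV_if_closed_under_deriv:
  assumes closed: "\<And>f. f \<in> S \<Longrightarrow> \<exists>g\<in>S. \<forall>x. (f has_vector_derivative g x) (at x)" and f: "f \<in> S"
  shows "smooth_on UNIV f"
proof -
  have "nderiv UNIV k f \<in> S" for k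
  proof (induction k)
    case (Suc k)
    then obtain g where g: "g \<in> S" "\<And>x. (nderiv UNIV k f has_vector_derivative g x) (at x)"
      using closed by blast
    then have "nderiv UNIV (Suc k) f = g"
      by (auto simp: nderiv_Suc vector_derivative_at)
    with g show ?case by simp
  qed (use f in simp)
  then show ?thesis
    using closed unfolding smooth_on_def by (meson differentiableI_vector)
qed

lemma test_functionI:
  assumes "smooth_on UNIV \<phi>" "\<And>x. x \<notin> {a..b} \<Longrightarrow> \<phi> x = 0" "0 < a" "b < 1"
  shows "test_function \<phi>"
proof -
  have sub: "closure {x. \<phi> x \<noteq> 0} \<subseteq> {a..b}"
    by (rule closure_minimal) (use assms(2) in blast, simp)
  then have "compact (closure {x. \<phi> x \<noteq> 0})"
    by (meson bounded_closed_interval bounded_subset closed_closure compact_eq_bounded_closed)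
  moreover have "closure {x. \<phi> x \<noteq> 0} \<subseteq> {0<..<1}"
    using sub assms(3,4) by force
  ultimately show ?thesis
    using assms(1) by (simp add: test_function_def)
qed

lemma test_function_bumps: "f \<in> bumps a b \<Longrightarrow> 0 < a \<Longrightarrow> b < 1 \<Longrightarrow> test_function f"
  by (rule test_functionI[of _ a b])
     (auto intro: smooth_on_UNIV_if_closed_under_deriv[of "bumps a b"] bumps_deriv bumps_support)

lemma smooth_on_UNIV_deriv:
  "smooth_on UNIV \<phi> \<Longrightarrow> (nderiv UNIV k \<phi> has_vector_derivative nderiv UNIV (Suc k) \<phi> x) (at x)"
  unfolding smooth_on_def nderiv_Suc by (auto simp: vector_derivative_works)

lemma test_function_deriv:
  assumes \<phi>: "test_function \<phi>" shows "test_function (nderiv UNIV 1 \<phi>)"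
proof -
  let ?K = "closure {x. \<phi> x \<noteq> 0}"
  have smooth: "smooth_on UNIV \<phi>"
    using \<phi> by (simp add: test_function_def)
  have "nderiv UNIV 1 \<phi> x = 0" if "x \<notin> ?K" for x
  proof -
    have "(\<phi> has_vector_derivative nderiv UNIV 1 \<phi> x) (at x)"
      using smooth_on_UNIV_deriv[OF smooth, of 0] by simp
    moreover have "(\<phi> has_vector_derivative 0) (at x)"
    proof (rule has_vector_derivative_transform_within_open[of "\<lambda>_. 0" _ _ "- ?K"])
      show "0 = \<phi> y" if "y \<in> - ?K" for y
        using that closure_subset[of "{x. \<phi> x \<noteq> 0}"] by auto
    qed (use that in auto)
    ultimately show ?thesis
      by (rule vector_derivative_unique_at)
  qed
  then have sub: "closure {x. nderiv UNIV 1 \<phi> x \<noteq> 0} \<subseteq> ?K"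
    by (intro closure_minimal) auto
  moreover have "smooth_on UNIV (nderiv UNIV 1 \<phi>)"
    using smooth unfolding smooth_on_def nderiv_nderiv by blast
  ultimately show ?thesis
    using \<phi> unfolding test_function_def
    by (meson bounded_subset closed_closure compact_eq_bounded_closed order_trans)
qed

lemma test_function_eq_0: "test_function \<phi> \<Longrightarrow> x \<notin> {0<..<1} \<Longrightarrow> \<phi> x = 0"
  unfolding test_function_def using closure_subset[of "{x. \<phi> x \<noteq> 0}"] by blast

lemma test_function_abs_cont:
  assumes "test_function \<phi>" shows "abs_cont \<phi> (nderiv UNIV 1 \<phi>)"
proof (rule abs_cont_C1)
  have "smooth_on UNIV \<phi>"
    using assms by (simp add: test_function_def)
  note d = smooth_on_UNIV_deriv[OF this]
  show "(\<phi> has_vector_derivative nderiv UNIV 1 \<phi> x) (at x within {0..1})" for x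
    using d[of 0 x] by (auto intro: has_vector_derivative_at_within)
  show "continuous_on {0..1} (nderiv UNIV 1 \<phi>)"
    using d[of 1] by (meson continuous_at_imp_continuous_on has_vector_derivative_continuous)
qed

lemma test_function_continuous: "test_function \<phi> \<Longrightarrow> continuous_on {0..1} \<phi>"
  by (rule abs_cont_continuous[OF test_function_abs_cont])

text \<open>
  Since \<open>exp(-1/(n y))\<close> tends to \<open>1\<close> for every \<open>y > 0\<close>, these functions tend to the indicator
  function of \<open>(a,b)\<close>, and they are bounded by \<open>1\<close>.
\<close>

definition bump :: "real \<Rightarrow> real \<Rightarrow> nat \<Rightarrow> real \<Rightarrow> complex"
  where "bump a b n x = complex_of_real (flat 1 (real (Suc n) * (x - a)) * flat 1 (real (Suc n) * (b - x)))"

lemma bump_in_bumps: "a0 \<le> a \<Longrightarrow> b \<le> b0 \<Longrightarrow> bump a b n \<in> bumps a0 b0"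
  unfolding bump_def [abs_def] by (rule bumps.base) auto

lemma tendsto_bump_integral:
  assumes h: "integrable unit_measure h"
  shows "(\<lambda>n. \<integral>x. h x * bump a b n x \<partial>unit_measure) \<longlonglongrightarrow>
    (\<integral>x. indicat_real {a<..<b} x *\<^sub>R h x \<partial>unit_measure)"
proof (rule integral_dominated_convergence)
  have [measurable]: "h \<in> borel_measurable unit_measure"
    using h by auto
  have [measurable]: "bump a b n \<in> borel_measurable unit_measure" for n
    by (rule continuous_measurable_unit[OF bumps_continuous[OF bump_in_bumps[OF order_refl order_refl]]])
  show "(\<lambda>x. h x * bump a b n x) \<in> borel_measurable unit_measure" for n
    by measurable
  have flat1: "\<bar>flat 1 x\<bar> \<le> 1" for x
    by (simp add: flat_def)
  have "norm (bump a b n x) \<le> 1" for n x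
    unfolding bump_def norm_of_real abs_mult using mult_mono[OF flat1 flat1] by simp
  then show "AE x in unit_measure. norm (h x * bump a b n x) \<le> norm (h x)" for n
    by (auto simp: norm_mult mult_left_le)
  show "integrable unit_measure (\<lambda>x. norm (h x))"
    using h by simp
  have lim1: "(\<lambda>n. flat 1 (real (Suc n) * y)) \<longlonglongrightarrow> (if y > 0 then 1 else 0)" for y
  proof (cases "y > 0")
    case True
    have "(\<lambda>n. exp (- (1 / y) * inverse (real (Suc n)))) \<longlonglongrightarrow> exp (- (1 / y) * 0)"
      by (intro tendsto_intros LIMSEQ_inverse_real_of_nat)
    moreover have "flat 1 (real (Suc n) * y) = exp (- (1 / y) * inverse (real (Suc n)))" for n
      using True by (simp add: flat_def field_simps del: of_nat_Suc)
    ultimately show ?thesis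
      using True by simp
  next
    case False
    then have "flat 1 (real (Suc n) * y) = 0" for n
      by (auto simp: flat_def zero_less_mult_iff)
    then show ?thesis using False by simp
  qed
  have "(\<lambda>n. bump a b n x) \<longlonglongrightarrow> of_real ((if x - a > 0 then 1 else 0) * (if b - x > 0 then 1 else 0))" for x
    unfolding bump_def by (intro tendsto_intros lim1)
  moreover have "(if x - a > 0 then 1 else 0) * (if b - x > 0 then 1 else 0) = indicat_real {a<..<b} x" for x
    by (auto simp: indicator_def)
  ultimately have lim: "(\<lambda>n. bump a b n x) \<longlonglongrightarrow> of_real (indicat_real {a<..<b} x)" for x
    by metis
  then show "AE x in unit_measure. (\<lambda>n. h x * bump a b n x) \<longlonglongrightarrow> indicat_real {a<..<b} x *\<^sub>R h x"
    by (auto intro!: tendsto_mult_left simp: scaleR_conv_of_real mult.commute[of "of_real _"])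
  show "(\<lambda>x. indicat_real {a<..<b} x *\<^sub>R h x) \<in> borel_measurable unit_measure"
    by (rule borel_measurable_LIMSEQ_metric[of "\<lambda>n x. h x * bump a b n x"])
       (use lim in \<open>auto intro!: tendsto_mult_left simp: scaleR_conv_of_real mult.commute[of "of_real _"]\<close>)
qed

lemma ex_bump_integral_nonzero: "\<exists>n. (\<integral>x. bump (1/4) (3/4) n x \<partial>unit_measure) \<noteq> 0"
proof -
  have "(\<lambda>n. \<integral>x. 1 * bump (1/4) (3/4) n x \<partial>unit_measure) \<longlonglongrightarrow>
      (\<integral>x. indicat_real {1/4<..<3/4} x *\<^sub>R 1 \<partial>unit_measure)"
    by (rule tendsto_bump_integral) simp
  also have "(\<integral>x. indicat_real {1/4<..<3/4} x *\<^sub>R (1::complex) \<partial>unit_measure) = 1/2"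
  proof -
    have m: "measure unit_measure {1/4<..<3/4} = 1/2"
      by (subst measure_restrict_space) auto
    have "{1/4<..<3/4::real} \<in> sets unit_measure"
      by (auto simp: sets_restrict_space image_iff intro!: bexI[of _ "{1/4<..<3/4::real}"])
    then have "(\<integral>x. indicat_real {1/4<..<3/4} x *\<^sub>R (1::complex) \<partial>unit_measure)
        = of_real (measure unit_measure {1/4<..<3/4})"
      by (simp add: scaleR_conv_of_real)
    then show ?thesis unfolding m by simp
  qed
  finally have "eventually (\<lambda>n. (\<integral>x. 1 * bump (1/4) (3/4) n x \<partial>unit_measure) \<noteq> 0) sequentially"
    by (rule tendsto_imp_eventually_ne) simp
  then show ?thesis
    by (auto simp: eventually_sequentially)
qed

text \<open>
  The integral of \<open>g\<close> vanishes over intervals, hence over Borel sets by a monotone class argument,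
  hence over Lebesgue sets, which are Borel up to null sets.
\<close>

lemma AE_zero_if_primitive_zero:
  assumes g: "integrable unit_measure g" and zero: "\<And>x. primitive g x = 0"
  shows "AE x in unit_measure. g x = 0"
proof (rule unit.density_zero[OF g])
  have g0: "(\<integral>x. g x \<partial>unit_measure) = 0"
    using zero[of 1] by (simp add: primitive_ge_1)
  note int = integrable_borel_indicator[OF _ g]
  have borel: "(\<integral>x. indicat_real A x *\<^sub>R g x \<partial>unit_measure) = 0" if "A \<in> sets borel" for A
    using that
  proof (induction rule: borel_set_induct)
    case empty
    show ?case by simp
  next
    case (interval a b)
    have "(\<integral>x. indicat_real {a..b} x *\<^sub>R g x \<partial>unit_measure) =
        (\<integral>x. indicat_real {..b} x *\<^sub>R g x - indicat_real {..a} x *\<^sub>R g x \<partial>unit_measure)"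
    proof (rule integral_cong_AE)
      show "AE x in unit_measure. indicat_real {a..b} x *\<^sub>R g x =
          indicat_real {..b} x *\<^sub>R g x - indicat_real {..a} x *\<^sub>R g x"
        using AE_unit_neq[of a] by eventually_elim (use interval in \<open>auto simp: indicator_def\<close>)
    qed (use int[of "{a..b}"] int[of "{..b}"] int[of "{..a}"] in \<open>auto intro!: borel_measurable_diff\<close>)
    also have "\<dots> = primitive g b - primitive g a"
      unfolding primitive_def by (intro Bochner_Integration.integral_diff integrable_cut g)
    finally show ?case by (simp add: zero)
  next
    case (compl A)
    have "(\<integral>x. indicat_real (- A) x *\<^sub>R g x \<partial>unit_measure) = (\<integral>x. g x - indicat_real A x *\<^sub>R g x \<partial>unit_measure)"
      by (intro Bochner_Integration.integral_cong) (auto simp: indicator_def)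
    also have "\<dots> = 0"
      using g0 compl by (subst Bochner_Integration.integral_diff[OF g int]) auto
    finally show ?case .
  next
    case (union A)
    let ?A = "\<lambda>i. A i \<inter> {0<..<1}"
    have cut: "set_lebesgue_integral unit_measure (B \<inter> {0<..<1}) g = (\<integral>x. indicat_real B x *\<^sub>R g x \<partial>unit_measure)" for B
      unfolding set_lebesgue_integral_def
      by (intro Bochner_Integration.integral_cong) (auto simp: indicator_def)
    have "(\<integral>x. indicat_real (\<Union>i. A i) x *\<^sub>R g x \<partial>unit_measure) = set_lebesgue_integral unit_measure (\<Union>i. ?A i) g"
      using cut[of "\<Union>i. A i"] by (simp add: Int_UN_distrib2)
    also have "\<dots> = (\<Sum>i. set_lebesgue_integral unit_measure (?A i) g)"
    proof (rule lebesgue_integral_countable_add)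
      show meas: "?A i \<in> sets unit_measure" for i
        using union(2)[of i] by (auto simp: sets_restrict_space)
      show "?A i \<inter> ?A j = {}" if "i \<noteq> j" for i j
        using union(1) that by (auto simp: disjoint_family_on_def)
      show "set_integrable unit_measure (\<Union>i. ?A i) g"
        unfolding set_integrable_def
        by (intro integrable_mult_indicator g sets.countable_UN) (use meas in auto)
    qed
    also have "\<dots> = 0"
      using union(3) by (simp add: cut)
    finally show ?case .
  qed
  show "set_lebesgue_integral unit_measure A g = 0" if "A \<in> sets unit_measure" for A
  proof -
    from that have "A \<in> sets lebesgue"
      by (auto simp: sets_restrict_space)
    then obtain S N N' where A: "A = S \<union> N" "N \<subseteq> N'" "N' \<in> null_sets lborel" "S \<in> sets lborel"
      by (rule sets_completionE)
    have "AE x in lebesgue. x \<notin> N'"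
      by (rule AE_not_in) (use A(3) in \<open>auto simp: null_sets_completionI\<close>)
    then have ae: "AE x in unit_measure. x \<notin> N'"
      by (subst AE_restrict_space_iff) auto
    have "set_lebesgue_integral unit_measure A g = (\<integral>x. indicat_real S x *\<^sub>R g x \<partial>unit_measure)"
      unfolding set_lebesgue_integral_def
    proof (rule integral_cong_AE)
      show "AE x in unit_measure. indicat_real A x *\<^sub>R g x = indicat_real S x *\<^sub>R g x"
        using ae by eventually_elim (use A(1,2) in \<open>auto simp: indicator_def\<close>)
      show "(\<lambda>x. indicat_real A x *\<^sub>R g x) \<in> borel_measurable unit_measure"
        using integrable_mult_indicator[OF that g] by auto
    qed (use int[of S] A(4) in auto)
    also have "\<dots> = 0"
      using borel A(4) by simp
    finally show ?thesis .
  qed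
qed

text \<open>
  A bump of mean zero is the derivative of a test function; subtracting
  from any bump a multiple of a fixed one \<open>\<rho>\<close> shows that \<open>h - c\<close> is orthogonal to all bumps, where
  \<open>c\<close> is the \<open>\<rho>\<close>-average of \<open>h\<close>. As bumps approximate indicator functions of intervals, \<open>h - c\<close> has
  a vanishing primitive.
\<close>

lemma du_Bois_Reymond:
  assumes h: "integrable unit_measure h"
    and orth: "\<And>\<phi>. test_function \<phi> \<Longrightarrow> (\<integral>x. h x * nderiv UNIV 1 \<phi> x \<partial>unit_measure) = 0"
  shows "\<exists>c. AE x in unit_measure. h x = c"
proof -
  have mean_zero: "(\<integral>x. h x * k x \<partial>unit_measure) = 0"
    if k: "k \<in> bumps a b" and ab: "0 < a" "b < 1" and k0: "(\<integral>x. k x \<partial>unit_measure) = 0" for k a b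
  proof -
    have kc: "continuous_on {0..1} k"
      by (rule bumps_continuous[OF k])
    have kint: "integrable unit_measure k"
      by (rule continuous_integrable_unit[OF kc])
    have left: "primitive k x = 0" if "x < a" for x
      unfolding primitive_def
      by (subst Bochner_Integration.integral_cong[where g = "\<lambda>_. 0"])
         (use that bumps_support[OF k] in \<open>auto simp: indicator_def\<close>)
    have right: "primitive k x = 0" if "x > b" for x
      unfolding primitive_def k0[symmetric]
      by (rule Bochner_Integration.integral_cong)
         (use that bumps_support[OF k] in \<open>auto simp: indicator_def\<close>)
    have ac: "abs_cont (primitive k) k"
      unfolding abs_cont_def using kint by (simp add: primitive_le_0)
    have der: "(primitive k has_vector_derivative k x) (at x)" for x
    proof -
      consider "x < a" | "x > b" | "0 < x" "x < 1"
        using ab by linarith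
      then show ?thesis
      proof cases
        case 1
        have "(primitive k has_vector_derivative 0) (at x)"
          by (rule has_vector_derivative_transform_within_open[of "\<lambda>_. 0" _ _ "{..<a}"])
             (use 1 left in auto)
        with 1 show ?thesis using bumps_support[OF k, of x] by simp
      next
        case 2
        have "(primitive k has_vector_derivative 0) (at x)"
          by (rule has_vector_derivative_transform_within_open[of "\<lambda>_. 0" _ _ "{b<..}"])
             (use 2 right in auto)
        with 2 show ?thesis using bumps_support[OF k, of x] by simp
      next
        case 3
        then have "at x within {0..1} = at x"
          by (intro at_within_interior) simp
        then show ?thesis
          using abs_cont_deriv[OF ac kc, of x] 3 by simp
      qed
    qed
    have "smooth_on UNIV (primitive k)"
      by (rule smooth_on_UNIV_if_closed_under_deriv[of "insert (primitive k) (bumps a b)"])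
         (use k der bumps_deriv in blast)+
    then have "test_function (primitive k)"
      by (rule test_functionI[of _ a b]) (use left right ab in \<open>auto simp: not_le\<close>)
    moreover have "nderiv UNIV 1 (primitive k) = k"
      using der by (auto simp: nderiv_Suc vector_derivative_at)
    ultimately show ?thesis
      using orth[of "primitive k"] by simp
  qed
  obtain n where n: "(\<integral>x. bump (1/4) (3/4) n x \<partial>unit_measure) \<noteq> 0"
    using ex_bump_integral_nonzero by blast
  define \<rho> where "\<rho> = bump (1/4) (3/4) n"
  define m where "m = (\<integral>x. \<rho> x \<partial>unit_measure)"
  define c where "c = (\<integral>x. h x * \<rho> x \<partial>unit_measure) / m"
  have m: "m \<noteq> 0"
    using n by (simp add: m_def \<rho>_def)
  define g where "g x = h x - c" for x
  have g: "integrable unit_measure g"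
    using h by (simp add: g_def [abs_def])
  have cont: "continuous_on {0..1} (bump a b n)" for a b n
    by (rule bumps_continuous[OF bump_in_bumps[OF order_refl order_refl]])
  have bump0: "(\<integral>x. g x * bump a b n x \<partial>unit_measure) = 0" if ab: "0 < a" "b < 1" for a b n
  proof -
    let ?M = "\<integral>x. bump a b n x \<partial>unit_measure"
    have [simp]: "integrable unit_measure (bump a b n)" "integrable unit_measure \<rho>"
        "integrable unit_measure (\<lambda>x. h x * bump a b n x)" "integrable unit_measure (\<lambda>x. h x * \<rho> x)"
      unfolding \<rho>_def by (intro continuous_integrable_unit integrable_mult_continuous h cont)+
    have "(\<integral>x. h x * (bump a b n x + (- ?M / m) * \<rho> x) \<partial>unit_measure) = 0"
    proof (rule mean_zero)
      show "(\<lambda>x. bump a b n x + (- ?M / m) * \<rho> x) \<in> bumps (min a (1/4)) (max b (3/4))"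
        unfolding \<rho>_def by (intro bumps.add bumps.scale bump_in_bumps) auto
      show "(\<integral>x. bump a b n x + (- ?M / m) * \<rho> x \<partial>unit_measure) = 0"
        using m by (simp add: m_def[symmetric])
    qed (use ab in auto)
    also have "(\<lambda>x. h x * (bump a b n x + (- ?M / m) * \<rho> x)) =
        (\<lambda>x. h x * bump a b n x + (- ?M / m) * (h x * \<rho> x))"
      by (auto simp: algebra_simps)
    also have "(\<integral>x. h x * bump a b n x + (- ?M / m) * (h x * \<rho> x) \<partial>unit_measure)
        = (\<integral>x. h x * bump a b n x \<partial>unit_measure) + (- ?M / m) * (\<integral>x. h x * \<rho> x \<partial>unit_measure)"
      by (subst Bochner_Integration.integral_add) auto
    also have "\<dots> = (\<integral>x. h x * bump a b n x \<partial>unit_measure) - c * ?M"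
      by (simp add: c_def)
    finally have "(\<integral>x. h x * bump a b n x \<partial>unit_measure) - c * ?M = 0" .
    moreover have "(\<integral>x. g x * bump a b n x \<partial>unit_measure) = (\<integral>x. h x * bump a b n x \<partial>unit_measure) - c * ?M"
      by (simp add: g_def left_diff_distrib)
    ultimately show ?thesis by simp
  qed
  have diff0: "primitive g b = primitive g a" if ab: "0 < a" "a < b" "b < 1" for a b
  proof -
    have "(\<integral>x. indicat_real {a<..<b} x *\<^sub>R g x \<partial>unit_measure) = 0"
      using tendsto_bump_integral[OF g, of a b] bump0[OF ab(1,3)] by (simp add: LIMSEQ_const_iff)
    moreover have "(\<integral>x. indicat_real {a<..<b} x *\<^sub>R g x \<partial>unit_measure)
        = (\<integral>x. indicat_real {..b} x *\<^sub>R g x - indicat_real {..a} x *\<^sub>R g x \<partial>unit_measure)"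
    proof (rule integral_cong_AE)
      show "AE x in unit_measure. indicat_real {a<..<b} x *\<^sub>R g x =
          indicat_real {..b} x *\<^sub>R g x - indicat_real {..a} x *\<^sub>R g x"
        using AE_unit_neq[of b] by eventually_elim (use ab in \<open>auto simp: indicator_def\<close>)
      have "integrable unit_measure (\<lambda>x. indicat_real {a<..<b} x *\<^sub>R g x)"
        using ab by (intro integrable_mult_indicator g) (auto simp: sets_restrict_space)
      then show "(\<lambda>x. indicat_real {a<..<b} x *\<^sub>R g x) \<in> borel_measurable unit_measure"
        by auto
    qed (use integrable_cut[OF g] in \<open>auto intro!: borel_measurable_diff\<close>)
    moreover have "\<dots> = primitive g b - primitive g a"
      unfolding primitive_def by (intro Bochner_Integration.integral_diff integrable_cut g)
    ultimately show ?thesis by simp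
  qed
  have const: "primitive g x = primitive g (1/2)" if "x \<in> {0<..<1}" for x
  proof -
    have x: "0 < x" "x < 1"
      using that by auto
    consider "x < 1/2" | "x = 1/2" | "1/2 < x"
      by linarith
    then show ?thesis
    proof cases
      case 1
      show ?thesis by (rule diff0[OF x(1) 1, symmetric]) simp
    next
      case 3
      show ?thesis by (rule diff0[OF _ 3 x(2)]) simp
    qed (rule arg_cong)
  qed
  have cl: "primitive g x = primitive g (1/2)" if "x \<in> {0..1}" for x
  proof (rule continuous_constant_on_closure[of "{0<..<1}" "primitive g" "primitive g (1/2)"])
    show "continuous_on (closure {0<..<1}) (primitive g)"
      by (rule continuous_on_subset[OF continuous_primitive[OF g]]) simp
    show "x \<in> closure {0<..<1}"
      using that by simp
  qed (rule const)
  have "primitive g x = 0" for x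
  proof -
    have "primitive g (1/2) = 0"
      using cl[of 0] by (simp add: primitive_le_0)
    then have unit: "primitive g y = 0" if "y \<in> {0..1}" for y
      using cl[OF that] by metis
    consider "x \<le> 0" | "x \<in> {0..1}" | "x \<ge> 1"
      by fastforce
    then show ?thesis
    proof cases
      case 3
      then show ?thesis using unit[of 1] by (simp add: primitive_ge_1)
    qed (use unit primitive_le_0 in auto)
  qed
  then have "AE x in unit_measure. g x = 0"
    by (rule AE_zero_if_primitive_zero[OF g])
  then have "AE x in unit_measure. h x = c"
    by eventually_elim (simp add: g_def)
  then show ?thesis ..
qed

text \<open>
  Derivatives of test functions are test functions, so \<open>h\<close> is constant; testing against a single
  bump of nonzero mean shows that the constant is \<open>0\<close>.
\<close>

lemma AE_zero_if_orthogonal: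
  assumes h: "integrable unit_measure h"
    and orth: "\<And>\<phi>. test_function \<phi> \<Longrightarrow> (\<integral>x. h x * \<phi> x \<partial>unit_measure) = 0"
  shows "AE x in unit_measure. h x = 0"
proof -
  obtain c where c: "AE x in unit_measure. h x = c"
    using du_Bois_Reymond[OF h] orth test_function_deriv by blast
  obtain n where n: "(\<integral>x. bump (1/4) (3/4) n x \<partial>unit_measure) \<noteq> 0"
    using ex_bump_integral_nonzero by blast
  let ?\<rho> = "bump (1/4) (3/4) n"
  have \<rho>: "test_function ?\<rho>"
    by (rule test_function_bumps[OF bump_in_bumps[OF order_refl order_refl]]) auto
  have \<rho>c: "continuous_on {0..1} ?\<rho>"
    by (rule test_function_continuous[OF \<rho>])
  have "0 = (\<integral>x. h x * ?\<rho> x \<partial>unit_measure)"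
    using orth[OF \<rho>] by simp
  also have "\<dots> = (\<integral>x. c * ?\<rho> x \<partial>unit_measure)"
  proof (rule integral_cong_AE)
    show "AE x in unit_measure. h x * ?\<rho> x = c * ?\<rho> x"
      using c by eventually_elim simp
    show "(\<lambda>x. h x * ?\<rho> x) \<in> borel_measurable unit_measure"
      using integrable_mult_continuous[OF h \<rho>c] by auto
    show "(\<lambda>x. c * ?\<rho> x) \<in> borel_measurable unit_measure"
      using continuous_measurable_unit[OF \<rho>c] by auto
  qed
  also have "\<dots> = c * (\<integral>x. ?\<rho> x \<partial>unit_measure)"
    using continuous_integrable_unit[OF \<rho>c] by simp
  finally have "c = 0" using n by simp
  with c show ?thesis by simp
qed

section \<open>Classical representatives of functions in the domain\<close>

lemma unit_derivative_unique:
  assumes "x \<in> {0..1::real}" "(f has_vector_derivative f') (at x within {0..1})"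
    "(f has_vector_derivative f'') (at x within {0..1})"
  shows "f' = f''"
  using vector_derivative_unique_within_closed_interval[of 0 1 x f f' f''] assms
  by (simp add: cbox_interval)

text \<open>
  The primitive of the difference is identically \<open>0\<close>, and by continuity its derivative is the
  difference at every point, the end points included.
\<close>

lemma continuous_AE_eq:
  assumes f: "continuous_on {0..1} f" and g: "continuous_on {0..1} g"
    and ae: "AE x in unit_measure. f x = (g x :: complex)" and x: "x \<in> {0..1}"
  shows "f x = g x"
proof -
  define h where "h = (\<lambda>x. f x - g x)"
  have h: "continuous_on {0..1} h"
    unfolding h_def by (intro continuous_intros f g)
  have "AE x in unit_measure. h x = 0"
    using ae by eventually_elim (simp add: h_def)
  then have "primitive h y = primitive (\<lambda>_. 0) y" for y
    by (intro primitive_cong_AE continuous_integrable_unit h) auto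
  then have "primitive h y = 0" for y
    by (simp add: primitive_def)
  then have ac: "abs_cont (\<lambda>_. 0) h"
    using continuous_integrable_unit[OF h] by (simp add: abs_cont_def)
  have "((\<lambda>_. 0) has_vector_derivative h x) (at x within {0..1})"
    by (rule abs_cont_deriv[OF ac h x])
  then have "h x = 0"
    by (rule unit_derivative_unique[OF x])
       (rule has_vector_derivative_const)
  then show ?thesis by (simp add: h_def)
qed

text \<open>
  Integration by parts shows that \<open>v - primitive w\<close> is orthogonal to all derivatives of test
  functions.
\<close>

lemma abs_cont_if_weak_deriv:
  assumes v: "integrable unit_measure v" and w: "integrable unit_measure w"
    and weak: "\<And>\<phi>. test_function \<phi> \<Longrightarrow>
      (\<integral>x. v x * nderiv UNIV 1 \<phi> x \<partial>unit_measure) = - (\<integral>x. w x * \<phi> x \<partial>unit_measure)"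
  shows "\<exists>f. abs_cont f w \<and> (AE x in unit_measure. v x = f x)"
proof -
  let ?W = "primitive w"
  have W: "abs_cont ?W w"
    using w by (simp add: abs_cont_def primitive_le_0)
  have Wint: "integrable unit_measure ?W"
    by (rule continuous_integrable_unit[OF abs_cont_continuous[OF W]])
  have "(\<integral>x. (v x - ?W x) * nderiv UNIV 1 \<phi> x \<partial>unit_measure) = 0" if \<phi>: "test_function \<phi>" for \<phi>
  proof -
    note d = test_function_continuous[OF test_function_deriv[OF \<phi>]]
    have "(\<integral>x. w x * \<phi> x \<partial>unit_measure) + (\<integral>x. ?W x * nderiv UNIV 1 \<phi> x \<partial>unit_measure) = 0"
      using integration_by_parts_mult[OF W test_function_abs_cont[OF \<phi>]]
      by (simp add: test_function_eq_0[OF \<phi>])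
    then show ?thesis
      using weak[OF \<phi>] integrable_mult_continuous[OF v d] integrable_mult_continuous[OF Wint d]
      by (simp add: left_diff_distrib add_eq_0_iff)
  qed
  then obtain c where c: "AE x in unit_measure. v x - ?W x = c"
    using du_Bois_Reymond[OF Bochner_Integration.integrable_diff[OF v Wint]] by blast
  have "AE x in unit_measure. v x = c + ?W x"
    using c by eventually_elim (auto simp: algebra_simps)
  moreover have "abs_cont (\<lambda>x. c + ?W x) w"
    unfolding abs_cont_def using w primitive_le_0[of 0 w] by simp
  ultimately show ?thesis by blast
qed

lemma weak_deriv_unique:
  assumes "has_weak_deriv k v w" "has_weak_deriv k v w'" shows "w = w'"
proof -
  have "(\<integral>x. (rep_L2 w x - rep_L2 w' x) * \<phi> x \<partial>unit_measure) = 0" if \<phi>: "test_function \<phi>" for \<phi>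
  proof -
    note i = integrable_mult_continuous[OF integrable_rep test_function_continuous[OF \<phi>]]
    from assms \<phi>
    have eq: "(\<integral>x. rep_L2 v x * nderiv UNIV k \<phi> x \<partial>unit_measure) = (-1) ^ k * (\<integral>x. rep_L2 w x * \<phi> x \<partial>unit_measure)"
      and eq': "(\<integral>x. rep_L2 v x * nderiv UNIV k \<phi> x \<partial>unit_measure) = (-1) ^ k * (\<integral>x. rep_L2 w' x * \<phi> x \<partial>unit_measure)"
      unfolding has_weak_deriv_def by blast+
    have "(\<integral>x. rep_L2 w x * \<phi> x \<partial>unit_measure) = (\<integral>x. rep_L2 w' x * \<phi> x \<partial>unit_measure)"
      using trans[OF eq[symmetric] eq'] by (subst (asm) mult_cancel_left) simp
    then show ?thesis
      using i by (simp add: left_diff_distrib)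
  qed
  then have "AE x in unit_measure. rep_L2 w x - rep_L2 w' x = 0"
    by (intro AE_zero_if_orthogonal Bochner_Integration.integrable_diff integrable_rep) auto
  then have "representative w (rep_L2 w')"
    by (simp add: representative_def)
  then show ?thesis
    by (rule representative_unique) (rule representative_rep)
qed

lemma weak_deriv_eq: "has_weak_deriv k v w \<Longrightarrow> weak_deriv k v = w"
  unfolding weak_deriv_def by (rule the_equality) (auto intro: weak_deriv_unique)

text \<open>
  Testing with \<open>\<phi>'\<close> in place of \<open>\<phi>\<close> shows that the \<open>(k+1)\<close>-st weak derivative is the weak derivative
  of the \<open>k\<close>-th one.
\<close>

lemma has_weak_deriv_step:
  assumes "has_weak_deriv k v w" "has_weak_deriv (Suc k) v z" and \<phi>: "test_function \<phi>"
  shows "(\<integral>x. rep_L2 w x * nderiv UNIV 1 \<phi> x \<partial>unit_measure) = - (\<integral>x. rep_L2 z x * \<phi> x \<partial>unit_measure)"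
proof -
  have "(-1) ^ k * (\<integral>x. rep_L2 w x * nderiv UNIV 1 \<phi> x \<partial>unit_measure)
      = (\<integral>x. rep_L2 v x * nderiv UNIV k (nderiv UNIV 1 \<phi>) x \<partial>unit_measure)"
    using assms(1) test_function_deriv[OF \<phi>] unfolding has_weak_deriv_def by simp
  also have "\<dots> = (-1) ^ Suc k * (\<integral>x. rep_L2 z x * \<phi> x \<partial>unit_measure)"
    using assms(2) \<phi> unfolding has_weak_deriv_def nderiv_nderiv by simp
  finally have "(-1) ^ k * (\<integral>x. rep_L2 w x * nderiv UNIV 1 \<phi> x \<partial>unit_measure)
      = (-1) ^ k * (- (\<integral>x. rep_L2 z x * \<phi> x \<partial>unit_measure))"
    by simp
  then show ?thesis
    by (subst (asm) mult_cancel_left) simp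
qed

lemma Sobolev_3_classical:
  assumes v: "v \<in> Sobolev 3"
  shows "\<exists>f f1 f2. representative v f \<and> abs_cont f f1 \<and> abs_cont f1 f2 \<and>
    abs_cont f2 (rep_L2 (weak_deriv 3 v))"
proof -
  obtain w1 w2 w3 where w: "has_weak_deriv 1 v w1" "has_weak_deriv 2 v w2" "has_weak_deriv 3 v w3"
    using v unfolding Sobolev_def by force
  have w3: "weak_deriv 3 v = w3"
    by (rule weak_deriv_eq[OF w(3)])
  have w0: "has_weak_deriv 0 v v"
    by (simp add: has_weak_deriv_def)
  obtain f2 where f2: "abs_cont f2 (rep_L2 w3)" "AE x in unit_measure. rep_L2 w2 x = f2 x"
    using abs_cont_if_weak_deriv[OF integrable_rep integrable_rep has_weak_deriv_step[of 2 v w2 w3]] w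
    by (auto simp: numeral_3_eq_3 numeral_2_eq_2)
  obtain f1 where f1: "abs_cont f1 (rep_L2 w2)" "AE x in unit_measure. rep_L2 w1 x = f1 x"
    using abs_cont_if_weak_deriv[OF integrable_rep integrable_rep has_weak_deriv_step[of 1 v w1 w2]] w
    by (auto simp: numeral_2_eq_2)
  obtain f where f: "abs_cont f (rep_L2 w1)" "AE x in unit_measure. rep_L2 v x = f x"
    using abs_cont_if_weak_deriv[OF integrable_rep integrable_rep has_weak_deriv_step[of 0 v v w1]] w w0
    by auto
  have "abs_cont f1 f2"
    by (rule abs_cont_cong_AE[OF f1(1) continuous_integrable_unit[OF abs_cont_continuous[OF f2(1)]] f2(2)])
  moreover have "abs_cont f f1"
    by (rule abs_cont_cong_AE[OF f(1) continuous_integrable_unit[OF abs_cont_continuous[OF f1(1)]] f1(2)])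
  ultimately show ?thesis
    using f2(1) f(2) unfolding w3 representative_def by blast
qed

abbreviation (input) A_op :: "L2 \<Rightarrow> L2"
  where "A_op v \<equiv> \<i> *\<^sub>C T_op v"

lemma A_op_eq: "A_op v = - weak_deriv 3 v"
proof -
  have "\<i> * (- \<i>) ^ 3 = (-1 :: complex)"
    by (simp add: power3_eq_cube)
  then show ?thesis
    by (simp add: T_op_def)
qed

text \<open>
  The classical content of membership in the domain: \<open>f\<close>, \<open>f1\<close>, \<open>f2\<close> are the continuous
  representatives of the derivatives of orders \<open>0\<close>, \<open>1\<close>, \<open>2\<close>, while the third derivative \<open>f3\<close>
  exists almost everywhere only.
\<close>

definition classical :: "real \<Rightarrow> (real \<Rightarrow> complex) \<Rightarrow> (real \<Rightarrow> complex) \<Rightarrow> (real \<Rightarrow> complex) \<Rightarrow>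
    (real \<Rightarrow> complex) \<Rightarrow> bool"
  where "classical \<beta> f f1 f2 f3 \<longleftrightarrow> abs_cont f f1 \<and> abs_cont f1 f2 \<and> abs_cont f2 f3 \<and>
    f 0 = 0 \<and> f 1 = 0 \<and> f1 1 = of_real \<beta> * f1 0"

text \<open>
  The boundary conditions are imposed on some \<open>C\<^sup>1\<close> representative; it agrees on the whole
  closed interval with the one obtained from the weak derivatives, and so do the derivatives.
\<close>

lemma T_dom_classical:
  assumes v: "v \<in> T_dom \<beta>"
  shows "\<exists>f f1 f2. representative v f \<and> classical \<beta> f f1 f2 (\<lambda>x. - rep_L2 (A_op v) x)"
proof -
  from v obtain g g' where g: "representative v g"
    "\<And>x. x \<in> {0..1} \<Longrightarrow> (g has_vector_derivative g' x) (at x within {0..1})"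
    "g 0 = 0" "g 1 = 0" "g' 1 = of_real \<beta> * g' 0"
    unfolding T_dom_def by blast
  from v have "v \<in> Sobolev 3"
    by (simp add: T_dom_def)
  then obtain f f1 f2 where f: "representative v f" "abs_cont f f1" "abs_cont f1 f2"
      "abs_cont f2 (rep_L2 (weak_deriv 3 v))"
    using Sobolev_3_classical by blast
  have "AE x in unit_measure. f x = g x"
    using g(1) f(1) unfolding representative_def by eventually_elim simp
  moreover have "continuous_on {0..1} g"
    using g(2) by (meson continuous_on_eq_continuous_within has_vector_derivative_continuous)
  ultimately have fg: "f x = g x" if "x \<in> {0..1}" for x
    using continuous_AE_eq abs_cont_continuous[OF f(2)] that by blast
  have f1g': "f1 x = g' x" if x: "x \<in> {0..1}" for x
  proof (rule unit_derivative_unique[OF x])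
    show "(f has_vector_derivative f1 x) (at x within {0..1})"
      by (rule abs_cont_deriv[OF f(2) abs_cont_continuous[OF f(3)] x])
    show "(f has_vector_derivative g' x) (at x within {0..1})"
      by (rule has_vector_derivative_transform[OF x fg g(2)[OF x]])
  qed
  have "AE x in unit_measure. rep_L2 (weak_deriv 3 v) x = - rep_L2 (A_op v) x"
    using representative_minus[OF representative_rep, of "weak_deriv 3 v"]
    unfolding A_op_eq representative_def by eventually_elim simp
  then have "abs_cont f2 (\<lambda>x. - rep_L2 (A_op v) x)"
    by (intro abs_cont_cong_AE[OF f(4)]) (auto intro: integrable_rep)
  then have "classical \<beta> f f1 f2 (\<lambda>x. - rep_L2 (A_op v) x)"
    unfolding classical_def using f g fg f1g' by auto
  with f(1) show ?thesis by blast
qed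

section \<open>The weighted energy\<close>

lemma weight_square_integrable:
  assumes f: "square_integrable f" shows "square_integrable (\<lambda>x. complex_of_real (c + x) * f x)"
proof -
  note [measurable] = square_integrableD[OF f]
  have [measurable]: "(\<lambda>x. complex_of_real (c + x)) \<in> borel_measurable unit_measure"
    by (intro continuous_measurable_unit continuous_intros)
  have "integrable unit_measure (\<lambda>x. (cmod (complex_of_real (c + x) * f x))\<^sup>2)"
  proof (rule Bochner_Integration.integrable_bound)
    show "integrable unit_measure (\<lambda>x. (\<bar>c\<bar> + 1)\<^sup>2 * (cmod (f x))\<^sup>2)"
      using f by (simp add: square_integrable_def)
    show "AE x in unit_measure. norm ((cmod (complex_of_real (c + x) * f x))\<^sup>2) \<le> norm ((\<bar>c\<bar> + 1)\<^sup>2 * (cmod (f x))\<^sup>2)"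
      by (rule AE_unit_cong)
         (auto simp: norm_mult power_mult_distrib simp del: of_real_add intro!: mult_right_mono power2_le_iff_abs_le[THEN iffD2])
  qed measurable
  moreover have "(\<lambda>x. complex_of_real (c + x) * f x) \<in> borel_measurable unit_measure"
    by measurable
  ultimately show ?thesis
    unfolding square_integrable_def by blast
qed

lift_definition weight :: "real \<Rightarrow> L2 \<Rightarrow> L2" is "\<lambda>c f x. complex_of_real (c + x) * f x"
proof -
  fix c f g assume *: "L2_eq f g"
  then have "AE x in unit_measure. f x = g x"
    by (simp add: L2_eq_def)
  then have "AE x in unit_measure. complex_of_real (c + x) * f x = complex_of_real (c + x) * g x"
    by eventually_elim simp
  with * show "L2_eq (\<lambda>x. complex_of_real (c + x) * f x) (\<lambda>x. complex_of_real (c + x) * g x)"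
    unfolding L2_eq_def using weight_square_integrable by blast
qed

text \<open>
  The bilinear form \<open>\<integral> (c + x) u \<bullet> v\<close>.
\<close>

definition energy :: "real \<Rightarrow> L2 \<Rightarrow> L2 \<Rightarrow> real"
  where "energy c u v = weight c u \<bullet> v"

lemma weight_abs:
  "square_integrable f \<Longrightarrow> weight c (abs_L2 f) = abs_L2 (\<lambda>x. complex_of_real (c + x) * f x)"
  by (rule weight.abs_eq) (simp add: L2_eq_def)

lemma inner_weight: "(complex_of_real r * a) \<bullet> b = r * (a \<bullet> b)"
  by (simp add: scaleR_conv_of_real[symmetric])

lemma inner_weight_right: "b \<bullet> (complex_of_real r * a) = r * (b \<bullet> a)"
  by (simp add: scaleR_conv_of_real[symmetric])

lemma energy_abs:
  "square_integrable f \<Longrightarrow> square_integrable g \<Longrightarrow>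
    energy c (abs_L2 f) (abs_L2 g) = (\<integral>x. (c + x) * (f x \<bullet> g x) \<partial>unit_measure)"
  unfolding energy_def weight_abs inner_abs_L2[OF weight_square_integrable] inner_weight ..

lemma integrable_weight_inner:
  "square_integrable f \<Longrightarrow> square_integrable g \<Longrightarrow> integrable unit_measure (\<lambda>x. (c + x) * (f x \<bullet> g x))"
  using integrable_inner_square[OF weight_square_integrable, of f g c] unfolding inner_weight .

lemma energy_rep: "energy c u v = (\<integral>x. (c + x) * (rep_L2 u x \<bullet> rep_L2 v x) \<partial>unit_measure)"
  using energy_abs[OF square_integrable_rep square_integrable_rep, of c u v] by (simp add: abs_rep_L2)

lemma energy_sym: "energy c u v = energy c v u"
  unfolding energy_rep by (simp add: inner_commute)

lemma norm_weight_le: "norm (weight c v) \<le> (\<bar>c\<bar> + 1) * norm v"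
proof -
  let ?f = "rep_L2 v"
  note sq = square_integrable_rep[of v]
  have "(norm (weight c v))\<^sup>2 = weight c (abs_L2 ?f) \<bullet> weight c (abs_L2 ?f)"
    by (simp add: power2_norm_eq_inner abs_rep_L2)
  also have "\<dots> = (\<integral>x. (c + x)\<^sup>2 * (?f x \<bullet> ?f x) \<partial>unit_measure)"
    unfolding weight_abs[OF sq] inner_abs_L2[OF weight_square_integrable[OF sq] weight_square_integrable[OF sq]]
      inner_weight inner_weight_right
    by (simp add: power2_eq_square mult.assoc)
  also have "\<dots> \<le> (\<integral>x. (\<bar>c\<bar> + 1)\<^sup>2 * (?f x \<bullet> ?f x) \<partial>unit_measure)"
  proof (rule integral_mono_AE)
    have "integrable unit_measure (\<lambda>x. (of_real (c + x) * ?f x) \<bullet> (of_real (c + x) * ?f x))"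
      by (intro integrable_inner_square weight_square_integrable sq)
    then show "integrable unit_measure (\<lambda>x. (c + x)\<^sup>2 * (?f x \<bullet> ?f x))"
      unfolding inner_weight inner_weight_right
      by (simp add: power2_eq_square mult.assoc)
    show "integrable unit_measure (\<lambda>x. (\<bar>c\<bar> + 1)\<^sup>2 * (?f x \<bullet> ?f x))"
      using integrable_inner_square[OF sq sq] by simp
    show "AE x in unit_measure. (c + x)\<^sup>2 * (?f x \<bullet> ?f x) \<le> (\<bar>c\<bar> + 1)\<^sup>2 * (?f x \<bullet> ?f x)"
      by (rule AE_unit_cong) (auto intro!: mult_right_mono power2_le_iff_abs_le[THEN iffD2])
  qed
  also have "\<dots> = ((\<bar>c\<bar> + 1) * norm v)\<^sup>2"
    by (simp add: power_mult_distrib power2_norm_eq_inner inner_L2_rep)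
  finally show ?thesis
    by (rule power2_le_imp_le) simp
qed

lemma weight_add: "weight c (u + v) = weight c u + weight c v"
  by transfer (rule L2_eqI; simp add: L2_eq_def distrib_left square_integrable_add weight_square_integrable del: of_real_add)

lemma weight_scaleR: "weight c (r *\<^sub>R v) = r *\<^sub>R weight c v"
  by transfer (rule L2_eqI; simp add: L2_eq_def square_integrable_scaleR weight_square_integrable del: of_real_add)

lemma bounded_linear_weight: "bounded_linear (weight c)"
  by (rule bounded_linear_intro[where K = "\<bar>c\<bar> + 1"])
     (use norm_weight_le[of c] in \<open>auto simp: weight_add weight_scaleR mult.commute\<close>)

lemma bounded_bilinear_energy: "bounded_bilinear (energy c)"
  unfolding energy_def by (rule bounded_bilinear.comp1[OF bounded_bilinear_inner bounded_linear_weight])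

lemma energy_bounds:
  assumes "c \<ge> 0"
  shows "c * (norm v)\<^sup>2 \<le> energy c v v" and "energy c v v \<le> (c + 1) * (norm v)\<^sup>2"
proof -
  let ?f = "rep_L2 v"
  note sq = square_integrable_rep[of v]
  note int = integrable_inner_square[OF sq sq] integrable_weight_inner[OF sq sq, of c]
  have n: "(norm v)\<^sup>2 = (\<integral>x. ?f x \<bullet> ?f x \<partial>unit_measure)"
    by (simp add: power2_norm_eq_inner inner_L2_rep)
  have "(\<integral>x. c * (?f x \<bullet> ?f x) \<partial>unit_measure) \<le> energy c v v"
    unfolding energy_rep
    by (rule integral_mono_AE) (use int in \<open>auto intro!: AE_unit_cong mult_right_mono\<close>)
  then show "c * (norm v)\<^sup>2 \<le> energy c v v"
    by (simp add: n)
  have "energy c v v \<le> (\<integral>x. (c + 1) * (?f x \<bullet> ?f x) \<partial>unit_measure)"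
    unfolding energy_rep
    by (rule integral_mono_AE) (use int in \<open>auto intro!: AE_unit_cong mult_right_mono\<close>)
  then show "energy c v v \<le> (c + 1) * (norm v)\<^sup>2"
    by (simp add: n)
qed

text \<open>
  The boundary value is included because it is what the boundary condition dissipates, and because
  interpolation has to control boundary terms by it.
\<close>

definition dissipation :: "(real \<Rightarrow> complex) \<Rightarrow> real"
  where "dissipation f' = (\<integral>x. (cmod (f' x))\<^sup>2 \<partial>unit_measure) + (cmod (f' 0))\<^sup>2"

lemma abs_cont_weight:
  assumes f: "abs_cont f f'" and f': "continuous_on {0..1} f'"
  shows "abs_cont (\<lambda>x. complex_of_real (c + x) * f x) (\<lambda>x. f x + complex_of_real (c + x) * f' x)"
proof (rule abs_cont_C1)
  fix x :: real assume x: "x \<in> {0..1}"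
  show "((\<lambda>x. complex_of_real (c + x) * f x) has_vector_derivative f x + complex_of_real (c + x) * f' x)
      (at x within {0..1})"
  proof -
    have "((\<lambda>x. complex_of_real (c + x)) has_vector_derivative of_real 1) (at x within {0..1})"
      by (rule has_vector_derivative_of_real) (auto intro!: derivative_eq_intros)
    from has_vector_derivative_mult[OF this abs_cont_deriv[OF f f' x]] show ?thesis
      by (simp add: add.commute)
  qed
qed (intro continuous_intros f' abs_cont_continuous[OF f])

text \<open>
  Three integrations by parts. The slope of the weight produces \<open>3/2 \<integral>|f'|\<^sup>2\<close>, up to a boundary
  term of the wrong sign; the constant part of the weight produces \<open>c (1 - \<beta>\<^sup>2) |f'(0)|\<^sup>2 / 2\<close>. The
  choice of \<open>c\<close> makes the total boundary contribution equal to \<open>3/2 |f'(0)|\<^sup>2\<close>.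
\<close>

lemma energy_identity:
  assumes f: "classical \<beta> f f1 f2 f3" and c: "c * (1 - \<beta>\<^sup>2) = 3 + \<beta>\<^sup>2"
  shows "(\<integral>x. f3 x \<bullet> (complex_of_real (c + x) * f x) \<partial>unit_measure) = 3 / 2 * dissipation f1"
proof -
  have f01: "abs_cont f f1" and f12: "abs_cont f1 f2" and f23: "abs_cont f2 f3"
    and bc: "f 0 = 0" "f 1 = 0" "f1 1 = of_real \<beta> * f1 0"
    using f by (auto simp: classical_def)
  note cont [continuous_intros] = abs_cont_continuous[OF f01] abs_cont_continuous[OF f12] abs_cont_continuous[OF f23]
  note int = continuous_integrable_unit
  define d where "d = (\<integral>x. f1 x \<bullet> f1 x \<partial>unit_measure)"
  define e where "e = (\<integral>x. f2 x \<bullet> (complex_of_real (c + x) * f1 x) \<partial>unit_measure)"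
  have "(\<integral>x. f3 x \<bullet> (complex_of_real (c + x) * f x) \<partial>unit_measure)
      + (\<integral>x. f2 x \<bullet> (f x + complex_of_real (c + x) * f1 x) \<partial>unit_measure) = 0"
    using integration_by_parts_inner[OF f23 abs_cont_weight[OF f01 cont(2), of c]] bc by simp
  also have "(\<integral>x. f2 x \<bullet> (f x + complex_of_real (c + x) * f1 x) \<partial>unit_measure)
      = (\<integral>x. f2 x \<bullet> f x \<partial>unit_measure) + e"
    unfolding inner_add_right e_def
    by (intro Bochner_Integration.integral_add int continuous_intros)
  finally have 1: "(\<integral>x. f3 x \<bullet> (complex_of_real (c + x) * f x) \<partial>unit_measure)
      + ((\<integral>x. f2 x \<bullet> f x \<partial>unit_measure) + e) = 0" .
  have 2: "(\<integral>x. f2 x \<bullet> f x \<partial>unit_measure) + d = 0"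
    using integration_by_parts_inner[OF f12 f01] bc by (simp add: d_def)
  have "e + (\<integral>x. f1 x \<bullet> (f1 x + complex_of_real (c + x) * f2 x) \<partial>unit_measure)
      = f1 1 \<bullet> (complex_of_real (c + 1) * f1 1) - f1 0 \<bullet> (complex_of_real (c + 0) * f1 0)"
    unfolding e_def by (rule integration_by_parts_inner[OF f12 abs_cont_weight[OF f12 cont(3), of c]])
  also have "(\<integral>x. f1 x \<bullet> (f1 x + complex_of_real (c + x) * f2 x) \<partial>unit_measure) = d + e"
  proof -
    have "(\<integral>x. f1 x \<bullet> (complex_of_real (c + x) * f2 x) \<partial>unit_measure) = e"
      unfolding e_def inner_weight_right
      by (simp add: inner_commute)
    moreover have "(\<integral>x. f1 x \<bullet> f1 x + f1 x \<bullet> (complex_of_real (c + x) * f2 x) \<partial>unit_measure)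
        = d + (\<integral>x. f1 x \<bullet> (complex_of_real (c + x) * f2 x) \<partial>unit_measure)"
      unfolding d_def by (intro Bochner_Integration.integral_add int continuous_intros)
    ultimately show ?thesis
      by (simp add: inner_add_right)
  qed
  also have "f1 1 \<bullet> (complex_of_real (c + 1) * f1 1) - f1 0 \<bullet> (complex_of_real (c + 0) * f1 0)
      = ((c + 1) * \<beta>\<^sup>2 - c) * (cmod (f1 0))\<^sup>2"
    unfolding inner_weight_right inner_weight bc(3)
    by (simp add: dot_square_norm norm_mult power_mult_distrib power2_eq_square algebra_simps)
  also have "(c + 1) * \<beta>\<^sup>2 - c = - 3"
    using c by (simp add: algebra_simps)
  finally have 3: "e + (d + e) = - 3 * (cmod (f1 0))\<^sup>2" .
  have "d = (\<integral>x. (cmod (f1 x))\<^sup>2 \<partial>unit_measure)"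
    by (simp add: d_def dot_square_norm)
  then show ?thesis
    using 1 2 3 by (simp add: dissipation_def)
qed

lemma energy_A_op:
  assumes v: "representative v f" and f: "classical \<beta> f f1 f2 (\<lambda>x. - rep_L2 (A_op v) x)"
    and c: "c * (1 - \<beta>\<^sup>2) = 3 + \<beta>\<^sup>2"
  shows "energy c v (A_op v) = - (3 / 2) * dissipation f1"
proof -
  have fc: "continuous_on {0..1} f"
    using f abs_cont_continuous by (auto simp: classical_def)
  have [measurable]: "f \<in> borel_measurable unit_measure"
    by (rule continuous_measurable_unit[OF fc])
  have [measurable]: "(\<lambda>x. complex_of_real (c + x)) \<in> borel_measurable unit_measure" "(\<lambda>x::real. c + x) \<in> borel_measurable unit_measure"
    by (intro continuous_measurable_unit continuous_intros)+
  have "energy c v (A_op v) = (\<integral>x. - ((- rep_L2 (A_op v) x) \<bullet> (complex_of_real (c + x) * f x)) \<partial>unit_measure)"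
    unfolding energy_rep
  proof (rule integral_cong_AE)
    show "AE x in unit_measure. (c + x) * (rep_L2 v x \<bullet> rep_L2 (A_op v) x)
        = - ((- rep_L2 (A_op v) x) \<bullet> (complex_of_real (c + x) * f x))"
      using v unfolding representative_def
      by eventually_elim (simp only: inner_weight_right, simp add: inner_commute)
  qed measurable
  also have "\<dots> = - (3 / 2 * dissipation f1)"
    unfolding integral_minus energy_identity[OF f c] ..
  finally show ?thesis by simp
qed

lemma primitive_diff_le:
  assumes w: "integrable unit_measure w"
  shows "cmod (primitive w y - primitive w x) \<le> (\<integral>t. cmod (w t) \<partial>unit_measure)"
proof -
  have "primitive w y - primitive w x
      = (\<integral>t. indicat_real {..y} t *\<^sub>R w t - indicat_real {..x} t *\<^sub>R w t \<partial>unit_measure)"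
    unfolding primitive_def by (intro Bochner_Integration.integral_diff[symmetric] integrable_cut w)
  also have "cmod \<dots> \<le> (\<integral>t. cmod (indicat_real {..y} t *\<^sub>R w t - indicat_real {..x} t *\<^sub>R w t) \<partial>unit_measure)"
    by (rule integral_norm_bound)
  also have "\<dots> \<le> (\<integral>t. cmod (w t) \<partial>unit_measure)"
    by (rule integral_mono)
       (use w integrable_cut[OF w] in \<open>auto simp: indicator_def intro!: Bochner_Integration.integrable_diff integrable_norm\<close>)
  finally show ?thesis .
qed

text \<open>
  The value at \<open>y\<close> differs from any other value by at most \<open>\<integral>|w|\<close>; average over the other point.
\<close>

lemma trace_bound:
  assumes h: "abs_cont h w" and w: "continuous_on {0..1} w" and y: "y \<in> {0..1}"
  shows "(cmod (h y))\<^sup>2 \<le> 2 * (\<integral>x. (cmod (h x))\<^sup>2 \<partial>unit_measure) + 2 * (\<integral>x. (cmod (w x))\<^sup>2 \<partial>unit_measure)"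
proof -
  define I where "I = (\<integral>x. cmod (w x) \<partial>unit_measure)"
  note hc = abs_cont_continuous[OF h]
  have I: "I\<^sup>2 \<le> (\<integral>x. (cmod (w x))\<^sup>2 \<partial>unit_measure)"
  proof -
    note sq = continuous_square_integrable[OF w]
    have "0 \<le> I" by (simp add: I_def)
    then have "I\<^sup>2 \<le> (norm (abs_L2 w))\<^sup>2"
      using integral_cmod_le_norm[OF sq] by (intro power_mono) (simp_all add: I_def)
    also have "\<dots> = (\<integral>x. (cmod (w x))\<^sup>2 \<partial>unit_measure)"
      unfolding power2_norm_eq_inner inner_abs_L2[OF sq sq] by (simp add: dot_square_norm)
    finally show ?thesis .
  qed
  have pt: "(cmod (h y))\<^sup>2 \<le> 2 * (cmod (h x))\<^sup>2 + 2 * I\<^sup>2" if x: "x \<in> {0..1}" for x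
  proof -
    have "h y - h x = primitive w y - primitive w x"
      using abs_contD[OF h x] abs_contD[OF h y] by (metis add_diff_cancel_left)
    then have "cmod (h y - h x) \<le> I"
      using primitive_diff_le[OF abs_cont_integrable[OF h]] by (simp add: I_def)
    then have "cmod (h y) \<le> cmod (h x) + I"
      using norm_triangle_sub[of "h y" "h x"] by simp
    then have "(cmod (h y))\<^sup>2 \<le> (cmod (h x) + I)\<^sup>2"
      by (intro power_mono) auto
    also have "\<dots> \<le> 2 * (cmod (h x))\<^sup>2 + 2 * I\<^sup>2"
      using sum_squares_bound[of "cmod (h x)" I] by (simp add: power2_sum)
    finally show ?thesis .
  qed
  have hi: "integrable unit_measure (\<lambda>x. (cmod (h x))\<^sup>2)"
    by (intro continuous_integrable_unit continuous_intros hc)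
  have "(\<integral>x. (cmod (h y))\<^sup>2 \<partial>unit_measure) \<le> (\<integral>x. 2 * (cmod (h x))\<^sup>2 + 2 * I\<^sup>2 \<partial>unit_measure)"
    by (rule integral_mono_AE) (use pt hi in \<open>auto intro!: AE_unit_cong\<close>)
  then have "(cmod (h y))\<^sup>2 \<le> 2 * (\<integral>x. (cmod (h x))\<^sup>2 \<partial>unit_measure) + 2 * I\<^sup>2"
    using hi by (simp add: measure_unit)
  with I show ?thesis by linarith
qed

lemma inner_Young:
  fixes a b :: complex
  assumes "s > 0" shows "a \<bullet> b \<le> s / 2 * (cmod a)\<^sup>2 + 1 / (2 * s) * (cmod b)\<^sup>2"
proof -
  have "0 \<le> (s * cmod a - cmod b)\<^sup>2 / (2 * s)"
    using assms by simp
  also have "\<dots> = s / 2 * (cmod a)\<^sup>2 + 1 / (2 * s) * (cmod b)\<^sup>2 - cmod a * cmod b"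
    using assms by (simp add: field_simps power2_eq_square)
  finally show ?thesis
    using norm_cauchy_schwarz[of a b] by linarith
qed

lemma integral_inner_Young:
  assumes s: "s > 0" and a: "continuous_on {0..1} a" and b: "continuous_on {0..1} b"
  shows "(\<integral>x. a x \<bullet> b x \<partial>unit_measure)
    \<le> s / 2 * (\<integral>x. (cmod (a x))\<^sup>2 \<partial>unit_measure) + 1 / (2 * s) * (\<integral>x. (cmod (b x))\<^sup>2 \<partial>unit_measure)"
proof -
  have i: "integrable unit_measure (\<lambda>x. (cmod (a x))\<^sup>2)" "integrable unit_measure (\<lambda>x. (cmod (b x))\<^sup>2)"
      "integrable unit_measure (\<lambda>x. a x \<bullet> b x)"
    by (intro continuous_integrable_unit continuous_intros a b)+
  have "(\<integral>x. a x \<bullet> b x \<partial>unit_measure)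
      \<le> (\<integral>x. s / 2 * (cmod (a x))\<^sup>2 + 1 / (2 * s) * (cmod (b x))\<^sup>2 \<partial>unit_measure)"
    by (rule integral_mono) (use i inner_Young[OF s] in auto)
  then show ?thesis
    using i by simp
qed

text \<open>
  This interpolates \<open>g = -f'''\<close> between \<open>f'\<close> and \<open>g'\<close>. As \<open>g\<close> vanishes at the end points,
  \<open>\<integral>|g|\<^sup>2 = \<integral>f''\<bullet>g'\<close>, and \<open>\<integral>|f''|\<^sup>2\<close> is controlled by \<open>f'\<close> and \<open>g\<close>: the boundary terms of this second
  integration by parts contain the values of \<open>f'\<close> at the end points, which the dissipation controls.
  The powers of \<open>s\<close> are those of the scaling in which \<open>s\<close> is a squared length.
\<close>

lemma interpolation:
  assumes f1: "abs_cont f1 f2" and f2: "abs_cont f2 (\<lambda>x. - g x)" and g: "abs_cont g g1"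
    and g1: "continuous_on {0..1} g1" and bc: "g 0 = 0" "g 1 = 0" "cmod (f1 1) \<le> cmod (f1 0)"
    and s: "0 < s" "s \<le> 1"
  shows "(\<integral>x. (cmod (g x))\<^sup>2 \<partial>unit_measure) \<le> 16 / s\<^sup>2 * dissipation f1 + 2 * s * dissipation g1"
proof -
  note f1c = abs_cont_continuous[OF f1] and f2c = abs_cont_continuous[OF f2] and gc = abs_cont_continuous[OF g]
  define a where "a = (\<integral>x. (cmod (g x))\<^sup>2 \<partial>unit_measure)"
  define m where "m = (\<integral>x. (cmod (f2 x))\<^sup>2 \<partial>unit_measure)"
  define d where "d = (\<integral>x. (cmod (f1 x))\<^sup>2 \<partial>unit_measure)"
  define b where "b = (\<integral>x. (cmod (g1 x))\<^sup>2 \<partial>unit_measure)"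
  define B where "B = (cmod (f1 0))\<^sup>2"
  have nonneg: "a \<ge> 0" "m \<ge> 0" "d \<ge> 0" "b \<ge> 0" "B \<ge> 0"
    by (auto simp: a_def m_def d_def b_def B_def)
  have "a = (\<integral>x. g1 x \<bullet> f2 x \<partial>unit_measure)"
    using integration_by_parts_inner[OF f2 g] bc by (simp add: a_def dot_square_norm inner_commute)
  also have "\<dots> \<le> s / 2 * b + 1 / (2 * s) * m"
    unfolding b_def m_def by (rule integral_inner_Young[OF s(1) g1 f2c])
  finally have am: "a \<le> s / 2 * b + 1 / (2 * s) * m" .
  have tr: "(cmod (f2 y))\<^sup>2 \<le> 2 * m + 2 * a" if "y \<in> {0..1}" for y
    using trace_bound[OF f2 _ that] gc by (simp add: m_def a_def continuous_on_minus)
  \<comment> \<open>The Young parameters put a small enough multiple of \<open>m + a\<close> on the right: \<open>m\<close> is absorbed there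
    because \<open>s \<le> 1\<close>, and \<open>a\<close> is absorbed in the last step.\<close>
  have s8: "s / 4 > 0" using s by simp
  have bd: "\<bar>f2 y \<bullet> f1 y\<bar> \<le> s / 8 * (2 * m + 2 * a) + 2 / s * B" if y: "y = 0 \<or> y = 1" for y
  proof -
    have "(cmod (f1 y))\<^sup>2 \<le> B"
      using y bc(3) by (auto simp: B_def intro: power_mono)
    then have "2 / s * (cmod (f1 y))\<^sup>2 \<le> 2 / s * B"
      using s by (intro mult_left_mono) auto
    moreover have "s / 8 * (cmod (f2 y))\<^sup>2 \<le> s / 8 * (2 * m + 2 * a)"
      using s tr[of y] y by (intro mult_left_mono) auto
    moreover have "f2 y \<bullet> f1 y \<le> s / 8 * (cmod (f2 y))\<^sup>2 + 2 / s * (cmod (f1 y))\<^sup>2"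
      "(- f2 y) \<bullet> f1 y \<le> s / 8 * (cmod (- f2 y))\<^sup>2 + 2 / s * (cmod (f1 y))\<^sup>2"
      using inner_Young[OF s8, of "f2 y" "f1 y"] inner_Young[OF s8, of "- f2 y" "f1 y"]
      by (simp_all add: mult.commute)
    ultimately show ?thesis by simp
  qed
  have "m = (\<integral>x. g x \<bullet> f1 x \<partial>unit_measure) + (f2 1 \<bullet> f1 1 - f2 0 \<bullet> f1 0)"
    using integration_by_parts_inner[OF f2 f1] by (simp add: m_def dot_square_norm)
  moreover have "(\<integral>x. g x \<bullet> f1 x \<partial>unit_measure) \<le> s / 4 * a + 1 / s * d"
    using integral_inner_Young[of "s / 2" g f1] s gc f1c by (simp add: a_def d_def)
  moreover have "m \<le> x + y + 2 * z" if "m = u + (p - q)" "u \<le> x + y" "\<bar>q\<bar> \<le> z" "\<bar>p\<bar> \<le> z" for p q u x y z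
    using that by linarith
  ultimately have "m \<le> s / 4 * a + 1 / s * d + 2 * (s / 8 * (2 * m + 2 * a) + 2 / s * B)"
    using bd[OF disjI1[OF refl]] bd[OF disjI2[OF refl]] by blast
  moreover have "s * m \<le> 1 * m"
    using s nonneg by (intro mult_right_mono) auto
  moreover have "s / 4 * a + 1 / s * d + 2 * (s / 8 * (2 * m + 2 * a) + 2 / s * B)
      = 3 / 4 * (s * a) + 1 / 2 * (s * m) + (d / s + 4 * (B / s))"
    by (simp add: algebra_simps)
  moreover have "(d + B) / s = d / s + B / s" "0 \<le> d / s"
    using s nonneg by (simp_all add: add_divide_distrib)
  moreover have "m \<le> 3 / 2 * x + 8 * z"
    if "m \<le> L" "y \<le> 1 * m" "L = 3 / 4 * x + 1 / 2 * y + (u + 4 * w)" "z = u + w" "0 \<le> u" for L x y z u w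
    using that by linarith
  ultimately have "m \<le> 3 / 2 * (s * a) + 8 * ((d + B) / s)"
    by blast
  then have "1 / s * m \<le> 1 / s * (3 / 2 * (s * a) + 8 * ((d + B) / s))"
    using s by (intro mult_left_mono) auto
  also have "\<dots> = 3 / 2 * a + 8 * ((d + B) / s\<^sup>2)"
    using s by (simp add: field_simps power2_eq_square)
  finally have "1 / s * m \<le> 3 / 2 * a + 8 * ((d + B) / s\<^sup>2)" .
  moreover have "1 / (2 * s) * m = 1 / 2 * (1 / s * m)" "16 / s\<^sup>2 * (d + B) = 16 * ((d + B) / s\<^sup>2)"
    by simp_all
  moreover have "a \<le> 4 * x + z" if "a \<le> x + y" "y = 1 / 2 * y'" "y' \<le> 3 / 2 * a + 8 * w" "z = 16 * w" for x y y' w z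
    using that by linarith
  ultimately have "a \<le> 4 * (s / 2 * b) + 16 / s\<^sup>2 * (d + B)"
    using am by blast
  moreover have "4 * (s / 2 * b) \<le> 2 * s * dissipation g1"
    unfolding dissipation_def b_def[symmetric] using s by simp
  ultimately have "a \<le> 16 / s\<^sup>2 * (d + B) + 2 * s * dissipation g1"
    by (subst add.commute) (rule order_trans[OF _ add_right_mono])
  then show ?thesis
    unfolding dissipation_def[of f1] a_def d_def B_def .
qed

lemma A_op_interpolation:
  assumes v: "v \<in> T_dom \<beta>" and Av: "A_op v \<in> T_dom \<beta>" and \<beta>: "\<bar>\<beta>\<bar> < 1"
    and c: "c * (1 - \<beta>\<^sup>2) = 3 + \<beta>\<^sup>2" and s: "0 < s" "s \<le> 1"
  shows "(norm (A_op v))\<^sup>2 \<le>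
    - (2 / 3) * (16 / s\<^sup>2 * energy c v (A_op v) + 2 * s * energy c (A_op v) (A_op (A_op v)))"
proof -
  obtain f f1 f2 where f: "representative v f" "classical \<beta> f f1 f2 (\<lambda>x. - rep_L2 (A_op v) x)"
    using T_dom_classical[OF v] by blast
  obtain g g1 g2 where g: "representative (A_op v) g"
      "classical \<beta> g g1 g2 (\<lambda>x. - rep_L2 (A_op (A_op v)) x)"
    using T_dom_classical[OF Av] by blast
  have ac: "abs_cont f1 f2" "abs_cont g g1" "abs_cont g1 g2"
    using f g by (auto simp: classical_def)
  note gc = abs_cont_continuous[OF ac(2)]
  have "abs_cont f2 (\<lambda>x. - g x)"
  proof (rule abs_cont_cong_AE)
    show "abs_cont f2 (\<lambda>x. - rep_L2 (A_op v) x)"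
      using f(2) by (simp add: classical_def)
    show "integrable unit_measure (\<lambda>x. - g x)"
      by (intro continuous_integrable_unit continuous_intros gc)
    show "AE x in unit_measure. - rep_L2 (A_op v) x = - g x"
      using g(1) unfolding representative_def by eventually_elim simp
  qed
  moreover have "cmod (f1 1) \<le> cmod (f1 0)"
    using f(2) \<beta> by (simp add: classical_def norm_mult mult_left_le_one_le)
  moreover have "g 0 = 0" "g 1 = 0"
    using g(2) by (auto simp: classical_def)
  ultimately have "(\<integral>x. (cmod (g x))\<^sup>2 \<partial>unit_measure) \<le> 16 / s\<^sup>2 * dissipation f1 + 2 * s * dissipation g1"
    using interpolation[OF ac(1) _ ac(2) abs_cont_continuous[OF ac(3)] _ _ _ s] by blast
  moreover have "(norm (A_op v))\<^sup>2 = (\<integral>x. (cmod (g x))\<^sup>2 \<partial>unit_measure)"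
    unfolding norm_L2_sq
  proof (rule integral_cong_AE)
    show "AE x in unit_measure. (cmod (rep_L2 (A_op v) x))\<^sup>2 = (cmod (g x))\<^sup>2"
      using g(1) unfolding representative_def by eventually_elim simp
    show "(\<lambda>x. (cmod (g x))\<^sup>2) \<in> borel_measurable unit_measure"
      by (intro continuous_measurable_unit continuous_intros gc)
  qed measurable
  ultimately have "(norm (A_op v))\<^sup>2 \<le> 16 / s\<^sup>2 * dissipation f1 + 2 * s * dissipation g1"
    by simp
  also have "p * x + q * y = - (2 / 3) * (p * (- (3 / 2) * x) + q * (- (3 / 2) * y))" for p q x y :: real
    by (simp add: algebra_simps)
  finally show ?thesis
    unfolding energy_A_op[OF f c] energy_A_op[OF g c] .
qed

section \<open>Strongly continuous semigroups\<close>

locale strongly_continuous =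
  fixes S :: "real \<Rightarrow> 'a::banach \<Rightarrow> 'a"
  assumes bounded_linear: "t \<ge> 0 \<Longrightarrow> bounded_linear (S t)"
    and S_0: "S 0 v = v"
    and S_add: "s \<ge> 0 \<Longrightarrow> t \<ge> 0 \<Longrightarrow> S (s + t) v = S s (S t v)"
    and tendsto_0: "((\<lambda>t. S t v) \<longlongrightarrow> v) (at_right 0)"
begin

definition generates :: "'a \<Rightarrow> 'a \<Rightarrow> bool"
  where "generates v w \<longleftrightarrow> ((\<lambda>h. inverse h *\<^sub>R (S h v - v)) \<longlongrightarrow> w) (at_right 0)"

text \<open>
  The uniform boundedness principle by Sokal's gliding hump. If \<open>S\<close> were unbounded near \<open>0\<close>, there
  would be times \<open>t\<^sub>n\<close> tending to \<open>0\<close> with \<open>\<parallel>S t\<^sub>n\<parallel> > n 3\<^sup>n\<close>. Sum up vectors of norm \<open>3\<^sup>-\<^sup>n\<close> on which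
  \<open>S t\<^sub>n\<close> nearly attains its norm, each with a sign that keeps \<open>S t\<^sub>n\<close> of the partial sum large.
  The later summands are too small to undo this, so the images of the limit under \<open>S t\<^sub>n\<close> are
  unbounded, against strong continuity.
\<close>

lemma locally_bounded:
  "\<exists>M \<delta>. \<delta> > 0 \<and> (\<forall>t v. 0 \<le> t \<longrightarrow> t \<le> \<delta> \<longrightarrow> norm (S t v) \<le> M * norm v)"
proof (rule ccontr)
  assume unbounded: "\<not> ?thesis"
  have "\<exists>t. 0 \<le> t \<and> t \<le> 1 / real (Suc n) \<and> onorm (S t) > real n * 3 ^ n" for n
  proof -
    have "0 < 1 / real (Suc n)" by simp
    then obtain t v where tv: "0 \<le> t" "t \<le> 1 / real (Suc n)" "\<not> norm (S t v) \<le> real n * 3 ^ n * norm v"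
      using unbounded by blast
    have "onorm (S t) * norm v > real n * 3 ^ n * norm v"
      using onorm[OF bounded_linear[OF tv(1)], of v] tv(3) by linarith
    then have "onorm (S t) > real n * 3 ^ n"
      using mult_right_less_imp_less norm_ge_zero by blast
    with tv show ?thesis by blast
  qed
  then obtain t where t: "\<And>n. 0 \<le> t n" "\<And>n. t n \<le> 1 / real (Suc n)" "\<And>n. onorm (S (t n)) > real n * 3 ^ n"
    by metis
  define T K where "T n = S (t n)" and "K n = onorm (T n)" for n
  have T: "bounded_linear (T n)" for n
    unfolding T_def by (rule bounded_linear[OF t(1)])
  have K: "K n > real n * 3 ^ n" for n
    using t(3) by (simp add: K_def T_def)
  have Kpos: "K n > 0" for n
    using K[of n] by (meson mult_nonneg_nonneg of_nat_0_le_iff order_le_less_trans zero_le_numeral zero_le_power)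
  have "\<exists>v. norm v = (1/3) ^ n \<and> norm (T n v) > 2 / 3 * K n * (1/3) ^ n" for n
  proof -
    interpret L: bounded_linear "T n" by (rule T)
    have "\<not> (\<forall>v. norm (T n v) \<le> 2 / 3 * K n * norm v)"
    proof
      assume "\<forall>v. norm (T n v) \<le> 2 / 3 * K n * norm v"
      then have "onorm (T n) \<le> 2 / 3 * K n"
        using Kpos[of n] by (intro onorm_bound) auto
      then have "K n \<le> 2 / 3 * K n"
        by (simp add: K_def)
      with Kpos[of n] show False by simp
    qed
    then obtain v where v: "norm (T n v) > 2 / 3 * K n * norm v"
      by (auto simp: not_le)
    then have "v \<noteq> 0"
      using L.zero by auto
    define r where "r = (1/3) ^ n / norm v"
    have r: "r > 0" using \<open>v \<noteq> 0\<close> by (simp add: r_def)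
    have rv: "norm (r *\<^sub>R v) = (1/3) ^ n"
      using \<open>v \<noteq> 0\<close> r by (simp add: r_def)
    have "r * norm (T n v) > r * (2 / 3 * K n * norm v)"
      using v r by (intro mult_strict_left_mono) auto
    also have "r * (2 / 3 * K n * norm v) = 2 / 3 * K n * norm (r *\<^sub>R v)"
      using r by simp
    also have "r * norm (T n v) = norm (T n (r *\<^sub>R v))"
      using r by (simp add: L.scaleR)
    finally show ?thesis
      using rv by metis
  qed
  then obtain v where v: "\<And>n. norm (v n) = (1/3) ^ n" "\<And>n. norm (T n (v n)) > 2 / 3 * K n * (1/3) ^ n"
    by metis
  \<comment> \<open>As \<open>2 v = (x + v) - (x - v)\<close>, one of the two signs gives an image at least as long as that of \<open>v\<close>.\<close>
  define step where "step n x = (if norm (T n (x + v n)) \<ge> norm (T n (v n)) then v n else - v n)" for n x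
  define X where "X = rec_nat 0 (\<lambda>n x. x + step n x)"
  have X_Suc: "X (Suc n) = X n + step n (X n)" and X_0: "X 0 = 0" for n
    by (simp_all add: X_def)
  define d where "d n = step n (X n)" for n
  have d: "norm (d n) \<le> (1/3) ^ n" for n
    using v(1)[of n] by (simp add: d_def step_def)
  have sum_d: "X n = (\<Sum>k<n. d k)" for n
    by (induction n) (simp_all add: X_0 X_Suc d_def)
  have geo: "summable (\<lambda>n. (1/3::real) ^ n)"
    by (rule summable_geometric) simp
  have summ: "summable d"
    by (rule summable_comparison_test'[OF geo, of 0]) (use d in auto)
  define x where "x = suminf d"
  have tail: "norm (x - X (Suc n)) \<le> 1 / 2 * (1/3) ^ n" for n
  proof -
    have "x - X (Suc n) = (\<Sum>k. d (k + Suc n))"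
      unfolding x_def sum_d by (rule suminf_minus_initial_segment[OF summ, symmetric])
    also have "norm \<dots> \<le> (\<Sum>k. (1/3) ^ Suc n * (1/3) ^ k)"
    proof (rule norm_suminf_le)
      show "norm (d (k + Suc n)) \<le> (1/3) ^ Suc n * (1/3) ^ k" for k
        using d[of "k + Suc n"] by (metis power_add add.commute)
    qed (intro summable_mult geo)
    also have "\<dots> = (1/3) ^ Suc n * (\<Sum>k. (1/3) ^ k)"
      by (rule suminf_mult[OF geo])
    also have "(\<Sum>k. (1/3::real) ^ k) = 3 / 2"
      by (subst suminf_geometric) auto
    finally show ?thesis by simp
  qed
  have big: "norm (T n (X (Suc n))) \<ge> norm (T n (v n))" for n
  proof (cases "norm (T n (X n + v n)) \<ge> norm (T n (v n))")
    case True
    then show ?thesis by (simp add: X_Suc step_def)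
  next
    case False
    interpret L: bounded_linear "T n" by (rule T)
    have "2 * norm (T n (v n)) = norm (T n (X n + v n) - T n (X n - v n))"
    proof -
      have "T n (X n + v n) - T n (X n - v n) = 2 *\<^sub>R T n (v n)"
        by (simp add: L.add L.diff scaleR_2)
      then show ?thesis by simp
    qed
    also have "\<dots> \<le> norm (T n (X n + v n)) + norm (T n (X n - v n))"
      by (rule norm_triangle_ineq4)
    finally have "norm (T n (X n - v n)) \<ge> norm (T n (v n))"
      using False by simp
    with False show ?thesis by (simp add: X_Suc step_def)
  qed
  have unb: "norm (T n x) > real n / 6" for n
  proof -
    interpret L: bounded_linear "T n" by (rule T)
    have "norm (T n (x - X (Suc n))) \<le> K n * norm (x - X (Suc n))"
      unfolding K_def by (rule onorm[OF T])
    also have "\<dots> \<le> K n * (1 / 2 * (1/3) ^ n)"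
      using tail Kpos[of n] by (intro mult_left_mono) auto
    finally have "norm (T n x - T n (X (Suc n))) \<le> K n * (1 / 2 * (1/3) ^ n)"
      by (simp add: L.diff)
    moreover have "norm (T n (X (Suc n))) \<le> norm (T n x) + norm (T n x - T n (X (Suc n)))"
      using norm_triangle_sub[of "T n (X (Suc n))" "T n x"] by (simp add: norm_minus_commute)
    ultimately have "norm (T n x) > 1 / 6 * (K n * (1/3) ^ n)"
      using big[of n] v(2)[of n] by simp
    moreover have "K n * (1/3) ^ n > real n"
      using mult_strict_right_mono[OF K[of n], of "(1/3) ^ n"] by (simp add: power_one_over)
    ultimately show ?thesis by simp
  qed
  have "eventually (\<lambda>h. norm (S h x) < norm x + 1) (at_right 0)"
    using tendsto_norm[OF tendsto_0[of x]] by (rule order_tendstoD) simp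
  then obtain b where b: "b > 0" "\<And>h. 0 < h \<Longrightarrow> h < b \<Longrightarrow> norm (S h x) < norm x + 1"
    by (auto simp: eventually_at_right_field)
  obtain n :: nat where n: "real n > max (6 * (norm x + 1)) (1 / b)"
    using reals_Archimedean2 by blast
  have "1 / b < real (Suc n)" using n by simp
  then have "1 / real (Suc n) < b"
    using b(1) by (simp add: field_simps)
  then have "t n < b" using t(2)[of n] by linarith
  then have "norm (S (t n) x) < norm x + 1"
    using b(2)[of "t n"] t(1)[of n] S_0[of x] by (cases "t n = 0") auto
  moreover have "norm (S (t n) x) > norm x + 1"
    using unb[of n] n by (simp add: T_def)
  ultimately show False by simp
qed

lemma bounded_on:
  assumes "T \<ge> 0"
  obtains M where "M > 0" "\<And>t v. 0 \<le> t \<Longrightarrow> t \<le> T \<Longrightarrow> norm (S t v) \<le> M * norm v"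
proof -
  obtain M0 \<delta> where \<delta>: "\<delta> > 0" and M0: "\<And>t v. 0 \<le> t \<Longrightarrow> t \<le> \<delta> \<Longrightarrow> norm (S t v) \<le> M0 * norm v"
    using locally_bounded by blast
  define M where "M = max M0 1"
  have M: "norm (S t v) \<le> M * norm v" if "0 \<le> t" "t \<le> \<delta>" for t v
    using M0[OF that, of v] mult_right_mono[of M0 M "norm v"] by (simp add: M_def)
  have M1: "M \<ge> 1" by (simp add: M_def)
  have *: "norm (S t v) \<le> M ^ Suc n * norm v" if "0 \<le> t" "t \<le> real (Suc n) * \<delta>" for n t v
    using that
  proof (induction n arbitrary: t v)
    case 0
    then show ?case using M by simp
  next
    case (Suc n)
    show ?case
    proof (cases "t \<le> \<delta>")
      case True
      have "M * norm v \<le> M ^ Suc (Suc n) * norm v"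
        using M1 power_increasing[of 1 "Suc (Suc n)" M] by (intro mult_right_mono) auto
      then show ?thesis using M[OF Suc.prems(1) True, of v] by linarith
    next
      case False
      have "S t v = S \<delta> (S (t - \<delta>) v)"
        using S_add[of \<delta> "t - \<delta>" v] False \<delta> by simp
      also have "norm \<dots> \<le> M * norm (S (t - \<delta>) v)"
        using M \<delta> by simp
      also have "\<dots> \<le> M * (M ^ Suc n * norm v)"
        using M1 False Suc.prems by (intro mult_left_mono Suc.IH) (auto simp: algebra_simps)
      finally show ?thesis by simp
    qed
  qed
  obtain n :: nat where n: "T / \<delta> < real n"
    using reals_Archimedean2 by blast
  then have "T \<le> real (Suc n) * \<delta>"
    using \<delta> by (simp add: field_simps)
  then show thesis
    using that[of "M ^ Suc n"] *[of _ n] M1 by (meson order_trans zero_less_one less_le_trans zero_less_power)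
qed

lemma small_increment:
  assumes "e > 0" obtains d where "d > 0" "\<And>h. 0 \<le> h \<Longrightarrow> h < d \<Longrightarrow> norm (S h v - v) < e"
proof -
  have "((\<lambda>h. norm (S h v - v)) \<longlongrightarrow> norm (v - v)) (at_right 0)"
    by (intro tendsto_intros tendsto_0)
  then have "eventually (\<lambda>h. norm (S h v - v) < e) (at_right 0)"
    by (rule order_tendstoD) (use assms in simp)
  then obtain d where "d > 0" "\<And>h. 0 < h \<Longrightarrow> h < d \<Longrightarrow> norm (S h v - v) < e"
    by (auto simp: eventually_at_right_field)
  then show thesis
    using that[of d] S_0[of v] assms by (metis diff_self norm_zero order_le_less)
qed

lemma S_diff: "t \<ge> 0 \<Longrightarrow> S t (v - w) = S t v - S t w"
  using bounded_linear linear_simps(2) by blast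

lemma S_scaleR: "t \<ge> 0 \<Longrightarrow> S t (r *\<^sub>R v) = r *\<^sub>R S t v"
  using bounded_linear linear_simps(5) by blast

lemma continuous_orbit: "continuous_on {0..} (\<lambda>t. S t v)"
  unfolding continuous_on_iff
proof (intro ballI allI impI)
  fix t e :: real assume t: "t \<in> {0..}" and e: "e > 0"
  obtain M where M: "M > 0" "\<And>s v. 0 \<le> s \<Longrightarrow> s \<le> t + 1 \<Longrightarrow> norm (S s v) \<le> M * norm v"
    using bounded_on[of "t + 1"] t by auto
  obtain d where d: "d > 0" "\<And>h. 0 \<le> h \<Longrightarrow> h < d \<Longrightarrow> norm (S h v - v) < e / M"
    using small_increment[of "e / M" v] e M(1) by auto
  have incr: "norm (S (r + h) v - S r v) < e" if "0 \<le> r" "r \<le> t + 1" "0 \<le> h" "h < d" for r h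
  proof -
    have "norm (S (r + h) v - S r v) = norm (S r (S h v - v))"
      using that by (simp add: S_add S_diff)
    also have "\<dots> \<le> M * norm (S h v - v)"
      using that by (intro M) auto
    also have "\<dots> < M * (e / M)"
      using d(2) that M(1) by (intro mult_strict_left_mono) auto
    finally show ?thesis using M(1) by simp
  qed
  show "\<exists>d>0. \<forall>s\<in>{0..}. dist s t < d \<longrightarrow> dist (S s v) (S t v) < e"
  proof (intro exI[of _ d] conjI ballI impI d)
    fix s :: real assume s: "s \<in> {0..}" "dist s t < d"
    show "dist (S s v) (S t v) < e"
    proof (cases "s \<ge> t")
      case True
      then show ?thesis using incr[of t "s - t"] s t by (simp add: dist_norm)
    next
      case False
      then show ?thesis using incr[of s "t - s"] s t by (simp add: dist_norm norm_minus_commute)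
    qed
  qed
qed

lemma generates_small:
  assumes "generates v w" "e > 0"
  obtains d where "d > 0" "\<And>h. 0 \<le> h \<Longrightarrow> h < d \<Longrightarrow> norm (S h v - v - h *\<^sub>R w) \<le> e * h"
proof -
  have "((\<lambda>h. norm (inverse h *\<^sub>R (S h v - v) - w)) \<longlongrightarrow> norm (w - w)) (at_right 0)"
    using assms(1) unfolding generates_def by (intro tendsto_intros)
  then have "eventually (\<lambda>h. norm (inverse h *\<^sub>R (S h v - v) - w) < e) (at_right 0)"
    by (rule order_tendstoD) (use assms in simp)
  then obtain d where d: "d > 0" "\<And>h. 0 < h \<Longrightarrow> h < d \<Longrightarrow> norm (inverse h *\<^sub>R (S h v - v) - w) < e"
    by (auto simp: eventually_at_right_field)
  have "norm (S h v - v - h *\<^sub>R w) \<le> e * h" if h: "0 \<le> h" "h < d" for h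
  proof (cases "h = 0")
    case True
    then show ?thesis by (simp add: S_0)
  next
    case False
    then have "S h v - v - h *\<^sub>R w = h *\<^sub>R (inverse h *\<^sub>R (S h v - v) - w)"
      by (simp add: scaleR_diff_right)
    then have "norm (S h v - v - h *\<^sub>R w) = h * norm (inverse h *\<^sub>R (S h v - v) - w)"
      using h by simp
    also have "\<dots> \<le> h * e"
      using d(2)[of h] h False by (intro mult_left_mono) auto
    finally show ?thesis by (simp add: mult.commute)
  qed
  with d(1) that show thesis by blast
qed

text \<open>
  To the left of \<open>t\<close> the increment is \<open>S s\<close> applied to an increment at \<open>0\<close>, with \<open>s < t\<close> variable;
  local boundedness makes the estimate uniform in \<open>s\<close>.
\<close>

lemma orbit_derivative:
  assumes gen: "generates v w" and t: "t \<ge> 0"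
  shows "((\<lambda>s. S s v) has_vector_derivative S t w) (at t within {0..})"
  unfolding has_vector_derivative_def has_derivative_within_alt
proof (intro conjI allI impI)
  show "bounded_linear (\<lambda>x. x *\<^sub>R S t w)"
    by (rule bounded_linear_scaleR_left)
  fix e :: real assume e: "e > 0"
  obtain M where M: "M > 0" "\<And>s v. 0 \<le> s \<Longrightarrow> s \<le> t \<Longrightarrow> norm (S s v) \<le> M * norm v"
    using bounded_on[OF t] by blast
  have e': "e / (2 * M) > 0" using e M(1) by simp
  obtain d1 where d1: "d1 > 0" "\<And>h. 0 \<le> h \<Longrightarrow> h < d1 \<Longrightarrow> norm (S h v - v - h *\<^sub>R w) \<le> e / (2 * M) * h"
    using generates_small[OF gen e'] by blast
  obtain d2 where d2: "d2 > 0" "\<And>h. 0 \<le> h \<Longrightarrow> h < d2 \<Longrightarrow> norm (S h w - w) < e / (2 * M)"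
    using small_increment[OF e', of w] by blast
  have "norm (S s v - S t v - (s - t) *\<^sub>R S t w) \<le> e * norm (s - t)"
    if s: "s \<ge> 0" "norm (s - t) < min d1 d2" for s
  proof (cases "s \<ge> t")
    case True
    define h where "h = s - t"
    have h: "h \<ge> 0" "h < d1" "s = t + h" using True s by (auto simp: h_def)
    have "S s v - S t v - (s - t) *\<^sub>R S t w = S t (S h v - v - h *\<^sub>R w)"
      using t h by (simp add: S_add S_diff S_scaleR)
    also have "norm \<dots> \<le> M * norm (S h v - v - h *\<^sub>R w)"
      using t by (intro M) auto
    also have "\<dots> \<le> M * (e / (2 * M) * h)"
      using M(1) h by (intro mult_left_mono d1) auto
    also have "\<dots> \<le> e * norm (s - t)"
      using M(1) h e by simp
    finally show ?thesis .
  next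
    case False
    define h where "h = t - s"
    have h: "h \<ge> 0" "h < d1" "h < d2" "t = s + h" using False s by (auto simp: h_def)
    have "S s v - S t v - (s - t) *\<^sub>R S t w = S s (h *\<^sub>R (S h w - w) - (S h v - v - h *\<^sub>R w))"
    proof -
      have "S t v = S s (S h v)" "S t w = S s (S h w)"
        using s h S_add by metis+
      then show ?thesis
        using s h by (simp add: S_diff S_scaleR scaleR_diff_right)
    qed
    also have "norm \<dots> \<le> M * norm (h *\<^sub>R (S h w - w) - (S h v - v - h *\<^sub>R w))"
      using s h by (intro M) auto
    also have "\<dots> \<le> M * (h * (e / (2 * M)) + e / (2 * M) * h)"
    proof (rule mult_left_mono)
      have "h * norm (S h w - w) \<le> h * (e / (2 * M))"
        using d2(2)[of h] h by (intro mult_left_mono) auto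
      then have "norm (h *\<^sub>R (S h w - w)) \<le> h * (e / (2 * M))"
        using h by simp
      with d1(2)[OF h(1,2)]
      show "norm (h *\<^sub>R (S h w - w) - (S h v - v - h *\<^sub>R w)) \<le> h * (e / (2 * M)) + e / (2 * M) * h"
        by (rule order_trans[OF norm_triangle_ineq4 add_mono, rotated])
    qed (use M(1) in simp)
    also have "\<dots> = e * norm (s - t)"
      using M(1) h by simp
    finally show ?thesis .
  qed
  then show "\<exists>d>0. \<forall>y\<in>{0..}. norm (y - t) < d \<longrightarrow>
      norm (S y v - S t v - (y - t) *\<^sub>R S t w) \<le> e * norm (y - t)"
    using d1(1) d2(1) by (intro exI[of _ "min d1 d2"]) auto
qed

lemma S_commute: "s \<ge> 0 \<Longrightarrow> t \<ge> 0 \<Longrightarrow> S s (S t v) = S t (S s v)"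
  by (metis S_add add.commute)

lemma generates_S:
  assumes "generates v w" "t \<ge> 0" shows "generates (S t v) (S t w)"
proof -
  have "((\<lambda>h. S t (inverse h *\<^sub>R (S h v - v))) \<longlongrightarrow> S t w) (at_right 0)"
    using assms(1) unfolding generates_def by (rule bounded_linear.tendsto[OF bounded_linear[OF assms(2)]])
  moreover have "eventually (\<lambda>h. S t (inverse h *\<^sub>R (S h v - v)) = inverse h *\<^sub>R (S h (S t v) - S t v)) (at_right 0)"
    using eventually_at_right_less[of 0]
    by eventually_elim (use assms(2) in \<open>simp add: S_scaleR S_diff S_commute\<close>)
  ultimately show ?thesis
    unfolding generates_def by (rule Lim_transform_eventually)
qed

lemma generates_scaleR_diff:
  assumes "generates v w" "generates v' w'"
  shows "generates (r *\<^sub>R (v - v')) (r *\<^sub>R (w - w'))"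
proof -
  have "((\<lambda>h. r *\<^sub>R (inverse h *\<^sub>R (S h v - v) - inverse h *\<^sub>R (S h v' - v'))) \<longlongrightarrow> r *\<^sub>R (w - w')) (at_right 0)"
    using assms unfolding generates_def by (intro tendsto_intros)
  moreover have "eventually (\<lambda>h. r *\<^sub>R (inverse h *\<^sub>R (S h v - v) - inverse h *\<^sub>R (S h v' - v')) =
      inverse h *\<^sub>R (S h (r *\<^sub>R (v - v')) - r *\<^sub>R (v - v'))) (at_right 0)"
    using eventually_at_right_less[of 0]
    by eventually_elim (simp add: S_scaleR S_diff algebra_simps)
  ultimately show ?thesis
    unfolding generates_def by (rule Lim_transform_eventually)
qed

lemma derivative_at_0_tendsto:
  fixes f :: "real \<Rightarrow> 'b::real_normed_vector"
  assumes "(f has_vector_derivative w) (at x within {x..})"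
  shows "((\<lambda>h. inverse h *\<^sub>R (f (x + h) - f x)) \<longlongrightarrow> w) (at_right 0)"
proof -
  have "((\<lambda>y. (1 / norm (y - x)) *\<^sub>R (f y - (f x + (y - x) *\<^sub>R w))) \<longlongrightarrow> 0) (at_right x)"
    using assms at_within_Ici_at_right[of x] by (simp add: has_vector_derivative_def has_derivative_within)
  then have "((\<lambda>h. (1 / norm (x + h - x)) *\<^sub>R (f (x + h) - (f x + (x + h - x) *\<^sub>R w))) \<longlongrightarrow> 0) (at_right 0)"
    by (simp add: filterlim_at_right_to_0[of _ _ x] add.commute)
  then have "((\<lambda>h. (1 / norm (x + h - x)) *\<^sub>R (f (x + h) - (f x + (x + h - x) *\<^sub>R w)) + w) \<longlongrightarrow> 0 + w) (at_right 0)"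
    by (intro tendsto_intros)
  moreover have "eventually (\<lambda>h. (1 / norm (x + h - x)) *\<^sub>R (f (x + h) - (f x + (x + h - x) *\<^sub>R w)) + w
      = inverse h *\<^sub>R (f (x + h) - f x)) (at_right 0)"
    using eventually_at_right_less[of 0]
    by eventually_elim (simp add: algebra_simps divide_inverse)
  ultimately have "((\<lambda>h. inverse h *\<^sub>R (f (x + h) - f x)) \<longlongrightarrow> 0 + w) (at_right 0)"
    by (rule Lim_transform_eventually)
  then show ?thesis
    by simp
qed

lemma orbit_integral_derivative:
  assumes "t \<ge> 0"
  shows "((\<lambda>s. integral {0..s} (\<lambda>r. S r v)) has_vector_derivative S t v) (at t within {0..})"
proof -
  have "((\<lambda>s. integral {0..s} (\<lambda>r. S r v)) has_vector_derivative S t v) (at t within {0..t + 1})"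
    by (rule integral_has_vector_derivative)
       (use assms in \<open>auto intro: continuous_on_subset[OF continuous_orbit]\<close>)
  moreover have "at t within {0..t + 1} = at t within {0..}"
    by (rule at_within_nhd[of _ "{..<t + 1}"]) auto
  ultimately show ?thesis by simp
qed

lemma orbit_integrable: "(\<lambda>r. S r v) integrable_on {0..h}"
  by (rule integrable_continuous_real) (rule continuous_on_subset[OF continuous_orbit], auto)

lemma increment_eq_integral:
  assumes "generates v w" "h \<ge> 0"
  shows "S h v - v = integral {0..h} (\<lambda>s. S s w)"
proof -
  have "((\<lambda>s. S s w) has_integral (S h v - S 0 v)) {0..h}"
    by (rule fundamental_theorem_of_calculus[OF assms(2)])
       (auto intro: has_vector_derivative_within_subset[OF orbit_derivative[OF assms(1)]])
  then show ?thesis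
    by (simp add: integral_unique S_0)
qed

lemma generates_if_increment:
  assumes "\<And>h. h \<ge> 0 \<Longrightarrow> S h v - v = integral {0..h} (\<lambda>s. S s w)"
  shows "generates v w"
proof -
  have "((\<lambda>h. inverse h *\<^sub>R (integral {0..0 + h} (\<lambda>s. S s w) - integral {0..0} (\<lambda>s. S s w))) \<longlongrightarrow> S 0 w) (at_right 0)"
    by (intro derivative_at_0_tendsto orbit_integral_derivative) simp
  then have "((\<lambda>h. inverse h *\<^sub>R integral {0..h} (\<lambda>s. S s w)) \<longlongrightarrow> w) (at_right 0)"
    by (simp add: S_0)
  moreover have "eventually (\<lambda>h. inverse h *\<^sub>R integral {0..h} (\<lambda>s. S s w) = inverse h *\<^sub>R (S h v - v)) (at_right 0)"
    using eventually_at_right_less[of 0] by eventually_elim (simp add: assms)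
  ultimately show ?thesis
    unfolding generates_def by (rule Lim_transform_eventually)
qed

text \<open>
  The relation \<open>S h v - v = \<integral>\<^sub>0\<^sup>h S s w\<close> characterises the generator and survives limits in both
  arguments.
\<close>

lemma generates_closed:
  assumes gen: "\<And>n. generates (v n) (w n)" and v: "v \<longlonglongrightarrow> v'" and w: "w \<longlonglongrightarrow> w'"
  shows "generates v' w'"
proof (rule generates_if_increment)
  fix h :: real assume h: "h \<ge> 0"
  obtain M where M: "M > 0" "\<And>s v. 0 \<le> s \<Longrightarrow> s \<le> h \<Longrightarrow> norm (S s v) \<le> M * norm v"
    using bounded_on[OF h] by blast
  have "(\<lambda>n. integral {0..h} (\<lambda>s. S s (w n))) \<longlonglongrightarrow> integral {0..h} (\<lambda>s. S s w')"
  proof (rule LIM_zero_cancel, rule tendsto_norm_zero_cancel, rule tendsto_sandwich[OF _ _ tendsto_const])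
    have "norm (integral {0..h} (\<lambda>s. S s (w n)) - integral {0..h} (\<lambda>s. S s w')) \<le> M * norm (w n - w') * (h - 0)" for n
    proof -
      have "integral {0..h} (\<lambda>s. S s (w n)) - integral {0..h} (\<lambda>s. S s w') = integral {0..h} (\<lambda>s. S s (w n) - S s w')"
        by (rule Henstock_Kurzweil_Integration.integral_diff[symmetric]) (rule orbit_integrable)+
      also have "\<dots> = integral {0..h} (\<lambda>s. S s (w n - w'))"
        by (rule Henstock_Kurzweil_Integration.integral_cong) (simp add: S_diff)
      also have "norm \<dots> \<le> M * norm (w n - w') * (h - 0)"
        by (rule integral_bound) (use h M in \<open>auto intro: continuous_on_subset[OF continuous_orbit]\<close>)
      finally show ?thesis .
    qed
    then show "eventually (\<lambda>n. norm (integral {0..h} (\<lambda>s. S s (w n)) - integral {0..h} (\<lambda>s. S s w'))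
        \<le> M * norm (w n - w') * (h - 0)) sequentially"
      by simp
    have "(\<lambda>n. M * norm (w n - w') * (h - 0)) \<longlonglongrightarrow> M * norm (w' - w') * (h - 0)"
      by (intro tendsto_intros w)
    then show "(\<lambda>n. M * norm (w n - w') * (h - 0)) \<longlonglongrightarrow> 0"
      by simp
  qed simp
  moreover have "integral {0..h} (\<lambda>s. S s (w n)) = S h (v n) - v n" for n
    using increment_eq_integral[OF gen h] by simp
  moreover have "(\<lambda>n. S h (v n) - v n) \<longlonglongrightarrow> S h v' - v'"
    by (intro tendsto_intros v bounded_linear.tendsto[OF bounded_linear[OF h]])
  ultimately show "S h v' - v' = integral {0..h} (\<lambda>s. S s w')"
    using LIMSEQ_unique by simp
qed

text \<open>
  \<open>S k\<close> shifts the interval of integration, so the increment is a difference of integrals over two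
  intervals of length \<open>k\<close>, at \<open>h\<close> and at \<open>0\<close>.
\<close>

lemma generates_average:
  assumes h: "h \<ge> 0"
  shows "generates (integral {0..h} (\<lambda>s. S s v)) (S h v - v)"
proof -
  define I where "I t = integral {0..t} (\<lambda>s. S s v)" for t
  have dI: "(I has_vector_derivative S t v) (at t within {0..})" if "t \<ge> 0" for t
    unfolding I_def by (rule orbit_integral_derivative[OF that])
  have I0: "I 0 = 0"
    by (simp add: I_def)
  have shift: "S k (I h) = I (h + k) - I k" if k: "k \<ge> 0" for k
  proof -
    have "S k (I h) = integral {0..h} (S k \<circ> (\<lambda>s. S s v))"
      unfolding I_def by (rule integral_linear[OF orbit_integrable bounded_linear[OF k], symmetric])
    also have "\<dots> = integral {0..h} (\<lambda>s. S (k + s) v)"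
      by (rule Henstock_Kurzweil_Integration.integral_cong) (use k in \<open>simp add: S_add\<close>)
    also have "\<dots> = I (k + h) - I (k + 0)"
    proof (rule integral_unique, rule fundamental_theorem_of_calculus[OF h])
      fix s assume s: "s \<in> {0..h}"
      have "((I \<circ> (\<lambda>s. k + s)) has_vector_derivative 1 *\<^sub>R S (k + s) v) (at s within {0..h})"
      proof (rule vector_diff_chain_within)
        show "((\<lambda>s. k + s) has_vector_derivative 1) (at s within {0..h})"
          by (auto intro!: derivative_eq_intros)
        show "(I has_vector_derivative S (k + s) v) (at (k + s) within (\<lambda>s. k + s) ` {0..h})"
          by (rule has_vector_derivative_within_subset[OF dI]) (use k s in auto)
      qed
      then show "((\<lambda>s. I (k + s)) has_vector_derivative S (k + s) v) (at s within {0..h})"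
        by (simp add: o_def)
    qed
    finally show ?thesis by (simp add: add.commute)
  qed
  have "((\<lambda>k. inverse k *\<^sub>R (I (h + k) - I h) - inverse k *\<^sub>R (I (0 + k) - I 0)) \<longlongrightarrow> S h v - S 0 v) (at_right 0)"
    by (intro tendsto_diff derivative_at_0_tendsto has_vector_derivative_within_subset[OF dI]) (use h in auto)
  moreover have "eventually (\<lambda>k. inverse k *\<^sub>R (I (h + k) - I h) - inverse k *\<^sub>R (I (0 + k) - I 0)
      = inverse k *\<^sub>R (S k (I h) - I h)) (at_right 0)"
    using eventually_at_right_less[of 0]
    by eventually_elim (simp add: shift I0 algebra_simps)
  ultimately have "((\<lambda>k. inverse k *\<^sub>R (S k (I h) - I h)) \<longlongrightarrow> S h v - S 0 v) (at_right 0)"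
    by (rule Lim_transform_eventually)
  then show ?thesis
    by (simp add: generates_def I_def S_0)
qed

lemma average_close:
  assumes "e > 0"
  obtains h where "h > 0" "norm (inverse h *\<^sub>R integral {0..h} (\<lambda>s. S s v) - v) < e"
proof -
  have "((\<lambda>h. inverse h *\<^sub>R (integral {0..0 + h} (\<lambda>s. S s v) - integral {0..0} (\<lambda>s. S s v))) \<longlongrightarrow> S 0 v) (at_right 0)"
    by (intro derivative_at_0_tendsto orbit_integral_derivative) simp
  then have "((\<lambda>h. inverse h *\<^sub>R integral {0..h} (\<lambda>s. S s v)) \<longlongrightarrow> v) (at_right 0)"
    by (simp add: S_0)
  then have "eventually (\<lambda>h. dist (inverse h *\<^sub>R integral {0..h} (\<lambda>s. S s v)) v < e) (at_right 0)"
    using assms by (rule tendstoD)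
  then have "eventually (\<lambda>h. h > 0 \<and> dist (inverse h *\<^sub>R integral {0..h} (\<lambda>s. S s v)) v < e) (at_right 0)"
    using eventually_at_right_less[of 0] by eventually_elim simp
  then obtain h where "h > 0" "dist (inverse h *\<^sub>R integral {0..h} (\<lambda>s. S s v)) v < e"
    using eventually_happens'[OF trivial_limit_at_right_real] by blast
  then show thesis
    using that by (simp add: dist_norm)
qed

text \<open>
  Averaging over a short time puts a vector into the domain; averaging twice puts it into the domain
  of the square of the generator.
\<close>

lemma dense_domain_square:
  assumes e: "e > 0"
  shows "\<exists>v' w z. generates v' w \<and> generates w z \<and> norm (v' - v) < e"
proof -
  have gen: "generates (inverse h *\<^sub>R integral {0..h} (\<lambda>s. S s x)) (inverse h *\<^sub>R (S h x - x))"
    if "h > 0" for h x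
  proof -
    have "generates 0 0"
      unfolding generates_def
      by (rule tendsto_eventually) (auto intro!: eventually_at_right_less[THEN eventually_mono] simp: linear_0[OF bounded_linear.linear[OF bounded_linear]])
    from generates_scaleR_diff[OF generates_average this, of h "inverse h" x] that show ?thesis by simp
  qed
  have e2: "e / 2 > 0" using e by simp
  obtain h where h: "h > 0" "norm (inverse h *\<^sub>R integral {0..h} (\<lambda>s. S s v) - v) < e / 2"
    using average_close[OF e2] by blast
  define y w where "y = inverse h *\<^sub>R integral {0..h} (\<lambda>s. S s v)" and "w = inverse h *\<^sub>R (S h v - v)"
  have yw: "generates y w"
    unfolding y_def w_def by (rule gen[OF h(1)])
  obtain k where k: "k > 0" "norm (inverse k *\<^sub>R integral {0..k} (\<lambda>s. S s y) - y) < e / 2"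
    using average_close[OF e2] by blast
  let ?v = "inverse k *\<^sub>R integral {0..k} (\<lambda>s. S s y)"
  have "generates ?v (inverse k *\<^sub>R (S k y - y))"
    by (rule gen[OF k(1)])
  moreover have "generates (inverse k *\<^sub>R (S k y - y)) (inverse k *\<^sub>R (S k w - w))"
    by (rule generates_scaleR_diff[OF generates_S[OF yw] yw]) (use k in auto)
  moreover have "norm (?v - v) < e"
    using norm_triangle_ineq[of "?v - y" "y - v"] h(2) k(2) by (simp add: y_def)
  ultimately show ?thesis by blast
qed

end

section \<open>Smoothing\<close>

lemma T_dom_generator:
  assumes C0: "C0_semigroup S" and gen: "generated_by S (T_dom \<beta>) A_op"
  shows "strongly_continuous S" and "strongly_continuous.generates S v w \<longleftrightarrow> v \<in> T_dom \<beta> \<and> w = A_op v"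
proof -
  show *: "strongly_continuous S"
    by (rule strongly_continuous.intro) (use C0 in \<open>auto simp: C0_semigroup_def\<close>)
  show "strongly_continuous.generates S v w \<longleftrightarrow> v \<in> T_dom \<beta> \<and> w = A_op v"
    using gen unfolding generated_by_def strongly_continuous.generates_def[OF *] by blast
qed

text \<open>
  The solution semigroup, with the constant \<open>c\<close> of the weight for which the energy identity has a
  clean right-hand side.
\<close>

locale dispersive =
  fixes S :: "real \<Rightarrow> L2 \<Rightarrow> L2" and \<beta> c :: real
  assumes C0: "C0_semigroup S" and gen: "generated_by S (T_dom \<beta>) A_op"
    and \<beta>: "\<bar>\<beta>\<bar> < 1" and c: "c * (1 - \<beta>\<^sup>2) = 3 + \<beta>\<^sup>2"
begin

sublocale strongly_continuous S
  by (rule T_dom_generator[OF C0 gen])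

lemma generates_iff: "generates v w \<longleftrightarrow> v \<in> T_dom \<beta> \<and> w = A_op v"
  by (rule T_dom_generator[OF C0 gen])

lemma generates_A: "v \<in> T_dom \<beta> \<Longrightarrow> generates v (A_op v)"
  by (simp add: generates_iff)

lemma S_T_dom:
  assumes "v \<in> T_dom \<beta>" "t \<ge> 0" shows "S t v \<in> T_dom \<beta>" and "A_op (S t v) = S t (A_op v)"
  using generates_S[OF generates_A[OF assms(1)] assms(2)] by (simp_all add: generates_iff)

lemma c_pos: "c > 0"
proof -
  have "\<beta>\<^sup>2 < 1"
    using \<beta> by (simp add: abs_square_less_1)
  then show ?thesis
    using c zero_less_mult_pos2[of c "1 - \<beta>\<^sup>2"] by (smt (verit) zero_le_power2)
qed

text \<open>
  With \<open>u = S t v\<close>, the functional \<open>E(u) + \<delta> t\<^sup>3 E(A u)\<close>, where \<open>E\<close> is the weighted energy, decreases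
  up to time \<open>1\<close>: both energies dissipate, and by interpolation with \<open>s\<close> proportional to \<open>t\<close> the
  dissipations absorb the term \<open>3 \<delta> t\<^sup>2 E(A u)\<close> that comes from differentiating the factor \<open>t\<^sup>3\<close>.
  At time \<open>0\<close> only \<open>E(v)\<close> remains.
\<close>

lemma smoothing_estimate:
  assumes v: "v \<in> T_dom \<beta>" and Av: "A_op v \<in> T_dom \<beta>" and t: "0 < t" "t \<le> 1"
  shows "1 / (64 * (c + 1) ^ 3) * t ^ 3 * (c * (norm (A_op (S t v)))\<^sup>2) \<le> (c + 1) * (norm v)\<^sup>2"
proof -
  define \<delta> where "\<delta> = 1 / (64 * (c + 1) ^ 3)"
  have \<delta>: "\<delta> > 0"
    using c_pos by (simp add: \<delta>_def)
  define E0 where "E0 r = energy c (S r v) (S r v)" for r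
  define E1 where "E1 r = energy c (S r (A_op v)) (S r (A_op v))" for r
  define D0 where "D0 r = energy c (S r v) (S r (A_op v))" for r
  define D1 where "D1 r = energy c (S r (A_op v)) (S r (A_op (A_op v)))" for r
  have dE: "((\<lambda>r. energy c (S r w) (S r w)) has_real_derivative 2 * energy c (S r w) (S r (A_op w))) (at r within {0..})"
    if "w \<in> T_dom \<beta>" "r \<ge> 0" for w r
  proof -
    have "((\<lambda>r. energy c (S r w) (S r w)) has_vector_derivative
        energy c (S r w) (S r (A_op w)) + energy c (S r (A_op w)) (S r w)) (at r within {0..})"
      by (rule bounded_bilinear.has_vector_derivative[OF bounded_bilinear_energy])
         (rule orbit_derivative[OF generates_A[OF that(1)] that(2)])+
    then show ?thesis
      by (simp add: has_real_derivative_iff_has_vector_derivative energy_sym[of c "S r (A_op w)"])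
  qed
  define F where "F r = E0 r + \<delta> * r ^ 3 * E1 r" for r
  define F' where "F' r = 2 * D0 r + \<delta> * (3 * r\<^sup>2 * E1 r + r ^ 3 * (2 * D1 r))" for r
  have dF: "(F has_real_derivative F' r) (at r within {0..})" if "r \<ge> 0" for r
    unfolding F_def [abs_def] F'_def E0_def E1_def D0_def D1_def
    by (rule derivative_eq_intros dE v Av that refl | simp)+ (simp add: algebra_simps)
  have F'_le: "F' r \<le> 0" if r: "0 < r" "r \<le> 1" for r
  proof -
    \<comment> \<open>This parameter makes the multiple of \<open>D1\<close> cancel exactly; \<open>\<delta>\<close> is then the value that cancels
      the multiple of \<open>D0\<close>.\<close>
    let ?s = "r / (2 * (c + 1))"
    have s: "0 < ?s" "?s \<le> 1"
      using r c_pos by (auto simp: field_simps)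
    have r0: "r \<ge> 0" using r by simp
    have Sv: "S r v \<in> T_dom \<beta>" "A_op (S r v) = S r (A_op v)" "A_op (S r v) \<in> T_dom \<beta>"
        "A_op (A_op (S r v)) = S r (A_op (A_op v))"
      using S_T_dom[OF v r0] S_T_dom[OF Av r0] by auto
    have "(norm (S r (A_op v)))\<^sup>2 \<le> - (2 / 3) * (16 / ?s\<^sup>2 * D0 r + 2 * ?s * D1 r)"
      using A_op_interpolation[OF Sv(1,3) \<beta> c s] Sv by (simp add: D0_def D1_def)
    moreover have "E1 r \<le> (c + 1) * (norm (S r (A_op v)))\<^sup>2"
      unfolding E1_def by (rule energy_bounds) (use c_pos in simp)
    ultimately have "E1 r \<le> (c + 1) * (- (2 / 3) * (16 / ?s\<^sup>2 * D0 r + 2 * ?s * D1 r))"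
      using c_pos by (smt (verit) mult_left_mono)
    then have "\<delta> * (3 * r\<^sup>2 * E1 r) \<le> \<delta> * (3 * r\<^sup>2 * ((c + 1) * (- (2 / 3) * (16 / ?s\<^sup>2 * D0 r + 2 * ?s * D1 r))))"
      using \<delta> r by (intro mult_left_mono) auto
    also have "\<dots> = - (\<delta> * (64 * (c + 1) ^ 3) * 2 * D0 r) - \<delta> * (r ^ 3 * (2 * D1 r))"
    proof -
      have "3 * r\<^sup>2 * (e * (- (2 / 3) * (16 / (r / (2 * e))\<^sup>2 * x + 2 * (r / (2 * e)) * y)))
          = - (64 * e ^ 3 * 2 * x) - r ^ 3 * (2 * y)" if "e > 0" for e x y :: real
        using that r by (simp add: field_simps power2_eq_square power3_eq_cube)
      from this[of "c + 1"] show ?thesis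
        using c_pos by (simp only: add_pos_pos zero_less_one) (simp add: right_diff_distrib)
    qed
    also have "\<delta> * (64 * (c + 1) ^ 3) = 1"
      using c_pos by (simp add: \<delta>_def)
    finally show ?thesis
      by (simp add: F'_def algebra_simps)
  qed
  have "F t \<le> F 0"
  proof -
    have "\<exists>r\<in>{0<..<t}. F t - F 0 = F' r * (t - 0)"
    proof (rule mvt_simple[OF t(1)])
      show "(F has_derivative (*) (F' r)) (at r within {0..t})" if "0 \<le> r" "r \<le> t" for r
        using has_field_derivative_subset[OF dF[OF that(1)], of "{0..t}"]
        by (auto simp: has_field_derivative_def)
    qed
    then obtain r where r: "0 < r" "r < t" "F t - F 0 = F' r * (t - 0)"
      by auto
    have "F' r * (t - 0) \<le> 0"
      using F'_le[of r] r t by (intro mult_nonpos_nonneg) auto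
    with r show ?thesis by simp
  qed
  also have "F 0 \<le> (c + 1) * (norm v)\<^sup>2"
    unfolding F_def E0_def using energy_bounds(2)[of c v] c_pos by (simp add: S_0)
  finally have "E0 t + \<delta> * t ^ 3 * E1 t \<le> (c + 1) * (norm v)\<^sup>2"
    by (simp add: F_def)
  moreover have "0 \<le> E0 t"
    unfolding E0_def using energy_bounds(1)[of c "S t v"] c_pos by (smt (verit) mult_nonneg_nonneg zero_le_power2)
  moreover have "\<delta> * t ^ 3 * (c * (norm (S t (A_op v)))\<^sup>2) \<le> \<delta> * t ^ 3 * E1 t"
    unfolding E1_def using t \<delta> c_pos energy_bounds(1)[of c "S t (A_op v)"] by (intro mult_left_mono) auto
  ultimately show ?thesis
    using S_T_dom(2)[OF v, of t] t by (simp add: \<delta>_def)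
qed

text \<open>
  By the estimate, \<open>A S(t)\<close> extends continuously from the dense domain of \<open>A\<^sup>2\<close>, and \<open>A\<close> is closed.
  Longer times reduce to times up to \<open>1\<close> by the semigroup law.
\<close>

lemma S_maps_into_domain:
  assumes t: "t > 0" shows "S t v \<in> T_dom \<beta>"
proof -
  have unit: "S t v \<in> T_dom \<beta>" if t: "0 < t" "t \<le> 1" for t v
  proof -
    define K where "K = 1 / (64 * (c + 1) ^ 3) * t ^ 3 * c"
    have K: "K > 0"
      using c_pos t by (simp add: K_def)
    have "\<exists>y. y \<in> T_dom \<beta> \<and> A_op y \<in> T_dom \<beta> \<and> norm (y - v) < 1 / real (Suc n)" for n
      using dense_domain_square[of "1 / real (Suc n)" v] by (auto simp: generates_iff)
    then obtain y where y: "\<And>n. y n \<in> T_dom \<beta>" "\<And>n. A_op (y n) \<in> T_dom \<beta>"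
        "\<And>n. norm (y n - v) < 1 / real (Suc n)"
      by metis
    have "(\<lambda>n. y n - v) \<longlonglongrightarrow> 0"
    proof (rule Lim_null_comparison)
      show "eventually (\<lambda>n. norm (y n - v) \<le> inverse (real (Suc n))) sequentially"
        using less_imp_le[OF y(3)] by (simp add: inverse_eq_divide del: of_nat_Suc)
    qed (rule LIMSEQ_inverse_real_of_nat)
    then have lim: "y \<longlonglongrightarrow> v"
      by (rule LIM_zero_cancel)
    have t0: "t \<ge> 0" using t by simp
    define L where "L = sqrt ((c + 1) / K)"
    have L: "L > 0"
      using K c_pos by (simp add: L_def)
    have diff: "norm (S t (A_op (y m)) - S t (A_op (y n))) \<le> L * norm (y m - y n)" for m n
    proof -
      have "generates (1 *\<^sub>R (y m - y n)) (1 *\<^sub>R (A_op (y m) - A_op (y n)))"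
        by (intro generates_scaleR_diff generates_A y)
      then have dom: "y m - y n \<in> T_dom \<beta>" and A: "A_op (y m - y n) = A_op (y m) - A_op (y n)"
        by (simp_all add: generates_iff)
      have "generates (1 *\<^sub>R (A_op (y m) - A_op (y n))) (1 *\<^sub>R (A_op (A_op (y m)) - A_op (A_op (y n))))"
        by (intro generates_scaleR_diff generates_A y)
      then have Adom: "A_op (y m - y n) \<in> T_dom \<beta>"
        by (simp add: generates_iff A)
      have "A_op (S t (y m - y n)) = S t (A_op (y m)) - S t (A_op (y n))"
        using S_T_dom(2)[OF dom t0] by (simp add: A S_diff t0)
      then have "K * (norm (S t (A_op (y m)) - S t (A_op (y n))))\<^sup>2 \<le> (c + 1) * (norm (y m - y n))\<^sup>2"
        using smoothing_estimate[OF dom Adom t] by (simp add: K_def)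
      then have "(norm (S t (A_op (y m)) - S t (A_op (y n))))\<^sup>2 \<le> (L * norm (y m - y n))\<^sup>2"
        using K c_pos by (simp add: L_def power_mult_distrib field_simps)
      then show ?thesis
        by (rule power2_le_imp_le) (use L in simp)
    qed
    have "Cauchy (\<lambda>n. S t (A_op (y n)))"
    proof (rule CauchyI)
      fix e :: real assume "e > 0"
      then have "e / L > 0" using L by simp
      then obtain N where N: "\<And>m n. m \<ge> N \<Longrightarrow> n \<ge> N \<Longrightarrow> norm (y m - y n) < e / L"
        using CauchyD[OF LIMSEQ_imp_Cauchy[OF lim]] by blast
      have "norm (S t (A_op (y m)) - S t (A_op (y n))) < e" if "m \<ge> N" "n \<ge> N" for m n
      proof -
        have "L * norm (y m - y n) < e"
          using N[OF that] L by (simp add: field_simps)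
        with diff[of m n] show ?thesis by linarith
      qed
      then show "\<exists>M. \<forall>m\<ge>M. \<forall>n\<ge>M. norm (S t (A_op (y m)) - S t (A_op (y n))) < e"
        by blast
    qed
    then obtain w where w: "(\<lambda>n. S t (A_op (y n))) \<longlonglongrightarrow> w"
      using Cauchy_convergent convergent_def by blast
    have "generates (S t v) w"
      by (rule generates_closed[OF generates_S[OF generates_A[OF y(1)] t0]
            bounded_linear.tendsto[OF bounded_linear[OF t0] lim] w])
    then show ?thesis
      by (simp add: generates_iff)
  qed
  have "S t v = S (min t 1) (S (t - min t 1) v)"
    using S_add[of "min t 1" "t - min t 1" v] t by simp
  then show ?thesis
    using unit[of "min t 1"] t by simp
qed

text \<open>
  Half of the time is spent on reaching the domain; \<open>A\<close> commutes with the other half, which is again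
  an orbit at a positive time.
\<close>

lemma S_maps_into_domain_powers:
  "t > 0 \<Longrightarrow> (A_op ^^ n) (S t v) \<in> T_dom \<beta>"
proof (induction n arbitrary: t v)
  case 0
  then show ?case by (simp add: S_maps_into_domain)
next
  case (Suc n)
  then have t2: "t / 2 > 0" by simp
  have "S t v = S (t / 2) (S (t / 2) v)"
    using S_add[of "t / 2" "t / 2" v] Suc.prems by simp
  then have "A_op (S t v) = S (t / 2) (A_op (S (t / 2) v))"
    using S_T_dom(2)[OF S_maps_into_domain[OF t2]] t2 by simp
  then have "(A_op ^^ Suc n) (S t v) = (A_op ^^ n) (S (t / 2) (A_op (S (t / 2) v)))"
    by (simp only: funpow_Suc_right o_apply)
  then show ?case
    using Suc.IH[OF t2] by simp
qed

end

text \<open>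
  The iterated derivatives agree with \<open>G k\<close> on the interval only, so each differentiation step has to
  pass between functions that may differ outside.
\<close>

lemma smooth_on_unit_interval:
  assumes G: "\<And>k x. x \<in> {0..1} \<Longrightarrow> (G k has_vector_derivative G (Suc k) x) (at x within {0..1})"
  shows "smooth_on {0..1} (G 0)"
proof -
  have *: "(nderiv {0..1} k (G 0) has_vector_derivative G (Suc k) x) (at x within {0..1})"
    if eq: "\<And>x. x \<in> {0..1} \<Longrightarrow> nderiv {0..1} k (G 0) x = G k x" and x: "x \<in> {0..1}" for k x
    by (rule has_vector_derivative_transform[OF x eq G[OF x]])
  have "x \<in> {0..1} \<Longrightarrow> nderiv {0..1} k (G 0) x = G k x" for k x
  proof (induction k arbitrary: x)
    case (Suc k)
    have "vector_derivative (nderiv {0..1} k (G 0)) (at x within cbox 0 1) = G (Suc k) x"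
      by (rule vector_derivative_within_cbox)
         (use *[of k x] Suc in \<open>auto simp: cbox_interval\<close>)
    then show ?case
      by (simp add: nderiv_Suc cbox_interval)
  qed simp
  with * show ?thesis
    unfolding smooth_on_def by (meson differentiableI_vector)
qed

text \<open>
  Since \<open>A\<close> is minus the third derivative, the derivatives of order \<open>3 n\<close>, \<open>3 n + 1\<close>, \<open>3 n + 2\<close> are
  \<open>(-1)\<^sup>n\<close> times those of orders \<open>0\<close>, \<open>1\<close>, \<open>2\<close> of the representative of \<open>A\<^sup>n v\<close>. The third derivative,
  known only almost everywhere for one step, becomes continuous in the next.
\<close>

lemma smooth_if_domain_powers:
  assumes v: "\<And>n. (A_op ^^ n) v \<in> T_dom \<beta>"
  shows "\<exists>f. representative v f \<and> smooth_on {0..1} f"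
proof -
  let ?v = "\<lambda>n. (A_op ^^ n) v"
  have "\<exists>f f1 f2. representative (?v n) f \<and> classical \<beta> f f1 f2 (\<lambda>x. - rep_L2 (?v (Suc n)) x)" for n
    using T_dom_classical[OF v[of n]] by simp
  then obtain f f1 f2 where rep: "\<And>n. representative (?v n) (f n)"
      and cl: "\<And>n. classical \<beta> (f n) (f1 n) (f2 n) (\<lambda>x. - rep_L2 (?v (Suc n)) x)"
    by metis
  have ac: "abs_cont (f n) (f1 n)" "abs_cont (f1 n) (f2 n)" for n
    using cl by (auto simp: classical_def)
  have "abs_cont (f2 n) (\<lambda>x. - f (Suc n) x)" for n
  proof (rule abs_cont_cong_AE)
    show "abs_cont (f2 n) (\<lambda>x. - rep_L2 (?v (Suc n)) x)"
      using cl by (simp add: classical_def)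
    show "integrable unit_measure (\<lambda>x. - f (Suc n) x)"
      by (intro continuous_integrable_unit continuous_intros abs_cont_continuous[OF ac(1)])
    show "AE x in unit_measure. - rep_L2 (?v (Suc n)) x = - f (Suc n) x"
      using rep[of "Suc n"] unfolding representative_def by eventually_elim simp
  qed
  note ac = ac this
  have d: "(f n has_vector_derivative f1 n x) (at x within {0..1})"
    "(f1 n has_vector_derivative f2 n x) (at x within {0..1})"
    "(f2 n has_vector_derivative - f (Suc n) x) (at x within {0..1})" if "x \<in> {0..1}" for n x
    by (intro abs_cont_deriv ac that continuous_intros abs_cont_continuous[OF ac(1)]
          abs_cont_continuous[OF ac(2)] abs_cont_continuous[OF ac(3)])+
  define G where "G k x = (-1) ^ (k div 3) *
    (if k mod 3 = 0 then f (k div 3) x else if k mod 3 = 1 then f1 (k div 3) x else f2 (k div 3) x)" for k x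
  have "(G k has_vector_derivative G (Suc k) x) (at x within {0..1})" if x: "x \<in> {0..1}" for k x
  proof -
    define n where "n = k div 3"
    have "k mod 3 < 3" by simp
    then consider "k = 3 * n" | "k = 3 * n + 1" | "k = 3 * n + 2"
      unfolding n_def by (metis One_nat_def Suc_1 add.right_neutral less_Suc_eq less_one mult_div_mod_eq numeral_3_eq_3)
    then show ?thesis
    proof cases
      case 1
      have "((\<lambda>x. (-1) ^ n * f n x) has_vector_derivative (-1) ^ n * f1 n x) (at x within {0..1})"
        by (intro has_vector_derivative_mult_right d x)
      moreover have "G k = (\<lambda>x. (-1) ^ n * f n x)" "G (Suc k) = (\<lambda>x. (-1) ^ n * f1 n x)"
        using 1 by (auto simp: G_def fun_eq_iff mod_Suc div_Suc)
      ultimately show ?thesis by simp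
    next
      case 2
      have "((\<lambda>x. (-1) ^ n * f1 n x) has_vector_derivative (-1) ^ n * f2 n x) (at x within {0..1})"
        by (intro has_vector_derivative_mult_right d x)
      moreover have "G k = (\<lambda>x. (-1) ^ n * f1 n x)" "G (Suc k) = (\<lambda>x. (-1) ^ n * f2 n x)"
        using 2 by (auto simp: G_def fun_eq_iff mod_Suc div_Suc)
      ultimately show ?thesis by simp
    next
      case 3
      have "((\<lambda>x. (-1) ^ n * f2 n x) has_vector_derivative (-1) ^ n * (- f (Suc n) x)) (at x within {0..1})"
        by (intro has_vector_derivative_mult_right d x)
      moreover have "G k = (\<lambda>x. (-1) ^ n * f2 n x)" "G (Suc k) = (\<lambda>x. (-1) ^ n * (- f (Suc n) x))"
        using 3 by (auto simp: G_def fun_eq_iff mod_Suc div_Suc)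
      ultimately show ?thesis by simp
    qed
  qed
  then have "smooth_on {0..1} (G 0)"
    by (rule smooth_on_unit_interval)
  moreover have "G 0 = f 0"
    by (simp add: G_def fun_eq_iff)
  moreover have "representative v (f 0)"
    using rep[of 0] by simp
  ultimately show ?thesis by auto
qed

theorem theorem1:
  fixes \<beta> :: real and S :: "real \<Rightarrow> L2 \<Rightarrow> L2" and u\<^sub>0 :: L2 and u :: "real \<Rightarrow> L2"
  assumes "0 < \<beta>" and "\<beta> < 1"
    and "\<And>\<mu>. eigenvalue (T_dom \<beta>) T_op \<mu> \<Longrightarrow> simple_eigenvalue (T_dom \<beta>) T_op \<mu>"
    and "C0_semigroup S"
    and "generated_by S (T_dom \<beta>) (\<lambda>v. \<i> *\<^sub>C T_op v)"
    and "\<And>t. t \<ge> 0 \<Longrightarrow> u t = S t u\<^sub>0"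
  shows "\<forall>t>0. \<exists>f. representative (u t) f \<and> smooth_on {0..1} f"
proof -
  have "\<beta>\<^sup>2 < 1"
    using assms(1,2) by (simp add: abs_square_less_1)
  then interpret dispersive S \<beta> "(3 + \<beta>\<^sup>2) / (1 - \<beta>\<^sup>2)"
    by unfold_locales (use assms(1,2,4,5) in auto)
  show ?thesis
    using smooth_if_domain_powers[OF S_maps_into_domain_powers] assms(6) by auto
qed

end
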